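(* Let $\mathbb F$ be an algebraically closed field, let $A(s)\in\mathbb F[s]^{p\times q}$ be a matrix pencil and let $P(s)\in\mathbb F[s]^{p\times q}$ be a matrix pencil of normal rank one. For every $\lambda\in\overline{\mathbb F}=\mathbb F\cup\{\infty\}$ the following hold (writing $\Delta_i=w_i(\lambda,A(s)+P(s))-w_i(\lambda,A(s))$): \begin{enumerate} \item[(i)] If both $A(s)$ and $A(s)+P(s)$ are regular, then $-1\le \Delta_i\le 1$ for all $i\ge 1$. \item[(ii)] If $A(s)$ is regular but $A(s)+P(s)$ is singular, then there exists an integer $a\ge1$ such that $-1\le\Delta_i\le 1$ for $1\le i\le a$ and $-2\le \Delta_i\le 0$ for $i\ge a+1$. \item[(iii)] If $A(s)$ is singular and $A(s)+P(s)$ is regular, then there exists an integer $a\ge 1$ such that $-1\le \Delta_i\le 1$ for $1\le i\le a$ and $0\le\Delta_i\le 2$ for $i\ge a+1$. \item[(iv)] If both $A(s)$ and $A(s)+P(s)$ are singular: \begin{itemize} \item If $\operatorname{rank}A(s)=\operatorname{rank}(A(s)+P(s))$ and $A(s)$ and $A(s)+P(s)$ have the same column minimal indices, then $-1\le\Delta_i\le 1$ for all $i\ge1$. \item If $\operatorname{rank}A(s)=\operatorname{rank}(A(s)+P(s))$ and $A(s)$ and $A(s)+P(s)$ have different column minimal indices, then there exist integers $b>a\ge1$ such that $-1\le\Delta_i\le1$ for $1\le i\le a$, $-(a+1)\le\Delta_i\le a+1$ for $a+1\le i\le b$, and $-b\le\Delta_i\le b$ for $i\ge b+1$. \item If $\operatorname{rank}A(s)<\operatorname{rank}(A(s)+P(s))$,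 then there exists an integer $a\ge1$ such that $-1\le\Delta_i\le 1$ for $1\le i\le a$ and $0\le \Delta_i\le a+1$ for $i\ge a+1$. \item If $\operatorname{rank}A(s)>\operatorname{rank}(A(s)+P(s))$, then there exists an integer $a\ge1$ such that $-1\le\Delta_i\le 1$ for $1\le i\le a$ and $-(a+1)\le \Delta_i\le 0$ for $i\ge a+1$. \end{itemize} \end{enumerate}
   Context: A matrix pencil is $A(s)=A_0+sA_1$ with $A_0,A_1\in\mathbb F^{p\times q}$. Its (normal) rank $\operatorname{rank}A(s)$ is its rank as a matrix over the field of rational functions $\mathbb F(s)$. It is regular if $p=q=\operatorname{rank}A(s)$, and singular otherwise. The column minimal indices of $A(s)$ are the sizes $k$ of the blocks $L_k(s)\in\mathbb F[s]^{k\times(k+1)}$ (with $s$ on the diagonal and $1$ on the superdiagonal), counted with multiplicity and including $q-\operatorname{rank}A(s)$ in total (zero indices corresponding to zero columns), in the Kronecker canonical form of $A(s)$ under strict equivalence $A(s)\mapsto PA(s)Q$ with $P,Q$ constant invertible matrices. We set $A(\infty):=A_1$. For $\lambda\in\overline{\mathbb F}$, an ordered set $(x_k,\dots,x_0)$ of vectors in $\mathbb F^q$ is a (right) Jordan chain of $A(s)$ at $\lambda$ of length $k+1$ if $x_0\ne0$ and: for $\lambda\in\mathbb F$, $A(\lambda)x_0=0$ and $A(\lambda)x_i=-A_1x_{i-1}$ for $1\le i\le k$; for $\lambda=\infty$, $A_1x_0=0$ and $A_1x_i=-A_0x_{i-1}$ for $1\le i\le k$. Let $\mathcal L^\ell_\lambda(A(s))$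 be the subspace spanned by all vectors of all Jordan chains of $A(s)$ at $\lambda$ of length at most $\ell$ ($\ell\ge1$), with $\mathcal L^0_\lambda(A(s))=\{0\}$ (and all these are $\{0\}$ if there is no Jordan chain at $\lambda$). The generalized Weyr characteristic is $w_i(\lambda,A(s))=\dim\big(\mathcal L^i_\lambda(A(s))/\mathcal L^{i-1}_\lambda(A(s))\big)$, $i\ge1$. *)

theory Defs
  imports "Jordan_Normal_Form.DL_Rank" "HOL-Computational_Algebra.Polynomial"
    "HOL-Computational_Algebra.Fraction_Field"
begin

text \<open>A matrix pencil A(s) = A0 + s A1 is represented by the pair (A0, A1) of
  constant matrices of the same dimensions p x q.\<close>
type_synonym 'a pencil = "'a mat \<times> 'a mat"

definition pencil_add :: "'a::field pencil \<Rightarrow> 'a pencil \<Rightarrow> 'a pencil" where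
  "pencil_add A P = (fst A + fst P, snd A + snd P)"

definition pencil_ratmat :: "'a::field pencil \<Rightarrow> 'a poly fract mat" where
  "pencil_ratmat A = mat (dim_row (fst A)) (dim_col (fst A))
     (\<lambda>(i,j). to_fract [: fst A $$ (i,j), snd A $$ (i,j) :])"

definition normal_rank :: "'a::field pencil \<Rightarrow> nat" where
  "normal_rank A = vec_space.rank (dim_row (fst A)) (pencil_ratmat A)"

definition regular_pencil :: "'a::field pencil \<Rightarrow> bool" where
  "regular_pencil A \<longleftrightarrow> dim_row (fst A) = dim_col (fst A) \<and> normal_rank A = dim_row (fst A)"

datatype 'a xpt = Fin 'a | Infty

text \<open>Right Jordan chain (x_k,...,x_0), stored as the list [x_0, x_1, ..., x_k].\<close>
definition jordan_chain :: "'a::field pencil \<Rightarrow> 'a xpt \<Rightarrow> 'a vec list \<Rightarrow> bool" where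
  "jordan_chain A lam xs \<longleftrightarrow>
     xs \<noteq> [] \<and> (\<forall>x\<in>set xs. x \<in> carrier_vec (dim_col (fst A))) \<and>
     xs ! 0 \<noteq> 0\<^sub>v (dim_col (fst A)) \<and>
     (case lam of
        Fin l \<Rightarrow> (fst A + l \<cdot>\<^sub>m snd A) *\<^sub>v (xs ! 0) = 0\<^sub>v (dim_row (fst A)) \<and>
                 (\<forall>i. 1 \<le> i \<and> i < length xs \<longrightarrow>
                    (fst A + l \<cdot>\<^sub>m snd A) *\<^sub>v (xs ! i) = - (snd A *\<^sub>v (xs ! (i - 1))))
      | Infty \<Rightarrow> snd A *\<^sub>v (xs ! 0) = 0\<^sub>v (dim_row (fst A)) \<and>
                 (\<forall>i. 1 \<le> i \<and> i < length xs \<longrightarrow>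
                    snd A *\<^sub>v (xs ! i) = - (fst A *\<^sub>v (xs ! (i - 1)))))"

definition chain_space :: "'a::field pencil \<Rightarrow> 'a xpt \<Rightarrow> nat \<Rightarrow> 'a vec set" where
  "chain_space A lam l =
     (if l = 0 then {0\<^sub>v (dim_col (fst A))}
      else LinearCombinations.module.span class_ring (module_vec TYPE('a) (dim_col (fst A)))
             (\<Union>{set xs | xs. jordan_chain A lam xs \<and> length xs \<le> l}))"

definition subspace_dim :: "'a::field itself \<Rightarrow> nat \<Rightarrow> 'a vec set \<Rightarrow> nat" where
  "subspace_dim ty n W = vectorspace.dim class_ring ((module_vec ty n)\<lparr>carrier := W\<rparr>)"

text \<open>Generalized Weyr characteristic w_i(lambda, A(s)) = dim L^i - dim L^(i-1), i \<ge> 1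
  (L^(i-1) \<subseteq> L^i, so this is dim (L^i / L^(i-1))).\<close>
definition weyr :: "'a::field pencil \<Rightarrow> 'a xpt \<Rightarrow> nat \<Rightarrow> int" where
  "weyr A lam i = int (subspace_dim TYPE('a) (dim_col (fst A)) (chain_space A lam i))
                 - int (subspace_dim TYPE('a) (dim_col (fst A)) (chain_space A lam (i - 1)))"

text \<open>Kronecker canonical form. Blocks (as pencils (B0,B1), i.e. B0 + s B1):
  L_k (k x (k+1), s on the diagonal, 1 on the superdiagonal), its transpose L_k^T,
  finite Jordan blocks (s - mu) I_k + N_k and infinite blocks I_k + s N_k (k \<ge> 1),
  where N_k is the nilpotent k x k Jordan block.\<close>
datatype 'a kblock = LB nat | LTB nat | JB nat 'a | NB nat

definition shift_mat :: "nat \<Rightarrow> nat \<Rightarrow> 'a::field mat" where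
  "shift_mat r c = mat r c (\<lambda>(i,j). if j = i + 1 then 1 else 0)"

definition diag_mat_rc :: "nat \<Rightarrow> nat \<Rightarrow> 'a::field mat" where
  "diag_mat_rc r c = mat r c (\<lambda>(i,j). if j = i then 1 else 0)"

fun kblock_pencil :: "'a::field kblock \<Rightarrow> 'a pencil" where
  "kblock_pencil (LB k) = (shift_mat k (k+1), diag_mat_rc k (k+1))"
| "kblock_pencil (LTB k) = (transpose_mat (shift_mat k (k+1)), transpose_mat (diag_mat_rc k (k+1)))"
| "kblock_pencil (JB k mu) = (shift_mat k k - mu \<cdot>\<^sub>m 1\<^sub>m k, 1\<^sub>m k)"
| "kblock_pencil (NB k) = (1\<^sub>m k, shift_mat k k)"

definition valid_kblock :: "'a kblock \<Rightarrow> bool" where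
  "valid_kblock b = (case b of JB k _ \<Rightarrow> k \<ge> 1 | NB k \<Rightarrow> k \<ge> 1 | _ \<Rightarrow> True)"

definition kcf_pencil :: "'a::field kblock list \<Rightarrow> 'a pencil" where
  "kcf_pencil bs = (diag_block_mat (map (fst \<circ> kblock_pencil) bs),
                    diag_block_mat (map (snd \<circ> kblock_pencil) bs))"

definition is_kcf :: "'a::field pencil \<Rightarrow> 'a kblock list \<Rightarrow> bool" where
  "is_kcf A bs \<longleftrightarrow> (\<forall>b\<in>set bs. valid_kblock b) \<and>
     (\<exists>P Q. P \<in> carrier_mat (dim_row (fst A)) (dim_row (fst A)) \<and>
            Q \<in> carrier_mat (dim_col (fst A)) (dim_col (fst A)) \<and>
            invertible_mat P \<and> invertible_mat Q \<and>
            P * fst A * Q = fst (kcf_pencil bs) \<and> P * snd A * Q = snd (kcf_pencil bs))"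

text \<open>Column minimal indices: multiset of the sizes k of the L_k blocks in the KCF
  (well defined by uniqueness of the KCF).\<close>
definition col_min_indices :: "'a::field pencil \<Rightarrow> nat multiset" where
  "col_min_indices A = (THE M. \<exists>bs. is_kcf A bs \<and> M = mset [k. LB k \<leftarrow> bs])"

end

(*
  Moving lambda to 0, let t i be the dimension of the space of polynomial vectors x of degree
  less than i with A(s) x(s) = 0 mod s^i, and m n that of the polynomial null vectors of degree
  less than n. Reading the coefficients of x as a Jordan chain gives
    w i = (t i - t (i - 1)) - (m (i - 1) - m (i - 2)).
  A pencil of normal rank one is u v(s)^T or u(s) v^T with u or v constant. In the first case
  both pencils arise from a common set of rows by adding one row; in the second case they
  become equivalent after adding the row v^T. Adding one row changes w i by -1 or 0 up to the
  first degree a in which the row acts nontrivially on null vectors, and by 0..a beyond it (only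
  the former occurs if the normal rank stays the same); the two cases of different rank and of
  equal rank are the combinations of two such changes. The increments t i - t (i - 1) of the two
  pencils always differ by at most 1, which gives the sharper bounds when the sequences m agree
  or one of them vanishes. Existence of the Kronecker form shows that m n is the sum of the
  truncated differences n - k over the column minimal indices k, so equal indices give equal m.
*)
theory Submission
  imports Defs "HOL-Library.Function_Algebras" "Jordan_Normal_Form.Char_Poly"
begin

subsection \<open>Finite-dimensional subspaces\<close>

text \<open>The spaces spanned by Jordan chains are not kernels of anything, which makes them hard
  to compare. Multiplying by a power of s, however, moves any vector of a chain of length at most i
  to the top coefficient i - 1 of a truncated solution, so they are images of the truncated solution
  spaces under the top coefficient. A truncated solution with zero top coefficient has degree below
  i - 1, its product with linear rows has degree below i and vanishes exactly; this is why m is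
  subtracted. Under one further row the increments of t move by 0 or 1, because shifting and cutting
  relate consecutive degrees, but those of m may jump. The constant a bounds the jump: from degree a
  on, the dimension of the values of the row on null vectors grows in every degree, and it never
  exceeds n + 1 for bound n, so at most a dimensions are left to make up. The column minimal indices
  are given by a definite description, so nothing is known of them before existence of a Kronecker
  form and uniqueness of its L blocks. Existence is the longest part, and the only one in which the
  field has to be algebraically closed.\<close>

definition fd :: "('a::field \<Rightarrow> 'b::ab_group_add \<Rightarrow> 'b) \<Rightarrow> 'b set \<Rightarrow> bool" where
  "fd s S \<longleftrightarrow> (\<exists>B. finite B \<and> S \<subseteq> Modules.module.span s B)"

context Vector_Spaces.vector_space
begin

text \<open>\<open>dim\<close> is the cardinality of a basis and says nothing about a set whose
  bases are infinite. Polynomials and polynomial vectors form infinite-dimensional spaces, so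
  dimensions are counted on sets satisfying \<open>fd\<close>, through this finite basis.\<close>

lemma fd_basis:
  assumes "fd scale S"
  obtains B where "finite B" "B \<subseteq> S" "independent B" "S \<subseteq> span B" "card B = dim S"
proof -
  obtain B where B: "B \<subseteq> S" "independent B" "S \<subseteq> span B" "card B = dim S"
    using basis_exists by blast
  obtain D where D: "finite D" "S \<subseteq> span D" using assms by (auto simp: fd_def)
  have "finite B" using independent_span_bound[OF D(1) B(2)] B(1) D(2) by auto
  then show ?thesis using that B by blast
qed

lemma fd_subset: "fd scale T \<Longrightarrow> S \<subseteq> span T \<Longrightarrow> fd scale S"
  unfolding fd_def by (metis order_trans span_minimal subspace_span)

lemma fd_span [simp]: "fd scale (span S) \<longleftrightarrow> fd scale S"
  using fd_subset[of "span S" S] fd_subset[of S "span S"] by (auto simp: span_superset span_span)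

lemma fd_finite: "finite S \<Longrightarrow> fd scale S"
  unfolding fd_def using span_superset by blast

lemma fd_Un: "fd scale S \<Longrightarrow> fd scale T \<Longrightarrow> fd scale (S \<union> T)"
proof -
  assume "fd scale S" "fd scale T"
  then obtain B D where "finite B" "S \<subseteq> span B" "finite D" "T \<subseteq> span D" by (auto simp: fd_def)
  then have "finite (B \<union> D)" "S \<union> T \<subseteq> span (B \<union> D)"
    using span_mono[of B "B \<union> D"] span_mono[of D "B \<union> D"] by auto
  then show ?thesis unfolding fd_def by blast
qed

lemma dim_mono_fd: "fd scale T \<Longrightarrow> S \<subseteq> span T \<Longrightarrow> dim S \<le> dim T"
  by (metis dim_le_card fd_basis span_minimal subspace_span order_trans)

lemma dim_subset_fd: "fd scale T \<Longrightarrow> S \<subseteq> T \<Longrightarrow> dim S \<le> dim T"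
  by (rule dim_mono_fd) (auto intro: span_base)

lemma independent_card_le_dim_fd: "fd scale T \<Longrightarrow> independent B \<Longrightarrow> B \<subseteq> span T \<Longrightarrow> finite B \<and> card B \<le> dim T"
  by (metis fd_basis independent_span_bound order_trans span_minimal subspace_span)

text \<open>A vector of \<open>T\<close> outside \<open>S\<close> would enlarge a basis of
  \<open>S\<close> to an independent subset of \<open>T\<close> with more than \<open>dim T\<close>
  elements.\<close>

lemma subspace_eq_if_dim_le:
  assumes "subspace S" "subspace T" "S \<subseteq> T" "fd scale T" "dim T \<le> dim S"
  shows "S = T"
proof (rule ccontr)
  assume "S \<noteq> T"
  then obtain x where x: "x \<in> T" "x \<notin> S" using assms(3) by blast
  have "fd scale S" using assms(3,4) fd_subset span_superset by blast
  then obtain B where B: "finite B" "B \<subseteq> S" "independent B" "S \<subseteq> span B" "card B = dim S"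
    by (rule fd_basis)
  have "span B = S" using B assms(1) by (simp add: span_minimal subset_antisym)
  then have "independent (insert x B)" using x B by (simp add: independent_insertI)
  moreover have "insert x B \<subseteq> span T" using x B assms(3) by (auto intro: span_base)
  ultimately have "card (insert x B) \<le> dim T" using independent_card_le_dim_fd assms(4) by blast
  moreover have "x \<notin> B" using x B by auto
  ultimately show False using B assms(5) by simp
qed

lemma dim_psubset_fd:
  assumes "subspace S" "subspace T" "S \<subset> T" "fd scale T"
  shows "dim S < dim T"
  using subspace_eq_if_dim_le[of S T] assms by force

lemma dim_zero_singleton: "dim {0} = 0"
  using dim_span[of "{}"] dim_eq_card_independent[OF independent_empty] by simp

lemma dim_eq_0_fd: "subspace S \<Longrightarrow> fd scale S \<Longrightarrow> dim S = 0 \<longleftrightarrow> S = {0}"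
  using subspace_eq_if_dim_le[OF subspace_single_0, of S] subspace_0[of S] dim_zero_singleton by auto

text \<open>The equation of dimensions says that \<open>zs\<close> is independent modulo the span of
  \<open>S\<close>. A list is returned because its members become positions in bases and strings,
  counted by length.\<close>

lemma extend_by_list:
  assumes "fd scale (S \<union> G)"
  obtains zs where "set zs \<subseteq> G" "span (S \<union> set zs) = span (S \<union> G)"
    "dim (S \<union> G) = dim S + length zs"
proof -
  have "fd scale S" using assms fd_subset[of "S \<union> G" S] span_superset by blast
  then obtain B where B: "finite B" "B \<subseteq> S" "independent B" "S \<subseteq> span B" "card B = dim S"
    by (rule fd_basis)
  obtain D where D: "B \<subseteq> D" "D \<subseteq> B \<union> G" "independent D" "B \<union> G \<subseteq> span D"
    using maximal_independent_subset_extend[of B "B \<union> G"] B(3) by auto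
  have "S \<union> G \<subseteq> span D" using D B by (metis Un_subset_iff order_trans span_mono)
  then have dS: "span (S \<union> G) = span D"
    using D B by (metis (no_types, lifting) Un_mono order_refl order_trans span_minimal span_mono
        subset_antisym subspace_span span_superset)
  have finD: "finite D" "card D = dim (S \<union> G)"
    using independent_card_le_dim_fd[OF assms D(3)] dS dim_span_eq_card_independent[OF D(3)]
    by (metis dim_span span_superset)+
  obtain zs where zs: "set zs = D - B" "distinct zs"
    using finite_distinct_list finD by (metis finite_Diff)
  have "span (S \<union> set zs) = span (S \<union> G)"
  proof (rule subset_antisym)
    have "S \<union> set zs \<subseteq> S \<union> G" using zs D by auto
    then show "span (S \<union> set zs) \<subseteq> span (S \<union> G)" by (rule span_mono)
    have "D \<subseteq> S \<union> set zs" using zs B by auto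
    then show "span (S \<union> G) \<subseteq> span (S \<union> set zs)" unfolding dS by (rule span_mono)
  qed
  moreover have "length zs = card D - card B"
    using zs distinct_card[of zs] card_Diff_subset[OF B(1) D(1)] by simp
  moreover have "card B \<le> card D" using D(1) finD(1) by (rule card_mono[rotated])
  ultimately show ?thesis using that[of zs] zs D B finD by auto
qed

lemma dim_Un_list_le: "fd scale S \<Longrightarrow> dim (S \<union> set xs) \<le> dim S + length xs"
proof -
  assume "fd scale S"
  then have "fd scale (S \<union> set xs)" by (simp add: fd_Un fd_finite)
  obtain B where B: "finite B" "B \<subseteq> S" "independent B" "S \<subseteq> span B" "card B = dim S"
    using fd_basis[OF \<open>fd scale S\<close>] .
  have "S \<union> set xs \<subseteq> span (B \<union> set xs)"
    using B span_mono[of B "B \<union> set xs"] span_superset[of "B \<union> set xs"] by auto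
  then have "dim (S \<union> set xs) \<le> card (B \<union> set xs)" using B by (intro dim_le_card) auto
  also have "\<dots> \<le> card B + card (set xs)" by (rule card_Un_le)
  also have "\<dots> \<le> dim S + length xs" using B card_length[of xs] by simp
  finally show ?thesis .
qed

text \<open>The coefficients of \<open>x\<close> with respect to \<open>B \<union> C\<close> are
  unique, so they vanish both outside \<open>B\<close> and outside \<open>C\<close>.\<close>

lemma span_Int_independent:
  assumes "independent (B \<union> C)" "B \<inter> C = {}" "x \<in> span B" "x \<in> span C"
  shows "x = 0"
proof -
  have "representation (B \<union> C) x = representation B x" "representation (B \<union> C) x = representation C x"
    using assms by (auto intro!: representation_extend)
  then have "representation B x b = 0" for b
    by (metis assms(2) disjoint_iff representation_ne_zero)
  then have "(\<Sum>b | representation B x b \<noteq> 0. representation B x b *s b) = 0" by simp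
  moreover have "independent B" using assms(1) independent_mono by blast
  ultimately show ?thesis using sum_nonzero_representation_eq assms(3) by metis
qed

text \<open>Coefficients belong to positions and not to vectors, so the list may contain
  repetitions.\<close>

lemma span_list_ext:
  assumes "v \<in> span (set xs)"
  obtains c where "v = (\<Sum>i<length xs. c i *s (xs ! i))"
  using assms
proof (induction xs arbitrary: v thesis)
  case Nil
  then show ?case by simp
next
  case (Cons x xs)
  from Cons.prems(2) obtain k where "v - k *s x \<in> span (set xs)"
    by (auto simp: span_breakdown_eq)
  then obtain c where c: "v - k *s x = (\<Sum>i<length xs. c i *s (xs ! i))" using Cons.IH by blast
  have "(\<Sum>i<length (x # xs). (case i of 0 \<Rightarrow> k | Suc j \<Rightarrow> c j) *s ((x # xs) ! i))
      = k *s x + (\<Sum>i<length xs. c i *s (xs ! i))"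
    by (simp add: sum.lessThan_Suc_shift del: sum.lessThan_Suc)
  also have "\<dots> = v" using c by (simp add: algebra_simps)
  finally show ?case using Cons.prems(1) by metis
qed

end

section \<open>Rank and nullity on a finite-dimensional subspace\<close>

context Vector_Spaces.linear
begin

lemma fd_image: "fd s1 S \<Longrightarrow> fd s2 (f ` S)"
  unfolding fd_def by (metis finite_imageI image_mono span_image)

text \<open>A basis of the kernel is extended to one of \<open>S\<close>, and \<open>f\<close> is
  injective on the span of the added vectors. The form relative to \<open>S\<close> is essential:
  \<open>f\<close> will act on infinite-dimensional spaces of polynomial vectors.\<close>

lemma rank_nullity:
  assumes S: "vs1.subspace S" and fdS: "fd s1 S"
  shows "vs1.dim S = vs2.dim (f ` S) + vs1.dim {x \<in> S. f x = 0}"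
proof -
  let ?K = "{x \<in> S. f x = 0}"
  have "fd s1 ?K" using fdS vs1.fd_subset[of S ?K] vs1.span_superset by blast
  then obtain B where B: "finite B" "B \<subseteq> ?K" "vs1.independent B" "?K \<subseteq> vs1.span B" "card B = vs1.dim ?K"
    by (rule vs1.fd_basis)
  obtain D where D: "B \<subseteq> D" "D \<subseteq> S" "vs1.independent D" "S \<subseteq> vs1.span D"
    using vs1.maximal_independent_subset_extend[of B S] B(2,3) by auto
  have "D \<subseteq> vs1.span S" using D(2) vs1.span_superset[of S] by blast
  then have finD: "finite D" "card D = vs1.dim S"
    using vs1.independent_card_le_dim_fd[OF fdS D(3)] D vs1.basis_card_eq_dim[of D S] by auto
  define C where "C = D - B"
  have DC: "D = B \<union> C" "B \<inter> C = {}" using D by (auto simp: C_def)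
  have indC: "vs1.independent C" using D(3) DC vs1.independent_mono by blast
  have CS: "vs1.span C \<subseteq> S" using D S DC by (simp add: vs1.span_minimal)
  have inj: "inj_on f (vs1.span C)"
  proof (subst inj_on_iff_eq_0)
    show "\<forall>x\<in>vs1.span C. f x = 0 \<longrightarrow> x = 0"
      using vs1.span_Int_independent[of B C] D(3) DC B(4) CS by blast
  qed simp
  have ind: "vs2.independent (f ` C)" by (rule independent_injective_image[OF indC inj])
  have im: "f ` S \<subseteq> vs2.span (f ` C)"
  proof
    fix y assume "y \<in> f ` S"
    then have "y \<in> f ` vs1.span D" using D by auto
    then have "y \<in> vs2.span (f ` D)" by (simp add: span_image)
    moreover have "f ` D \<subseteq> insert 0 (f ` C)" using DC B by auto
    ultimately show "y \<in> vs2.span (f ` C)" by (metis vs2.span_insert_0 vs2.span_mono subsetD)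
  qed
  have "card (f ` C) = vs2.dim (f ` S)"
    using ind im D DC by (intro vs2.basis_card_eq_dim) auto
  moreover have "card (f ` C) = card C"
    using inj inj_on_subset vs1.span_superset by (metis card_image)
  moreover have "card D = card B + card C" using DC finD B by (simp add: card_Un_disjoint)
  ultimately show ?thesis using B finD by simp
qed

end

subsection \<open>Polynomial vectors orthogonal to a set of rows\<close>

text \<open>Functions on all naturals give one additive group for vectors of every length. Scalars
  are constants: dimensions of spaces of polynomial vectors are taken over the ground field.\<close>

definition pscale :: "'a::field \<Rightarrow> (nat \<Rightarrow> 'a poly) \<Rightarrow> nat \<Rightarrow> 'a poly" where
  "pscale c x = (\<lambda>i. Polynomial.smult c (x i))"

lemma pscale_apply [simp]: "pscale c x i = Polynomial.smult c (x i)"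
  by (simp add: pscale_def)

interpretation ps: Vector_Spaces.vector_space pscale
  by unfold_locales (auto simp: pscale_def fun_eq_iff smult_add_right smult_add_left)

interpretation pl: Vector_Spaces.vector_space "Polynomial.smult :: 'a::field \<Rightarrow> 'a poly \<Rightarrow> 'a poly"
  by unfold_locales (auto simp: smult_add_right smult_add_left)

lemma sum_fun_apply: "(\<Sum>a\<in>A. f a) k = (\<Sum>a\<in>A. f a k)"
  by (induction A rule: infinite_finite_induct) auto

text \<open>Stated over a commutative ring, since it serves for polynomials and for rational
  functions alike.\<close>

definition dotp :: "nat \<Rightarrow> (nat \<Rightarrow> 'b::comm_ring) \<Rightarrow> (nat \<Rightarrow> 'b) \<Rightarrow> 'b" where
  "dotp q r x = (\<Sum>i<q. r i * x i)"

lemma dotp_add_right: "dotp q r (x + y) = dotp q r x + dotp q r y"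
  by (simp add: dotp_def algebra_simps sum.distrib)

lemma dotp_add_left: "dotp q (r + r') x = dotp q r x + dotp q r' x"
  by (simp add: dotp_def algebra_simps sum.distrib)

lemma dotp_scale_right: "dotp q r (pscale c x) = Polynomial.smult c (dotp q r x)"
  by (simp add: dotp_def pl.scale_sum_right)

lemma dotp_scale_left: "dotp q (pscale c r) x = Polynomial.smult c (dotp q r x)"
  by (simp add: dotp_def pl.scale_sum_right)

lemma dotp_zero_right [simp]: "dotp q r 0 = 0"
  by (simp add: dotp_def)

lemma dotp_zero_left [simp]: "dotp q 0 x = 0"
  by (simp add: dotp_def)

lemma dotp_mult_right: "dotp q r (\<lambda>i. c * x i) = c * dotp q r x"
  by (simp add: dotp_def sum_distrib_left algebra_simps)

lemma linear_dotp: "Vector_Spaces.linear pscale Polynomial.smult (dotp q r)"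
  by unfold_locales (simp_all add: dotp_add_right dotp_scale_right)

section \<open>Truncated solutions and exact null vectors of bounded degree\<close>

definition PP :: "nat \<Rightarrow> 'a::field poly set" where
  "PP n = {p. \<forall>j\<ge>n. coeff p j = 0}"

definition PV :: "nat \<Rightarrow> nat \<Rightarrow> (nat \<Rightarrow> 'a::field poly) set" where
  "PV q n = {x. (\<forall>i\<ge>q. x i = 0) \<and> (\<forall>i. x i \<in> PP n)}"

text \<open>A pencil enters only through the set \<open>R\<close> of its rows, so that adding a row
  is \<open>insert\<close>. The dimensions \<open>dimX\<close> and \<open>dimM\<close> of
  \<open>XS\<close> and \<open>MS\<close> are the sequences t and m of the overview.\<close>

definition XS :: "nat \<Rightarrow> (nat \<Rightarrow> 'a::field poly) set \<Rightarrow> nat \<Rightarrow> (nat \<Rightarrow> 'a poly) set" where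
  "XS q R n = {x \<in> PV q n. \<forall>r\<in>R. \<forall>j<n. coeff (dotp q r x) j = 0}"

definition MS :: "nat \<Rightarrow> (nat \<Rightarrow> 'a::field poly) set \<Rightarrow> nat \<Rightarrow> (nat \<Rightarrow> 'a poly) set" where
  "MS q R n = {x \<in> PV q n. \<forall>r\<in>R. dotp q r x = 0}"

definition dimX :: "nat \<Rightarrow> (nat \<Rightarrow> 'a::field poly) set \<Rightarrow> nat \<Rightarrow> nat" where
  "dimX q R n = ps.dim (XS q R n)"

definition dimM :: "nat \<Rightarrow> (nat \<Rightarrow> 'a::field poly) set \<Rightarrow> nat \<Rightarrow> nat" where
  "dimM q R n = ps.dim (MS q R n)"

lemma PP_sum_monom: "p \<in> PP n \<Longrightarrow> p = (\<Sum>j<n. Polynomial.smult (coeff p j) (monom 1 j))"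
  by (rule poly_eqI) (auto simp: PP_def coeff_sum if_distrib sum.delta cong: if_cong)

lemma PP_subset_span: "PP n \<subseteq> pl.span ((\<lambda>j. monom 1 j) ` {..<n})"
proof
  fix p :: "'a poly" assume "p \<in> PP n"
  then have "p = (\<Sum>j<n. Polynomial.smult (coeff p j) (monom 1 j))" by (rule PP_sum_monom)
  also have "\<dots> \<in> pl.span ((\<lambda>j. monom 1 j) ` {..<n})"
    by (intro pl.span_sum pl.span_scale pl.span_base) auto
  finally show "p \<in> pl.span ((\<lambda>j. monom 1 j) ` {..<n})" .
qed

lemma fd_PP: "fd Polynomial.smult (PP n)"
  unfolding fd_def by (intro exI[of _ "(\<lambda>j. monom 1 j) ` {..<n}"] conjI PP_subset_span) simp

lemma dim_PP: "pl.dim (PP n :: 'a::field poly set) = n"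
proof -
  have inj: "inj_on (\<lambda>j. monom (1::'a) j) {..<n}" by (auto simp: inj_on_def monom_eq_iff')
  have "pl.independent ((\<lambda>j. monom (1::'a) j) ` {..<n})"
  proof (rule pl.independent_if_scalars_zero)
    fix f x assume 0: "(\<Sum>p\<in>(\<lambda>j. monom (1::'a) j) ` {..<n}. Polynomial.smult (f p) p) = 0"
      and "x \<in> (\<lambda>j. monom (1::'a) j) ` {..<n}"
    then obtain k where k: "k < n" "x = monom 1 k" by auto
    have "0 = coeff (\<Sum>j<n. Polynomial.smult (f (monom 1 j)) (monom 1 j)) k"
      using 0 by (simp add: sum.reindex[OF inj])
    also have "\<dots> = f x" using k by (simp add: coeff_sum if_distrib sum.delta cong: if_cong)
    finally show "f x = 0" by simp
  qed simp
  then have "pl.dim (PP n :: 'a poly set) = card ((\<lambda>j. monom (1::'a) j) ` {..<n})"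
    by (intro pl.dim_unique[OF _ PP_subset_span _ refl]) (auto simp: PP_def)
  then show ?thesis using inj by (simp add: card_image)
qed

lemma subspace_PV: "ps.subspace (PV q n)"
  by (auto simp: ps.subspace_def PV_def PP_def)

lemma fd_PV: "fd pscale (PV q n)"
proof -
  define e :: "nat \<times> nat \<Rightarrow> nat \<Rightarrow> 'a poly" where
    "e = (\<lambda>(i,j) k. if k = i then monom 1 j else 0)"
  have "PV q n \<subseteq> ps.span (e ` ({..<q} \<times> {..<n}))"
  proof
    fix x :: "nat \<Rightarrow> 'a poly" assume x: "x \<in> PV q n"
    have "x k = (\<Sum>i<q. \<Sum>j<n. pscale (coeff (x i) j) (e (i,j))) k" for k
    proof -
      have "(\<Sum>i<q. \<Sum>j<n. pscale (coeff (x i) j) (e (i,j))) k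
          = (\<Sum>i<q. \<Sum>j<n. if k = i then Polynomial.smult (coeff (x i) j) (monom 1 j) else 0)"
        by (simp add: sum_fun_apply e_def if_distrib cong: if_cong)
      also have "\<dots> = (\<Sum>i<q. if k = i then \<Sum>j<n. Polynomial.smult (coeff (x i) j) (monom 1 j) else 0)"
        by (intro sum.cong) auto
      also have "\<dots> = x k"
        using x PP_sum_monom[of "x k" n] by (auto simp: PV_def)
      finally show ?thesis by simp
    qed
    then have "x = (\<Sum>i<q. \<Sum>j<n. pscale (coeff (x i) j) (e (i,j)))" by blast
    also have "\<dots> \<in> ps.span (e ` ({..<q} \<times> {..<n}))"
      by (intro ps.span_sum ps.span_scale ps.span_base) auto
    finally show "x \<in> ps.span (e ` ({..<q} \<times> {..<n}))" .
  qed
  then show ?thesis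
    unfolding fd_def by (intro exI[of _ "e ` ({..<q} \<times> {..<n})"] conjI) simp_all
qed

lemma subspace_XS: "ps.subspace (XS q R n)"
  using subspace_PV[of q n] by (auto simp: ps.subspace_def XS_def dotp_add_right dotp_scale_right)

lemma subspace_MS: "ps.subspace (MS q R n)"
  using subspace_PV[of q n] by (auto simp: ps.subspace_def MS_def dotp_add_right dotp_scale_right)

lemma fd_XS: "fd pscale (XS q R n)"
  by (rule ps.fd_subset[OF fd_PV[of q n]]) (auto simp: XS_def intro: ps.span_base)

lemma fd_MS: "fd pscale (MS q R n)"
  by (rule ps.fd_subset[OF fd_PV[of q n]]) (auto simp: MS_def intro: ps.span_base)

text \<open>For a fixed \<open>x\<close> the conditions are linear in the row, so \<open>R\<close>
  can be replaced by any set with the same span; this is what permits row elimination.\<close>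

lemma XS_span: "XS q (ps.span R) n = XS q R n"
proof -
  have "ps.span R \<subseteq> {r. \<forall>j<n. coeff (dotp q r x) j = 0}" if "x \<in> XS q R n" for x
  proof (rule ps.span_minimal)
    show "R \<subseteq> {r. \<forall>j<n. coeff (dotp q r x) j = 0}" using that by (auto simp: XS_def)
    show "ps.subspace {r. \<forall>j<n. coeff (dotp q r x) j = 0}"
      by (auto simp: ps.subspace_def dotp_add_left dotp_scale_left)
  qed
  then show ?thesis using ps.span_superset[of R] by (auto simp: XS_def)
qed

lemma MS_span: "MS q (ps.span R) n = MS q R n"
proof -
  have "ps.span R \<subseteq> {r. dotp q r x = 0}" if "x \<in> MS q R n" for x
  proof (rule ps.span_minimal)
    show "R \<subseteq> {r. dotp q r x = 0}" using that by (auto simp: MS_def)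
    show "ps.subspace {r. dotp q r x = 0}"
      by (auto simp: ps.subspace_def dotp_add_left dotp_scale_left)
  qed
  then show ?thesis using ps.span_superset[of R] by (auto simp: MS_def)
qed

lemma dimX_cong_span: "ps.span R = ps.span R' \<Longrightarrow> dimX q R n = dimX q R' n"
  unfolding dimX_def by (metis XS_span)

lemma dimM_cong_span: "ps.span R = ps.span R' \<Longrightarrow> dimM q R n = dimM q R' n"
  unfolding dimM_def by (metis MS_span)

lemma dimX_0 [simp]:
  fixes R :: "(nat \<Rightarrow> 'a::field poly) set" shows "dimX q R 0 = 0"
proof -
  have "XS q R 0 \<subseteq> {0}" by (auto simp: XS_def PV_def PP_def fun_eq_iff poly_eq_iff)
  then have "dimX q R 0 \<le> ps.dim {0 :: nat \<Rightarrow> 'a poly}"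
    unfolding dimX_def by (rule ps.dim_subset_fd[OF ps.fd_finite, rotated]) simp
  then show ?thesis by (simp add: ps.dim_zero_singleton)
qed

lemma dimM_0 [simp]:
  fixes R :: "(nat \<Rightarrow> 'a::field poly) set" shows "dimM q R 0 = 0"
proof -
  have "MS q R 0 \<subseteq> {0}" by (auto simp: MS_def PV_def PP_def fun_eq_iff poly_eq_iff)
  then have "dimM q R 0 \<le> ps.dim {0 :: nat \<Rightarrow> 'a poly}"
    unfolding dimM_def by (rule ps.dim_subset_fd[OF ps.fd_finite, rotated]) simp
  then show ?thesis by (simp add: ps.dim_zero_singleton)
qed

subsection \<open>Adding one row\<close>

text \<open>The rank of the map given by \<open>r\<close> on truncated solutions, as
  \<open>sigma\<close> is its rank on exact null vectors. They are the drops of \<open>dimX\<close>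
  and \<open>dimM\<close> when \<open>r\<close> is inserted. The cutoff is there because
  \<open>XS\<close> sees only the coefficients below n.\<close>

definition rho :: "nat \<Rightarrow> (nat \<Rightarrow> 'a::field poly) set \<Rightarrow> (nat \<Rightarrow> 'a poly) \<Rightarrow> nat \<Rightarrow> nat" where
  "rho q R r n = pl.dim ((\<lambda>x. poly_cutoff n (dotp q r x)) ` XS q R n)"

definition sigma :: "nat \<Rightarrow> (nat \<Rightarrow> 'a::field poly) set \<Rightarrow> (nat \<Rightarrow> 'a poly) \<Rightarrow> nat \<Rightarrow> nat" where
  "sigma q R r n = pl.dim (dotp q r ` MS q R n)"

lemma linear_cutoff: "Vector_Spaces.linear Polynomial.smult Polynomial.smult (poly_cutoff n)"
  by unfold_locales (auto simp: poly_eq_iff coeff_poly_cutoff)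

lemma linear_cutoff_dotp: "Vector_Spaces.linear pscale Polynomial.smult (\<lambda>x. poly_cutoff n (dotp q r x))"
  by unfold_locales (auto simp: poly_eq_iff coeff_poly_cutoff dotp_add_right dotp_scale_right)

lemma linear_shift: "Vector_Spaces.linear Polynomial.smult Polynomial.smult (\<lambda>p. pCons 0 p)"
  by unfold_locales auto

lemma poly_cutoff_eq_0_iff: "poly_cutoff n p = 0 \<longleftrightarrow> (\<forall>j<n. coeff p j = 0)"
  by (auto simp: poly_eq_iff coeff_poly_cutoff)

lemma dimX_insert: "dimX q R n = rho q R r n + dimX q (insert r R) n"
proof -
  interpret l: Vector_Spaces.linear pscale Polynomial.smult "\<lambda>x. poly_cutoff n (dotp q r x)"
    by (rule linear_cutoff_dotp)
  have "{x \<in> XS q R n. poly_cutoff n (dotp q r x) = 0} = XS q (insert r R) n"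
    by (auto simp: XS_def poly_cutoff_eq_0_iff)
  then show ?thesis
    using l.rank_nullity[OF subspace_XS fd_XS, of q R n] by (simp add: dimX_def rho_def)
qed

lemma dimM_insert: "dimM q R n = sigma q R r n + dimM q (insert r R) n"
proof -
  interpret l: Vector_Spaces.linear pscale Polynomial.smult "dotp q r" by (rule linear_dotp)
  have "{x \<in> MS q R n. dotp q r x = 0} = MS q (insert r R) n"
    by (auto simp: MS_def)
  then show ?thesis
    using l.rank_nullity[OF subspace_MS fd_MS, of q R n] by (simp add: dimM_def sigma_def)
qed

lemma pl_dim_mono: "S \<subseteq> T \<Longrightarrow> T \<subseteq> PP n \<Longrightarrow> pl.dim S \<le> pl.dim T"
  by (rule pl.dim_subset_fd[OF pl.fd_subset[OF fd_PP[of n]]]) (auto intro: pl.span_base)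

lemma dim_pCons_image:
  assumes "pl.subspace S" "fd Polynomial.smult S"
  shows "pl.dim (pCons 0 ` S) = pl.dim S"
proof -
  interpret l: Vector_Spaces.linear Polynomial.smult Polynomial.smult "\<lambda>p. pCons 0 p" by (rule linear_shift)
  have "{x \<in> S. pCons 0 x = 0} = {0}" using assms(1) by (auto simp: pl.subspace_0)
  then show ?thesis using l.rank_nullity[OF assms] by (simp add: pl.dim_zero_singleton)
qed

lemma shift_PV: "x \<in> PV q n \<Longrightarrow> (\<lambda>i. pCons 0 (x i)) \<in> PV q (Suc n)"
  by (auto simp: PV_def PP_def coeff_pCons split: nat.splits)

lemma dotp_shift:
  fixes r :: "nat \<Rightarrow> 'a::field poly"
  shows "dotp q r (\<lambda>i. pCons 0 (x i)) = pCons 0 (dotp q r x)"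
  using dotp_mult_right[of q r "[:0,1:]" x] by simp

lemma rho_image_PP: "(\<lambda>x. poly_cutoff n (dotp q r x)) ` XS q R n \<subseteq> PP n"
  by (auto simp: PP_def coeff_poly_cutoff)

lemma subspace_rho_image: "pl.subspace ((\<lambda>x. poly_cutoff n (dotp q r x)) ` XS q R n)"
proof -
  interpret l: Vector_Spaces.linear pscale Polynomial.smult "\<lambda>x. poly_cutoff n (dotp q r x)"
    by (rule linear_cutoff_dotp)
  show ?thesis by (rule l.subspace_image[OF subspace_XS])
qed

lemma fd_rho_image: "fd Polynomial.smult ((\<lambda>x. poly_cutoff n (dotp q r x)) ` XS q R n)"
  by (rule pl.fd_subset[OF fd_PP[of n]]) (use rho_image_PP pl.span_superset in blast)

lemma rho_le: "rho q R r n \<le> n"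
  unfolding rho_def using pl_dim_mono[OF rho_image_PP order_refl] dim_PP by metis

text \<open>Multiplication by the variable turns truncated solutions for n into those for n + 1 and
  multiplies the value of the row by the variable, which is injective.\<close>

lemma rho_mono_Suc: "rho q R r n \<le> rho q R r (Suc n)"
proof -
  have "pCons 0 ` (\<lambda>x. poly_cutoff n (dotp q r x)) ` XS q R n
     \<subseteq> (\<lambda>x. poly_cutoff (Suc n) (dotp q r x)) ` XS q R (Suc n)"
  proof clarify
    fix x assume x: "x \<in> XS q R n"
    let ?y = "\<lambda>i. pCons 0 (x i)"
    have "?y \<in> XS q R (Suc n)"
      using x shift_PV[of x q n] by (auto simp: XS_def dotp_shift coeff_pCons split: nat.splits)
    moreover have "pCons 0 (poly_cutoff n (dotp q r x)) = poly_cutoff (Suc n) (dotp q r ?y)"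
      by (auto simp: poly_eq_iff dotp_shift coeff_pCons coeff_poly_cutoff split: nat.splits)
    ultimately show "pCons 0 (poly_cutoff n (dotp q r x))
      \<in> (\<lambda>x. poly_cutoff (Suc n) (dotp q r x)) ` XS q R (Suc n)" by blast
  qed
  then show ?thesis unfolding rho_def
    using pl_dim_mono[OF _ rho_image_PP] dim_pCons_image[OF subspace_rho_image fd_rho_image] by metis
qed

lemma coeff_dotp_cutoff:
  "j < n \<Longrightarrow> coeff (dotp q r (\<lambda>i. poly_cutoff n (x i))) j = coeff (dotp q r x) j"
  unfolding dotp_def coeff_sum coeff_mult
  by (intro sum.cong refl) (simp add: coeff_poly_cutoff less_imp_diff_less)

text \<open>Cutting a solution for n + 1 down to degree below n gives a solution for n, since
  coefficient j of a product involves only coefficients up to j. What the cutoff of a value loses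
  lies on the line of the monomial of degree n.\<close>

lemma rho_Suc_le: "rho q R r (Suc n) \<le> Suc (rho q R r n)"
proof -
  interpret l: Vector_Spaces.linear Polynomial.smult Polynomial.smult "poly_cutoff n" by (rule linear_cutoff)
  let ?S = "\<lambda>n. (\<lambda>x. poly_cutoff n (dotp q r x)) ` XS q R n"
  have "poly_cutoff n ` ?S (Suc n) \<subseteq> ?S n"
  proof clarify
    fix x assume x: "x \<in> XS q R (Suc n)"
    let ?y = "\<lambda>i. poly_cutoff n (x i)"
    have "?y \<in> XS q R n"
      using x by (auto simp: XS_def PV_def PP_def coeff_dotp_cutoff coeff_poly_cutoff)
    moreover have "poly_cutoff n (poly_cutoff (Suc n) (dotp q r x)) = poly_cutoff n (dotp q r ?y)"
      by (auto simp: poly_eq_iff coeff_poly_cutoff coeff_dotp_cutoff)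
    ultimately show "poly_cutoff n (poly_cutoff (Suc n) (dotp q r x)) \<in> ?S n" by blast
  qed
  then have "pl.dim (poly_cutoff n ` ?S (Suc n)) \<le> rho q R r n"
    unfolding rho_def by (rule pl_dim_mono[OF _ rho_image_PP])
  moreover have "pl.dim {p \<in> ?S (Suc n). poly_cutoff n p = 0} \<le> card {monom (1::'a) n}"
  proof (rule pl.dim_le_card)
    show "{p \<in> ?S (Suc n). poly_cutoff n p = 0} \<subseteq> pl.span {monom 1 n}"
    proof clarify
      fix x assume 0: "poly_cutoff n (poly_cutoff (Suc n) (dotp q r x)) = 0"
      have "poly_cutoff (Suc n) (dotp q r x) = Polynomial.smult (coeff (dotp q r x) n) (monom 1 n)"
        using 0 unfolding poly_cutoff_eq_0_iff by (auto simp: poly_eq_iff coeff_poly_cutoff less_Suc_eq)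
      then show "poly_cutoff (Suc n) (dotp q r x) \<in> pl.span {monom 1 n}"
        by (auto simp: pl.span_singleton)
    qed
  qed simp
  ultimately show ?thesis
    using l.rank_nullity[OF subspace_rho_image fd_rho_image, of "Suc n" q r R]
    unfolding rho_def[of q R r "Suc n"] by simp
qed

section \<open>Rows of degree at most one and their values on null vectors\<close>

definition deg1 :: "(nat \<Rightarrow> 'a::field poly) \<Rightarrow> bool" where
  "deg1 r \<longleftrightarrow> (\<forall>i. degree (r i) \<le> 1)"

lemma dotp_PP: "deg1 r \<Longrightarrow> x \<in> PV q n \<Longrightarrow> dotp q r x \<in> PP (Suc n)"
proof -
  assume r: "deg1 r" and x: "x \<in> PV q n"
  have "coeff (r i * x i) j = 0" if "j \<ge> Suc n" for i j
  proof -
    have "coeff (r i) k * coeff (x i) (j - k) = 0" if "k \<le> j" for k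
    proof (cases "k \<le> 1")
      case True then show ?thesis using x \<open>j \<ge> Suc n\<close> by (auto simp: PV_def PP_def)
    next
      case False
      then have "degree (r i) < k" using r by (metis deg1_def le_less_trans not_le)
      then show ?thesis by (simp add: coeff_eq_0)
    qed
    then show ?thesis unfolding coeff_mult by (intro sum.neutral) auto
  qed
  then show ?thesis by (simp add: PP_def dotp_def coeff_sum)
qed

lemma sigma_image_PP: "deg1 r \<Longrightarrow> dotp q r ` MS q R n \<subseteq> PP (Suc n)"
  using dotp_PP by (auto simp: MS_def)

lemma subspace_sigma_image: "pl.subspace (dotp q r ` MS q R n)"
proof -
  interpret l: Vector_Spaces.linear pscale Polynomial.smult "dotp q r" by (rule linear_dotp)
  show ?thesis by (rule l.subspace_image[OF subspace_MS])
qed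

lemma sigma_le: "deg1 r \<Longrightarrow> sigma q R r n \<le> Suc n"
  unfolding sigma_def using pl_dim_mono[OF sigma_image_PP order_refl] dim_PP by metis

lemma MS_mono: "n \<le> m \<Longrightarrow> MS q R n \<subseteq> MS q R m"
  by (auto simp: MS_def PV_def PP_def)

lemma MS_shift: "x \<in> MS q R n \<Longrightarrow> (\<lambda>i. pCons 0 (x i)) \<in> MS q R (Suc n)"
  using shift_PV by (auto simp: MS_def dotp_shift)

lemma sigma_mono: "deg1 r \<Longrightarrow> n \<le> m \<Longrightarrow> sigma q R r n \<le> sigma q R r m"
  unfolding sigma_def using pl_dim_mono[OF _ sigma_image_PP] MS_mono by (metis image_mono)

lemma sigma_0 [simp]:
  fixes R :: "(nat \<Rightarrow> 'a::field poly) set" shows "sigma q R r 0 = 0"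
proof -
  have "x = 0" if "x \<in> MS q R 0" for x
    using that by (auto simp: MS_def PV_def PP_def fun_eq_iff poly_eq_iff)
  then have "dotp q r ` MS q R 0 \<subseteq> {0}"
    by (metis (no_types, lifting) dotp_zero_right image_subsetI singletonI)
  then have "sigma q R r 0 \<le> pl.dim {0 :: 'a poly}"
    unfolding sigma_def by (rule pl.dim_subset_fd[OF pl.fd_finite, rotated]) simp
  then show ?thesis by (simp add: pl.dim_zero_singleton)
qed

text \<open>A null vector of degree below n is a truncated solution for n + 1 as well, and the value
  of the linear row on it has degree at most n, so the cutoff keeps all of it. In
  \<open>wd_insert_gt\<close> this is what bounds a jump of \<open>sigma\<close>.\<close>

lemma sigma_le_rho:
  assumes "deg1 r" "\<And>r'. r' \<in> R \<Longrightarrow> deg1 r'"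
  shows "sigma q R r n \<le> rho q R r (Suc n)"
  unfolding sigma_def rho_def
proof (rule pl_dim_mono[OF _ rho_image_PP], clarify)
  fix x assume x: "x \<in> MS q R n"
  have "x \<in> XS q R (Suc n)" using x by (auto simp: MS_def XS_def PV_def PP_def)
  moreover have "dotp q r x = poly_cutoff (Suc n) (dotp q r x)"
    using sigma_image_PP[OF assms(1)] x by (fastforce simp: PP_def poly_eq_iff coeff_poly_cutoff)
  ultimately show "dotp q r x \<in> (\<lambda>x. poly_cutoff (Suc n) (dotp q r x)) ` XS q R (Suc n)" by blast
qed

text \<open>Multiplying an element of maximal degree by the variable leaves the space.\<close>
lemma shift_closed_dim_less:
  assumes "pl.subspace S" "pl.subspace T" "S \<subseteq> T" "pCons 0 ` S \<subseteq> T" "fd Polynomial.smult T" "S \<subseteq> PP n" "pl.dim S > 0"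
  shows "pl.dim S < pl.dim T"
proof (rule pl.dim_psubset_fd)
  have "S \<noteq> {0}"
  proof (rule notI)
    assume "S = {0}"
    with assms(7) show False by (simp add: pl.dim_zero_singleton)
  qed
  moreover have "0 \<in> S" by (rule pl.subspace_0[OF assms(1)])
  ultimately obtain p where p: "p \<in> S" "p \<noteq> 0" by blast
  define D where "D = degree ` (S - {0})"
  have "degree p \<le> n" if "p \<in> S" for p
  proof (rule degree_le, intro allI impI)
    fix j assume "n < j"
    then show "coeff p j = 0" using assms(6) that by (auto simp: PP_def)
  qed
  then have "D \<subseteq> {..n}" by (auto simp: D_def)
  then have fin: "finite D" using finite_subset by blast
  have "D \<noteq> {}" using p by (auto simp: D_def)
  then have "Max D \<in> D" using fin by (rule Max_in[rotated])
  then obtain m where "Max D = degree m" "m \<in> S - {0}" unfolding D_def by (rule imageE)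
  then have m: "m \<in> S" "m \<noteq> 0" "degree m = Max D" by auto
  have "pCons 0 m \<notin> S"
  proof
    assume "pCons 0 m \<in> S"
    then have "pCons 0 m \<in> S - {0}" using m by simp
    then have "degree (pCons 0 m) \<in> D" unfolding D_def by (rule imageI)
    then have "degree (pCons 0 m) \<le> Max D" using fin by simp
    then show False using m by simp
  qed
  then show "S \<subset> T" using m assms by blast
qed (use assms in auto)

text \<open>The values of \<open>r\<close> on null vectors of degree below n, and the products of
  these values with the variable, all occur for the next bound.\<close>

lemma sigma_Suc_gt: "deg1 r \<Longrightarrow> sigma q R r n > 0 \<Longrightarrow> sigma q R r (Suc n) \<ge> Suc (sigma q R r n)"
  unfolding sigma_def Suc_le_eq
proof (rule shift_closed_dim_less[OF subspace_sigma_image subspace_sigma_image _ _ _ sigma_image_PP])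
  assume r: "deg1 r"
  show "dotp q r ` MS q R n \<subseteq> dotp q r ` MS q R (Suc n)"
    by (intro image_mono MS_mono) simp
  show "pCons 0 ` dotp q r ` MS q R n \<subseteq> dotp q r ` MS q R (Suc n)"
    using MS_shift by (force simp: dotp_shift[symmetric])
  show "fd Polynomial.smult (dotp q r ` MS q R (Suc n))"
    by (rule pl.fd_subset[OF fd_PP[of "Suc (Suc n)"]])
      (use sigma_image_PP[OF r, of q R "Suc n"] pl.span_superset in blast)
qed

text \<open>For i = 1 the indices \<open>i - 1\<close> and \<open>i - 2\<close> are both 0, where
  \<open>dimX\<close> and \<open>dimM\<close> vanish, so the subtracted increment is 0 as
  required.\<close>

definition wd :: "nat \<Rightarrow> (nat \<Rightarrow> 'a::field poly) set \<Rightarrow> nat \<Rightarrow> int" where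
  "wd q R i = int (dimX q R i) - int (dimX q R (i - 1)) - (int (dimM q R (i - 1)) - int (dimM q R (i - 2)))"

text \<open>As long as \<open>r\<close> vanishes on the null vectors concerned, only
  \<open>rho\<close> contributes, by minus its increment, which is 0 or 1.\<close>

lemma wd_insert_le:
  assumes "i \<ge> 1" "sigma q R r (i - 1) = 0" "deg1 r"
  shows "wd q (insert r R) i - wd q R i \<in> {-1..0}"
proof -
  obtain j where j: "i = Suc j" using assms(1) by (cases i) auto
  have "sigma q R r (j - 1) = 0" using sigma_mono[OF assms(3), of "j - 1" j q R] assms(2) j by simp
  then show ?thesis
    using j assms dimX_insert[of q R i r] dimX_insert[of q R j r] dimM_insert[of q R j r]
      dimM_insert[of q R "j - 1" r] rho_mono_Suc[of q R r j] rho_Suc_le[of q R r j]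
    by (simp add: wd_def)
qed

text \<open>The change is the increment of \<open>sigma\<close> from i - 2 to i - 1 minus the
  increment of \<open>rho\<close> from i - 1 to i. The first is at least 1 and the second at most 1,
  hence the lower bound. For the upper bound, \<open>sigma\<close> at i - 1 is at most
  \<open>rho\<close> at i, so the change is at most \<open>rho\<close> at i - 1 minus
  \<open>sigma\<close> at i - 2; the former is at most i - 1 and the latter at least i - 1 -
  a.\<close>

lemma wd_insert_gt:
  assumes r: "deg1 r" "\<And>r'. r' \<in> R \<Longrightarrow> deg1 r'"
    and a: "sigma q R r a > 0" "\<And>n. n < a \<Longrightarrow> sigma q R r n = 0" and i: "i \<ge> Suc a"
  shows "wd q (insert r R) i - wd q R i \<in> {0..int a}"
proof -
  have a0: "a \<ge> 1" using a by (cases a) auto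
  define j where "j = i - 2"
  have j: "i = Suc (Suc j)" using i a0 by (simp add: j_def)
  have grow: "sigma q R r (a + k) \<ge> Suc k" for k
  proof (induction k)
    case (Suc k)
    then show ?case using sigma_Suc_gt[OF r(1), of q R "a + k"] by simp
  qed (use a in simp)
  have lower: "sigma q R r (Suc j) \<ge> Suc (sigma q R r j)"
  proof (cases "Suc j = a")
    case True then show ?thesis using a by simp
  next
    case False
    then show ?thesis using sigma_Suc_gt[OF r(1), of q R j] grow[of "j - a"] i j by simp
  qed
  have upper: "sigma q R r j + a \<ge> Suc j"
  proof (cases "Suc j = a")
    case False
    then show ?thesis using grow[of "j - a"] i j by simp
  qed simp
  show ?thesis
    using j dimX_insert[of q R i r] dimX_insert[of q R "Suc j" r] dimM_insert[of q R j r]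
      dimM_insert[of q R "Suc j" r] rho_mono_Suc[of q R r "Suc j"] rho_Suc_le[of q R r "Suc j"]
      rho_le[of q R r "Suc j"] sigma_le[OF r(1), of q R "Suc j"] sigma_le_rho[where R = R, OF r, where q = q and n = "Suc j"]
      lower upper
    by (simp add: wd_def)
qed

section \<open>Growth of the spaces of null vectors\<close>

lemma MS_shift_notin:
  assumes "x \<in> MS q R (Suc n)" "x \<notin> MS q R n"
  shows "(\<lambda>i. pCons 0 (x i)) \<in> MS q R (Suc (Suc n)) - MS q R (Suc n)"
proof -
  have "x \<in> MS q R n" if "(\<lambda>i. pCons 0 (x i)) \<in> MS q R (Suc n)"
  proof -
    have "coeff (x i) j = 0" if "n \<le> j" for i j
    proof -
      have "coeff (pCons 0 (x i)) (Suc j) = 0"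
        using \<open>(\<lambda>i. pCons 0 (x i)) \<in> MS q R (Suc n)\<close> that by (simp add: MS_def PV_def PP_def del: coeff_pCons_Suc)
      then show ?thesis by simp
    qed
    then show ?thesis using assms(1) by (simp add: MS_def PV_def PP_def)
  qed
  then show ?thesis using assms MS_shift by blast
qed

text \<open>The least bound admitting a nonzero null vector is attained by the degree of such a
  vector; its multiples by powers of the variable give a new null vector for every later
  bound.\<close>

lemma dimM_Suc_gt:
  assumes "dimM q R n > 0" shows "dimM q R (Suc n) > dimM q R n"
proof -
  define m where "m = (LEAST m. MS q R m \<noteq> {0})"
  have n: "MS q R n \<noteq> {0}" using assms ps.dim_eq_0_fd[OF subspace_MS fd_MS, of q R n] by (simp add: dimM_def)
  then have m: "MS q R m \<noteq> {0}" "m \<le> n" unfolding m_def by (rule LeastI, intro Least_le)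
  have m0: "m \<noteq> 0" using m ps.dim_eq_0_fd[OF subspace_MS fd_MS, of q R 0] dimM_0[of q R] by (auto simp: dimM_def)
  have "MS q R (m - 1) = {0}" using m0 not_less_Least[of "m - 1" "\<lambda>m. MS q R m \<noteq> {0}"] by (auto simp: m_def)
  moreover obtain x where "x \<in> MS q R m" "x \<noteq> 0" using m ps.subspace_0[OF subspace_MS, of q R m] by blast
  ultimately have x: "x \<in> MS q R (Suc (m - 1))" "x \<notin> MS q R (m - 1)" using m0 by auto
  have "\<exists>y. y \<in> MS q R (Suc (m - 1 + k)) \<and> y \<notin> MS q R (m - 1 + k)" for k
  proof (induction k)
    case (Suc k)
    then obtain y where "y \<in> MS q R (Suc (m - 1 + k))" "y \<notin> MS q R (m - 1 + k)" by blast
    from MS_shift_notin[OF this] show ?case by auto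
  qed (use x in auto)
  from this[of "n - (m - 1)"] obtain y where "y \<in> MS q R (Suc n)" "y \<notin> MS q R n"
    using m m0 by auto
  then have "MS q R n \<subset> MS q R (Suc n)" using MS_mono[of n "Suc n"] by fastforce
  then show ?thesis unfolding dimM_def by (intro ps.dim_psubset_fd subspace_MS fd_MS)
qed

lemma dimM_mono: "n \<le> m \<Longrightarrow> dimM q R n \<le> dimM q R m"
  unfolding dimM_def by (intro ps.dim_subset_fd fd_MS MS_mono)

text \<open>If a single further row destroys all null vectors, then any two null vectors are proportional
  over the rational functions, so their leading coefficient vectors are proportional over the field.\<close>
lemma dimM_Suc_le:
  fixes r :: "nat \<Rightarrow> 'a::field poly"
  assumes "\<And>n. MS q (insert r R) n \<subseteq> {0}"
  shows "dimM q R (Suc n) \<le> Suc (dimM q R n)"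
proof -
  \<comment> \<open>The vector of coefficients of degree n, kept as constant polynomials so that the
    target has the scaling of the source.\<close>
  define f where "f = (\<lambda>(x::nat \<Rightarrow> 'a poly) i. [:coeff (x i) n:])"
  have f0: "f x = 0 \<longleftrightarrow> (\<forall>i. coeff (x i) n = 0)" for x
    by (simp add: f_def fun_eq_iff)
  interpret l: Vector_Spaces.linear pscale pscale f
    by unfold_locales (simp_all add: f_def fun_eq_iff)
  let ?M = "MS q R (Suc n)"
  have ker: "{x \<in> ?M. f x = 0} \<subseteq> MS q R n"
  proof clarify
    fix x assume x: "x \<in> ?M" and 0: "f x = 0"
    have "coeff (x i) n = 0" for i using 0 f0 by blast
    then show "x \<in> MS q R n"
      using x by (auto simp: MS_def PV_def PP_def) (metis le_antisym not_less_eq_eq)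
  qed
  have nz: "dotp q r x \<noteq> 0" if "x \<in> ?M" "x \<noteq> 0" for x
    using assms[of "Suc n"] that by (auto simp: MS_def)
  have par: "f h \<in> ps.span {f g}" if g: "g \<in> ?M" "f g \<noteq> 0" and h: "h \<in> ?M" for g h
  proof (cases "f h = 0")
    case True then show ?thesis by (simp add: ps.span_zero)
  next
    case False
    have gh0: "g \<noteq> 0" "h \<noteq> 0" using g(2) False by (auto simp: f0)
    define a b where "a = dotp q r h" and "b = dotp q r g"
    have ab: "a \<noteq> 0" "b \<noteq> 0" using nz gh0 g h by (auto simp: a_def b_def)
    \<comment> \<open>A polynomial combination of two null vectors on which the row \<open>r\<close>
      vanishes too, hence zero by the assumption.\<close>
    define z where "z = (\<lambda>i. a * g i) - (\<lambda>i. b * h i)"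
    have dz: "dotp q r' z = a * dotp q r' g - b * dotp q r' h" for r'
      by (simp add: z_def dotp_def algebra_simps sum_subtractf sum_distrib_left)
    \<comment> \<open>The factors \<open>a\<close> and \<open>b\<close> may raise the degree of
      \<open>z\<close> beyond n, so the assumption is used for another bound.\<close>
    define N where "N = Suc (Max (insert 0 ((\<lambda>i. degree (z i)) ` {..<q})))"
    have "z \<in> PV q N"
    proof -
      have z0: "z i = 0" if "i \<ge> q" for i using g h that by (simp add: z_def MS_def PV_def)
      have "degree (z i) < N" if "i < q" for i
        unfolding N_def using that by (intro le_imp_less_Suc Max_ge) auto
      then have "z i \<in> PP N" for i using z0[of i]
        by (cases "i < q") (auto simp: PP_def intro!: coeff_eq_0 intro: less_le_trans)
      then show ?thesis using z0 by (simp add: PV_def)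
    qed
    moreover have "dotp q r' z = 0" if "r' \<in> insert r R" for r'
      using that g h by (auto simp: dz a_def b_def MS_def)
    ultimately have "z \<in> MS q (insert r R) N" by (simp add: MS_def)
    then have "z = 0" using assms by blast
    then have eq: "a * g i = b * h i" for i by (simp add: z_def fun_eq_iff)
    have dg: "degree (x i) \<le> n" if "x \<in> ?M" for x i
      using that by (intro degree_le) (auto simp: MS_def PV_def PP_def)
    have top: "coeff (c * x i) (degree c + n) = lead_coeff c * coeff (x i) n" if "x \<in> ?M" for c x i
      using coeff_mult_degree_sum[of c "x i"] dg[OF that, of i] degree_mult_le[of c "x i"]
      by (cases "degree (x i) = n") (auto simp: coeff_eq_0)
    have top0: "coeff (c * x i) j = 0" if "x \<in> ?M" "j > degree c + n" for c x i j
      using dg[OF that(1), of i] that(2) degree_mult_le[of c "x i"] by (intro coeff_eq_0) linarith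
    obtain i where i: "coeff (g i) n \<noteq> 0" using g(2) by (auto simp: f0)
    obtain k where k: "coeff (h k) n \<noteq> 0" using False by (auto simp: f0)
    have "degree a = degree b"
    proof (rule ccontr)
      assume "degree a \<noteq> degree b"
      then consider "degree a < degree b" | "degree b < degree a" by linarith
      then show False
      proof cases
        case 1
        then show False using eq[of k] top[OF h, of b k] top0[OF g(1), of a "degree b + n" k] k ab by simp
      next
        case 2
        then show False using eq[of i] top[OF g(1), of a i] top0[OF h, of b "degree a + n" i] i ab by simp
      qed
    qed
    then have "lead_coeff a * coeff (g j) n = lead_coeff b * coeff (h j) n" for j
      using eq[of j] top[OF g(1), of a j] top[OF h, of b j] by simp
    then have "coeff (h j) n = (lead_coeff a / lead_coeff b) * coeff (g j) n" for j
      using ab by (simp add: field_simps)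
    then have "f h = pscale (lead_coeff a / lead_coeff b) (f g)"
      by (simp add: f_def fun_eq_iff)
    then show ?thesis by (metis ps.span_base ps.span_scale singletonI)
  qed
  have "ps.dim (f ` ?M) \<le> 1"
  proof (cases "\<exists>g\<in>?M. f g \<noteq> 0")
    case True
    then obtain g where "g \<in> ?M" "f g \<noteq> 0" by blast
    then have "f ` ?M \<subseteq> ps.span {f g}" using par by blast
    then show ?thesis using ps.dim_le_card[of "f ` ?M" "{f g}"] by simp
  next
    case False
    then have "f ` ?M \<subseteq> ps.span {}" by auto
    then show ?thesis using ps.dim_le_card[of "f ` ?M" "{}"] by simp
  qed
  moreover have "ps.dim {x \<in> ?M. f x = 0} \<le> dimM q R n"
    unfolding dimM_def by (intro ps.dim_subset_fd fd_MS ker)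
  ultimately show ?thesis using l.rank_nullity[OF subspace_MS fd_MS, of q R "Suc n"]
    by (simp add: dimM_def)
qed

subsection \<open>Strings of a pencil of linear maps\<close>

text \<open>A block together with the vectors of the domain and of the codomain that belong to its
  columns and its rows.\<close>

type_synonym ('a, 'v, 'w) kstring = "'a kblock \<times> 'v list \<times> 'w list"

text \<open>\<open>E\<close> stands for the coefficient of s and \<open>A\<close> for the constant
  one. Only infinite Jordan blocks and transposed L blocks occur: they are what the iteration in
  \<open>string_decomposition\<close> uses up. In both, \<open>E\<close> reaches every codomain
  vector of the string except the last.\<close>

definition good_string :: "('v \<Rightarrow> 'w::zero) \<Rightarrow> ('v \<Rightarrow> 'w) \<Rightarrow> ('a, 'v, 'w) kstring \<Rightarrow> bool" where
  "good_string E A t = (case t of (b, vs, ws) \<Rightarrow> (case b of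
      NB k \<Rightarrow> k \<ge> 1 \<and> length vs = k \<and> length ws = k \<and> (\<forall>j<k. A (vs ! j) = ws ! j)
             \<and> E (vs ! 0) = 0 \<and> (\<forall>j. Suc j < k \<longrightarrow> E (vs ! Suc j) = ws ! j)
    | LTB k \<Rightarrow> length vs = k \<and> length ws = Suc k
             \<and> (\<forall>j<k. E (vs ! j) = ws ! j \<and> A (vs ! j) = ws ! Suc j)
    | _ \<Rightarrow> False))"

definition vcat :: "('a, 'v, 'w) kstring list \<Rightarrow> 'v list" where
  "vcat ts = concat (map (fst \<circ> snd) ts)"

definition wcat :: "('a, 'v, 'w) kstring list \<Rightarrow> 'w list" where
  "wcat ts = concat (map (snd \<circ> snd) ts)"

fun is_NB :: "'a kblock \<Rightarrow> bool" where
  "is_NB (NB k) = True" | "is_NB _ = False"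

fun kgrow :: "'a kblock \<Rightarrow> 'a kblock" where
  "kgrow (NB k) = NB (Suc k)" | "kgrow (LTB k) = LTB (Suc k)" | "kgrow b = b"

lemma good_string_ws_nonempty: "good_string E A (b, vs, ws) \<Longrightarrow> ws \<noteq> []"
  by (auto simp: good_string_def split: kblock.splits)

lemma good_string_grow:
  assumes "good_string E A (b, vs, ws)" "E u = last ws"
  shows "good_string E A (kgrow b, vs @ [u], ws @ [A u])"
proof -
  have "last ws = ws ! (length ws - 1)"
    using good_string_ws_nonempty[OF assms(1)] by (rule last_conv_nth)
  then show ?thesis
    using assms by (cases b) (auto simp: good_string_def nth_append less_Suc_eq intro!: arg_cong[where f = "(!) ws"])
qed

text \<open>Together with \<open>good_string_nontop\<close>: up to 0, \<open>E\<close> maps the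
  domain vectors of a string exactly onto its codomain vectors other than the last.\<close>

lemma good_string_E:
  assumes "good_string E A (b, vs, ws)" "v \<in> set vs"
  shows "E v = 0 \<or> E v \<in> set (butlast ws)"
proof -
  obtain j where j: "j < length vs" "v = vs ! j" using assms(2) by (auto simp: in_set_conv_nth)
  show ?thesis
  proof (cases b)
    case (NB k)
    show ?thesis
    proof (cases j)
      case 0 then show ?thesis using assms NB j by (simp add: good_string_def)
    next
      case (Suc i)
      then have "E v = butlast ws ! i" "i < length (butlast ws)"
        using assms NB j by (auto simp: good_string_def nth_butlast)
      then show ?thesis by simp
    qed
  next
    case (LTB k)
    then have "E v = butlast ws ! j" "j < length (butlast ws)"
      using assms j by (auto simp: good_string_def nth_butlast)
    then show ?thesis by simp
  qed (use assms in \<open>auto simp: good_string_def\<close>)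
qed

lemma good_string_nontop:
  assumes "good_string E A (b, vs, ws)" "w \<in> set (butlast ws)"
  shows "w \<in> E ` set vs"
proof -
  obtain j where j: "j < length ws - 1" "w = ws ! j"
    using assms(2) by (auto simp: in_set_conv_nth nth_butlast)
  show ?thesis
  proof (cases b)
    case (NB k)
    then have "w = E (vs ! Suc j)" "Suc j < length vs" using assms j by (auto simp: good_string_def)
    then show ?thesis by auto
  next
    case (LTB k)
    then have "w = E (vs ! j)" "j < length vs" using assms j by (auto simp: good_string_def)
    then show ?thesis by auto
  qed (use assms in \<open>auto simp: good_string_def\<close>)
qed

lemma (in Vector_Spaces.vector_space) fd_mono: "fd scale T \<Longrightarrow> S \<subseteq> T \<Longrightarrow> fd scale S"
  by (erule fd_subset) (use span_superset in blast)

locale linear_pencil = E: Vector_Spaces.linear s1 s2 E + A: Vector_Spaces.linear s1 s2 A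
  for s1 :: "'k::field \<Rightarrow> 'v::ab_group_add \<Rightarrow> 'v" and s2 :: "'k \<Rightarrow> 'w::ab_group_add \<Rightarrow> 'w" and E A
begin

text \<open>\<open>V1\<close> is the full preimage of \<open>W1\<close> in \<open>V\<close>, so
  \<open>A\<close> induces an injection of \<open>V\<close> modulo \<open>V1\<close> into the
  quotient by \<open>W1\<close>, and a basis of \<open>V\<close> modulo \<open>V1\<close> has images
  independent modulo \<open>W1\<close>.\<close>

lemma dim_quotient_embed:
  assumes V: "E.vs1.subspace V" "fd s1 V" and W1: "E.vs2.subspace W1" "fd s2 W1"
    and V1: "V1 = {v \<in> V. A v \<in> W1}" and L: "E.vs1.span (V1 \<union> set L) = V"
    and d: "E.vs1.dim V = E.vs1.dim V1 + length L"
  shows "E.vs2.dim (W1 \<union> A ` set L) = E.vs2.dim W1 + length L"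
proof -
  have fdW: "fd s2 (W1 \<union> A ` set L)" using W1 by (simp add: E.vs2.fd_Un E.vs2.fd_finite)
  then obtain zs where zs: "set zs \<subseteq> A ` set L" "E.vs2.span (W1 \<union> set zs) = E.vs2.span (W1 \<union> A ` set L)"
     "E.vs2.dim (W1 \<union> A ` set L) = E.vs2.dim W1 + length zs"
    by (rule E.vs2.extend_by_list)
  define g where "g z = (SOME l. l \<in> set L \<and> A l = z)" for z
  have g: "g z \<in> set L" "A (g z) = z" if "z \<in> set zs" for z
    using someI_ex[of "\<lambda>l. l \<in> set L \<and> A l = z"] zs(1) that by (auto simp: g_def)
  let ?L' = "map g zs"
  have sub: "E.vs1.subspace V1"
    using V W1 by (auto simp: V1 E.vs1.subspace_def E.vs2.subspace_def A.add A.scale A.zero)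
  have "V \<subseteq> E.vs1.span (V1 \<union> set ?L')"
  proof
    fix v assume v: "v \<in> V"
    have "A v \<in> A ` E.vs1.span (V1 \<union> set L)" using v L by simp
    then have "A v \<in> E.vs2.span (A ` (V1 \<union> set L))" by (simp add: A.span_image)
    moreover have "A ` (V1 \<union> set L) \<subseteq> W1 \<union> A ` set L" by (auto simp: V1)
    ultimately have "A v \<in> E.vs2.span (W1 \<union> set zs)" unfolding zs(2) using E.vs2.span_mono by blast
    moreover have "E.vs2.span W1 = W1" using W1 by simp
    ultimately obtain w z where wz: "A v = w + z" "w \<in> W1" "z \<in> E.vs2.span (set zs)"
      unfolding E.vs2.span_Un by auto
    have "set zs = A ` set ?L'" using g by force
    then have "E.vs2.span (set zs) = A ` E.vs1.span (set ?L')" using A.span_image by metis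
    then have "z \<in> A ` E.vs1.span (set ?L')" using wz by simp
    then obtain y where y: "y \<in> E.vs1.span (set ?L')" "z = A y" by blast
    have "set ?L' \<subseteq> V" using g L E.vs1.span_superset by force
    then have "y \<in> V" using y V E.vs1.span_minimal by blast
    then have "v - y \<in> V1" using v wz y V by (simp add: V1 A.diff E.vs1.subspace_diff)
    then have "v - y \<in> E.vs1.span (V1 \<union> set ?L')" by (intro E.vs1.span_base) simp
    moreover have "y \<in> E.vs1.span (V1 \<union> set ?L')"
      using y E.vs1.span_mono[of "set ?L'" "V1 \<union> set ?L'"] by blast
    ultimately have "(v - y) + y \<in> E.vs1.span (V1 \<union> set ?L')" by (rule E.vs1.span_add)
    then show "v \<in> E.vs1.span (V1 \<union> set ?L')" by simp
  qed
  moreover have fdV1: "fd s1 V1"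
    by (rule E.vs1.fd_mono[OF V(2)]) (auto simp: V1)
  ultimately have "E.vs1.dim V \<le> E.vs1.dim (V1 \<union> set ?L')"
    by (intro E.vs1.dim_mono_fd E.vs1.fd_Un E.vs1.fd_finite[of "set ?L'"]) simp_all
  also have "\<dots> \<le> E.vs1.dim V1 + length ?L'"
    by (rule E.vs1.dim_Un_list_le[OF fdV1])
  finally have "length L \<le> length zs" using d by simp
  moreover have "E.vs2.dim (W1 \<union> set (map A L)) \<le> E.vs2.dim W1 + length (map A L)"
    by (rule E.vs2.dim_Un_list_le[OF W1(2)])
  ultimately show ?thesis using zs(3) by simp
qed

text \<open>Pass from \<open>(V, W)\<close> to \<open>(A\<^sup>-\<^sup>1(E V), E V)\<close>. Every string found there ends in \<open>E V\<close>, so it can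
  be prolonged by an \<open>E\<close>-preimage \<open>u\<close> of its last vector and by \<open>A u\<close>; the missing part is filled with
  new strings starting in the kernel of \<open>E\<close> or outside \<open>E V\<close>.\<close>
lemma string_decomposition:
  assumes "E.vs1.subspace V" "fd s1 V" "E.vs2.subspace W" "fd s2 W" "E ` V \<subseteq> W" "A ` V \<subseteq> W"
  shows "\<exists>(ts :: ('a, 'v, 'w) kstring list) V' W'. E.vs1.subspace V' \<and> V' \<subseteq> V
      \<and> E.vs2.subspace W' \<and> W' \<subseteq> W \<and> E ` V' = W' \<and> A ` V' \<subseteq> W'
      \<and> (\<forall>t\<in>set ts. good_string E A t)
      \<and> E.vs1.span (V' \<union> set (vcat ts)) = V \<and> E.vs1.dim V = E.vs1.dim V' + length (vcat ts)
      \<and> E.vs2.span (W' \<union> set (wcat ts)) = W \<and> E.vs2.dim W = E.vs2.dim W' + length (wcat ts)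
      \<and> ((\<forall>v\<in>V. E v = 0 \<longrightarrow> v = 0) \<longrightarrow> (\<forall>t\<in>set ts. \<not> is_NB (fst t)))"
  using assms
proof (induction "E.vs2.dim W" arbitrary: V W rule: less_induct)
  case less
  note V = less.prems(1,2) and W = less.prems(3,4) and EV = less.prems(5) and AV = less.prems(6)
  show ?case
  proof (cases "E ` V = W")
    \<comment> \<open>The iteration has become stationary and no string remains to be split
      off.\<close>
    case True
    then show ?thesis using V W AV
      by (intro exI[of _ "[]"] exI[of _ V] exI[of _ W]) (auto simp: vcat_def wcat_def)
  next
    case False
    define W1 where "W1 = E ` V"
    define V1 where "V1 = {v \<in> V. A v \<in> W1}"
    have W1: "E.vs2.subspace W1" "fd s2 W1" "W1 \<subseteq> W"
      using V EV by (auto simp: W1_def E.subspace_image E.fd_image)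
    have V1: "E.vs1.subspace V1" "V1 \<subseteq> V"
      using V W1 by (auto simp: V1_def E.vs1.subspace_def E.vs2.subspace_def A.add A.scale A.zero)
    have fdV1: "fd s1 V1" by (rule E.vs1.fd_mono[OF V(2) V1(2)])
    have dW1: "E.vs2.dim W1 < E.vs2.dim W"
      using W1 W False by (intro E.vs2.dim_psubset_fd) (auto simp: W1_def)
    have EA1: "E ` V1 \<subseteq> W1" "A ` V1 \<subseteq> W1" using V1 by (auto simp: W1_def V1_def)
    obtain ts :: "('a, 'v, 'w) kstring list" and V' W' where H:
      "E.vs1.subspace V' \<and> V' \<subseteq> V1 \<and> E.vs2.subspace W' \<and> W' \<subseteq> W1 \<and> E ` V' = W' \<and> A ` V' \<subseteq> W'
      \<and> (\<forall>t\<in>set ts. good_string E A t)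
      \<and> E.vs1.span (V' \<union> set (vcat ts)) = V1 \<and> E.vs1.dim V1 = E.vs1.dim V' + length (vcat ts)
      \<and> E.vs2.span (W' \<union> set (wcat ts)) = W1 \<and> E.vs2.dim W1 = E.vs2.dim W' + length (wcat ts)
      \<and> ((\<forall>v\<in>V1. E v = 0 \<longrightarrow> v = 0) \<longrightarrow> (\<forall>t\<in>set ts. \<not> is_NB (fst t)))"
      using less.hyps[OF dW1 V1(1) fdV1 W1(1,2) EA1] by (elim exE) (rule that)
    have IH: "E.vs1.subspace V'" "V' \<subseteq> V1" "E.vs2.subspace W'" "W' \<subseteq> W1" "E ` V' = W'" "A ` V' \<subseteq> W'"
      and good: "\<forall>t\<in>set ts. good_string E A t"
      and spV: "E.vs1.span (V' \<union> set (vcat ts)) = V1" and dV: "E.vs1.dim V1 = E.vs1.dim V' + length (vcat ts)"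
      and spW: "E.vs2.span (W' \<union> set (wcat ts)) = W1" and dW: "E.vs2.dim W1 = E.vs2.dim W' + length (wcat ts)"
      and noNB: "(\<forall>v\<in>V1. E v = 0 \<longrightarrow> v = 0) \<longrightarrow> (\<forall>t\<in>set ts. \<not> is_NB (fst t))"
      using H by - (elim conjE, assumption)+
    note good = bspec[OF good]
    have fdW': "fd s2 W'" by (rule E.vs2.fd_mono[OF W1(2) IH(4)])
    define top where "top t = last (snd (snd t))" for t :: "('a, 'v, 'w) kstring"
    have wsne: "snd (snd t) \<noteq> []" if "t \<in> set ts" for t
      using good[OF that] good_string_ws_nonempty by (metis prod.collapse)
    have topW1: "top t \<in> W1" if "t \<in> set ts" for t
    proof -
      have "top t \<in> set (snd (snd t))" unfolding top_def by (rule last_in_set[OF wsne[OF that]])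
      then have "top t \<in> set (wcat ts)" using that by (auto simp: wcat_def)
      then show ?thesis using spW E.vs2.span_superset by blast
    qed
    define u where "u t = (SOME v. v \<in> V \<and> E v = top t)" for t
    have u: "u t \<in> V" "E (u t) = top t" if "t \<in> set ts" for t
    proof -
      have "\<exists>v. v \<in> V \<and> E v = top t" using topW1[OF that] unfolding W1_def by (metis imageE)
      from someI_ex[OF this] show "u t \<in> V" "E (u t) = top t" unfolding u_def by blast+
    qed
    \<comment> \<open>\<open>S\<close> adds the vectors that prolong the old strings;
      \<open>G\<close> is the kernel in which new strings start.\<close>
    define S where "S = E.vs1.span (V1 \<union> set (map u ts))"
    define G where "G = {v \<in> V. E v = 0}"
    have SV: "S \<subseteq> V" unfolding S_def using V1 V u by (intro E.vs1.span_minimal) auto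
    have fdS: "fd s1 S" by (rule E.vs1.fd_mono[OF V(2) SV])
    have subS: "E.vs1.subspace S" by (simp add: S_def)
    have ESs: "E.vs2.subspace (E ` S)" by (rule E.subspace_image[OF subS])
    have V1S: "V1 \<subseteq> S" unfolding S_def using E.vs1.span_superset by blast
    have uS: "u t \<in> S" if "t \<in> set ts" for t
      unfolding S_def using that by (intro E.vs1.span_base) auto
    have vcatV1: "set (vcat ts) \<subseteq> V1" using spV E.vs1.span_superset by blast
    have W1S: "W1 \<subseteq> E ` S"
    proof -
      have "w \<in> E ` S" if w: "w \<in> set (wcat ts)" for w
      proof -
        obtain t where t: "t \<in> set ts" "w \<in> set (snd (snd t))" using w by (auto simp: wcat_def)
        obtain b vs ws where bvw: "t = (b, vs, ws)" by (cases t)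
        show ?thesis
        proof (cases "w = top t")
          case True then show ?thesis using u[OF t(1)] uS[OF t(1)] by force
        next
          case False
          have "ws = butlast ws @ [top t]" using wsne[OF t(1)] bvw by (simp add: top_def)
          then have "w \<in> set (butlast ws)" using t bvw False
            by (metis Un_iff empty_iff insert_iff list.set(1,2) set_append snd_conv)
          then have "w \<in> E ` set vs" using good_string_nontop good[OF t(1)] bvw by blast
          moreover have "set vs \<subseteq> S" using t bvw vcatV1 V1S by (force simp: vcat_def)
          ultimately show ?thesis by blast
        qed
      qed
      moreover have "W' \<subseteq> E ` S" using IH V1S by blast
      ultimately have "E.vs2.span (W' \<union> set (wcat ts)) \<subseteq> E ` S"
        by (intro E.vs2.span_minimal ESs) auto
      then show ?thesis using spW by simp
    qed
    have fdSG: "fd s1 (S \<union> G)"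
      by (rule E.vs1.fd_mono[OF V(2)]) (use SV in \<open>auto simp: G_def\<close>)
    then obtain ks where ks: "set ks \<subseteq> G" "E.vs1.span (S \<union> set ks) = E.vs1.span (S \<union> G)"
      "E.vs1.dim (S \<union> G) = E.vs1.dim S + length ks"
      by (rule E.vs1.extend_by_list)
    have VSG: "E.vs1.span (S \<union> G) = V"
    proof (rule subset_antisym)
      show "E.vs1.span (S \<union> G) \<subseteq> V" using SV V by (intro E.vs1.span_minimal) (auto simp: G_def)
      show "V \<subseteq> E.vs1.span (S \<union> G)"
      proof
        fix v assume v: "v \<in> V"
        then obtain s where s: "s \<in> S" "E v = E s" using W1S by (auto simp: W1_def)
        then have "v - s \<in> G" using v SV V by (auto simp: G_def E.diff E.vs1.subspace_diff)
        then have "s + (v - s) \<in> E.vs1.span (S \<union> G)"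
          using s by (intro E.vs1.span_add E.vs1.span_base) auto
        then show "v \<in> E.vs1.span (S \<union> G)" by simp
      qed
    qed
    \<comment> \<open>\<open>E\<close> maps \<open>V1\<close> into the span of \<open>W'\<close> and
      the non-final string vectors, so the image falls short of \<open>W1\<close> by at least the
      number of strings. By rank and nullity this makes the preimages \<open>u\<close> independent
      modulo \<open>V1\<close>.\<close>
    have nontop: "E ` V1 \<subseteq> E.vs2.span (W' \<union> set (concat (map (butlast \<circ> snd \<circ> snd) ts)))" (is "_ \<subseteq> ?N")
    proof -
      have "E v \<in> ?N" if v: "v \<in> set (vcat ts)" for v
      proof -
        obtain t where t: "t \<in> set ts" "v \<in> set (fst (snd t))" using v by (auto simp: vcat_def)
        obtain b vs ws where bvw: "t = (b, vs, ws)" by (cases t)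
        have "E v = 0 \<or> E v \<in> set (butlast ws)"
          using good_string_E good[OF t(1)] t bvw by (metis fst_conv snd_conv)
        then show ?thesis
        proof
          assume "E v \<in> set (butlast ws)"
          then have "E v \<in> W' \<union> set (concat (map (butlast \<circ> snd \<circ> snd) ts))" using t bvw by force
          then show ?thesis by (rule E.vs2.span_base)
        qed (simp add: E.vs2.span_zero)
      qed
      moreover have "E v \<in> ?N" if "v \<in> V'" for v
        using that IH by (intro E.vs2.span_base) auto
      ultimately have "E ` (V' \<union> set (vcat ts)) \<subseteq> ?N" by blast
      then have "E.vs2.span (E ` (V' \<union> set (vcat ts))) \<subseteq> ?N" by (intro E.vs2.span_minimal) auto
      then show ?thesis using spV E.span_image by metis
    qed
    have len: "length (wcat ts) = length (concat (map (butlast \<circ> snd \<circ> snd) ts)) + length ts"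
      using wsne unfolding wcat_def
    proof (induction ts)
      case (Cons t ts)
      have "length (snd (snd t)) = Suc (length (butlast (snd (snd t))))"
        using Cons.prems[of t] by (simp del: length_butlast add: length_butlast) 
      then show ?case using Cons by simp
    qed simp
    have "E.vs2.dim (E ` V1) \<le> E.vs2.dim (W' \<union> set (concat (map (butlast \<circ> snd \<circ> snd) ts)))"
      by (intro E.vs2.dim_mono_fd nontop E.vs2.fd_Un fdW' E.vs2.fd_finite) simp
    also have "\<dots> \<le> E.vs2.dim W' + length (concat (map (butlast \<circ> snd \<circ> snd) ts))"
      by (rule E.vs2.dim_Un_list_le[OF fdW'])
    finally have dEV1: "E.vs2.dim (E ` V1) + length ts \<le> E.vs2.dim W1" using dW len by simp
    have "E.vs1.dim S = E.vs1.dim V1 + length ts"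
    proof (rule antisym)
      show "E.vs1.dim S \<le> E.vs1.dim V1 + length ts"
        using E.vs1.dim_Un_list_le[OF fdV1, of "map u ts"] by (simp add: S_def)
      have "E ` S = W1" using W1S SV by (auto simp: W1_def)
      then have "E.vs1.dim S = E.vs2.dim W1 + E.vs1.dim {x \<in> S. E x = 0}"
        using E.rank_nullity[OF subS fdS] by simp
      moreover have "E.vs1.dim {x \<in> V1. E x = 0} \<le> E.vs1.dim {x \<in> S. E x = 0}"
        using V1S by (intro E.vs1.dim_subset_fd E.vs1.fd_mono[OF fdS]) auto
      ultimately show "E.vs1.dim V1 + length ts \<le> E.vs1.dim S"
        using E.rank_nullity[OF V1(1) fdV1] dEV1 by simp
    qed
    moreover have "E.vs1.dim V = E.vs1.dim (S \<union> G)" using VSG E.vs1.dim_span by metis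
    ultimately have dVt: "E.vs1.dim V = E.vs1.dim V1 + length (map u ts @ ks)" using ks by simp
    have spVt: "E.vs1.span (V1 \<union> set (map u ts @ ks)) = V"
    proof (rule subset_antisym)
      show "E.vs1.span (V1 \<union> set (map u ts @ ks)) \<subseteq> V"
        using V1 V u ks by (intro E.vs1.span_minimal) (auto simp: G_def)
      have "S \<subseteq> E.vs1.span (V1 \<union> set (map u ts @ ks))"
        unfolding S_def by (intro E.vs1.span_mono) auto
      moreover have "set ks \<subseteq> E.vs1.span (V1 \<union> set (map u ts @ ks))"
        by (auto intro: E.vs1.span_base)
      ultimately have "E.vs1.span (S \<union> set ks) \<subseteq> E.vs1.span (V1 \<union> set (map u ts @ ks))"
        by (intro E.vs1.span_minimal) auto
      then show "V \<subseteq> E.vs1.span (V1 \<union> set (map u ts @ ks))" using ks VSG by simp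
    qed
    let ?L = "map u ts @ ks"
    have dWL: "E.vs2.dim (W1 \<union> A ` set ?L) = E.vs2.dim W1 + length ?L"
      by (rule dim_quotient_embed[OF V W1(1,2) V1_def spVt dVt])
    have LV: "set ?L \<subseteq> V" using spVt E.vs1.span_superset by blast
    have WL: "W1 \<union> A ` set ?L \<subseteq> W" using LV W1 AV by blast
    then have "fd s2 ((W1 \<union> A ` set ?L) \<union> W)" using W by (simp add: Un_absorb1)
    then obtain zs where zs: "set zs \<subseteq> W" "E.vs2.span ((W1 \<union> A ` set ?L) \<union> set zs) = E.vs2.span ((W1 \<union> A ` set ?L) \<union> W)"
      "E.vs2.dim ((W1 \<union> A ` set ?L) \<union> W) = E.vs2.dim (W1 \<union> A ` set ?L) + length zs"
      by (rule E.vs2.extend_by_list)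
    have WW: "(W1 \<union> A ` set ?L) \<union> W = W" using WL by blast
    \<comment> \<open>A kernel vector starts an infinite block of size 1. A vector needed to
      complete \<open>W1\<close> and the images under \<open>A\<close> to \<open>W\<close> starts
      \<open>LTB 0\<close>, which has one row and no column.\<close>
    define ts' :: "('a, 'v, 'w) kstring list" where
      "ts' = map (\<lambda>t. (kgrow (fst t), fst (snd t) @ [u t], snd (snd t) @ [A (u t)])) ts
          @ map (\<lambda>k. (NB 1, [k], [A k])) ks @ map (\<lambda>z. (LTB 0, [], [z])) zs"
    have setv: "set (vcat ts') = set (vcat ts) \<union> set ?L"
      by (auto simp: ts'_def vcat_def)
    have setw: "set (wcat ts') = set (wcat ts) \<union> A ` set ?L \<union> set zs"
      by (auto simp: ts'_def wcat_def)
    have lenv: "length (vcat ts') = length (vcat ts) + length ?L"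
      by (simp add: ts'_def vcat_def length_concat o_def sum_list_Suc sum_list_triv)
    have lenw: "length (wcat ts') = length (wcat ts) + length ?L + length zs"
      by (simp add: ts'_def wcat_def length_concat o_def sum_list_Suc sum_list_triv)
    have good': "good_string E A t" if t: "t \<in> set ts'" for t
    proof -
      consider s where "s \<in> set ts" "t = (kgrow (fst s), fst (snd s) @ [u s], snd (snd s) @ [A (u s)])"
        | k where "k \<in> set ks" "t = (NB 1, [k], [A k])" | z where "z \<in> set zs" "t = (LTB 0, [], [z])"
        using t by (auto simp: ts'_def)
      then show ?thesis
      proof cases
        case 1
        then show ?thesis using good[OF 1(1)] u[OF 1(1)]
          by (cases s) (auto simp: top_def intro: good_string_grow)
      qed (use ks in \<open>auto simp: good_string_def G_def\<close>)
    qed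
    have spV': "E.vs1.span (V' \<union> set (vcat ts')) = V"
    proof (rule subset_antisym)
      show "E.vs1.span (V' \<union> set (vcat ts')) \<subseteq> V"
        using IH V1 vcatV1 LV V unfolding setv by (intro E.vs1.span_minimal) auto
      have "V1 \<subseteq> E.vs1.span (V' \<union> set (vcat ts'))"
        unfolding spV[symmetric] setv by (intro E.vs1.span_mono) auto
      moreover have "set ?L \<subseteq> E.vs1.span (V' \<union> set (vcat ts'))"
        unfolding setv by (auto intro: E.vs1.span_base)
      ultimately show "V \<subseteq> E.vs1.span (V' \<union> set (vcat ts'))"
        unfolding spVt[symmetric] by (intro E.vs1.span_minimal) (simp_all del: set_append)
    qed
    have spW': "E.vs2.span (W' \<union> set (wcat ts')) = W"
    proof (rule subset_antisym)
      have "set (wcat ts) \<subseteq> W1" using spW E.vs2.span_superset by blast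
      then show "E.vs2.span (W' \<union> set (wcat ts')) \<subseteq> W"
        using IH W1 WL W zs(1) unfolding setw by (intro E.vs2.span_minimal) auto
      have "W1 \<subseteq> E.vs2.span (W' \<union> set (wcat ts'))"
        unfolding spW[symmetric] setw by (intro E.vs2.span_mono) auto
      moreover have "A ` set ?L \<union> set zs \<subseteq> E.vs2.span (W' \<union> set (wcat ts'))"
        unfolding setw by (auto intro: E.vs2.span_base)
      ultimately have "E.vs2.span ((W1 \<union> A ` set ?L) \<union> set zs) \<subseteq> E.vs2.span (W' \<union> set (wcat ts'))"
        by (intro E.vs2.span_minimal) (simp_all del: set_append)
      then show "W \<subseteq> E.vs2.span (W' \<union> set (wcat ts'))" using zs(2) WW E.vs2.span_superset[of W] by simp
    qed
    \<comment> \<open>With \<open>E\<close> injective, \<open>G\<close> is zero, so no string starts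
      in the kernel, and prolonging preserves the kind of a string.\<close>
    have noNB': "\<forall>t\<in>set ts'. \<not> is_NB (fst t)" if inj: "\<forall>v\<in>V. E v = 0 \<longrightarrow> v = 0"
    proof -
      have "G \<subseteq> S" using inj E.vs1.subspace_0[OF subS] by (auto simp: G_def)
      then have "ks = []" using ks(3) by (simp add: Un_absorb2)
      moreover have "\<not> is_NB (kgrow (fst t))" if "t \<in> set ts" for t
        using noNB inj V1 that by (cases "fst t") auto
      ultimately show ?thesis by (auto simp: ts'_def)
    qed
    have "E.vs1.dim V = E.vs1.dim V' + length (vcat ts')" using lenv dV dVt by simp
    moreover have "E.vs2.dim W = E.vs2.dim W' + length (wcat ts')" using lenw dW dWL zs(3) WW by simp
    moreover have "V' \<subseteq> V" "W' \<subseteq> W" using IH(2,4) V1(2) W1(3) by (meson order_trans)+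
    moreover have "(\<forall>v\<in>V. E v = 0 \<longrightarrow> v = 0) \<longrightarrow> (\<forall>t\<in>set ts'. \<not> is_NB (fst t))"
      using noNB' by (rule impI)
    moreover have "\<forall>t\<in>set ts'. good_string E A t" using good' by (rule ballI)
    ultimately show ?thesis using IH(1,3,5,6) spV' spW'
      by (intro exI[of _ ts'] exI[of _ V'] exI[of _ W'] conjI) assumption+
  qed
qed

end

subsection \<open>Strict equivalence and the Kronecker form\<close>

text \<open>Coordinate vectors get the same encoding as polynomial vectors, over any field: it is
  used for the ground field and for the rational functions.\<close>

definition fscale :: "'k::field \<Rightarrow> ('i \<Rightarrow> 'k) \<Rightarrow> 'i \<Rightarrow> 'k" where
  "fscale c f = (\<lambda>i. c * f i)"

lemma fscale_apply [simp]: "fscale c f i = c * f i"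
  by (simp add: fscale_def)

interpretation fs: Vector_Spaces.vector_space fscale
  by unfold_locales (auto simp: fscale_def fun_eq_iff algebra_simps)

definition FV :: "nat \<Rightarrow> (nat \<Rightarrow> 'k::field) set" where
  "FV n = {f. \<forall>i\<ge>n. f i = 0}"

definition unitf :: "nat \<Rightarrow> nat \<Rightarrow> 'k::field" where
  "unitf i = (\<lambda>k. if k = i then 1 else 0)"

lemma unitf_apply: "unitf i k = (if k = i then 1 else 0)"
  by (simp add: unitf_def)

lemma subspace_FV: "fs.subspace (FV n)"
  by (auto simp: fs.subspace_def FV_def)

lemma FV_expand: "f \<in> FV n \<Longrightarrow> f = (\<Sum>i<n. fscale (f i) (unitf i))"
  by (rule ext) (auto simp: sum_fun_apply unitf_def FV_def if_distrib cong: if_cong)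

lemma FV_subset_span: "FV n \<subseteq> fs.span (unitf ` {..<n})"
proof
  fix f :: "nat \<Rightarrow> 'a" assume "f \<in> FV n"
  then have "f = (\<Sum>i<n. fscale (f i) (unitf i))" by (rule FV_expand)
  also have "\<dots> \<in> fs.span (unitf ` {..<n})"
    by (intro fs.span_sum fs.span_scale fs.span_base) auto
  finally show "f \<in> fs.span (unitf ` {..<n})" .
qed

lemma fd_FV: "fd fscale (FV n)"
  unfolding fd_def by (intro exI[of _ "unitf ` {..<n}"] conjI FV_subset_span) simp

lemma dim_FV: "fs.dim (FV n :: (nat \<Rightarrow> 'k::field) set) = n"
proof -
  have inj: "inj_on (unitf :: nat \<Rightarrow> nat \<Rightarrow> 'k) {..<n}"
    by (auto simp: inj_on_def unitf_def fun_eq_iff)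
  have "fs.independent ((unitf :: nat \<Rightarrow> nat \<Rightarrow> 'k) ` {..<n})"
  proof (rule fs.independent_if_scalars_zero)
    fix f and x :: "nat \<Rightarrow> 'k"
    assume 0: "(\<Sum>p\<in>unitf ` {..<n}. fscale (f p) p) = (0 :: nat \<Rightarrow> 'k)" and "x \<in> unitf ` {..<n}"
    then obtain k where k: "k < n" "x = unitf k" by auto
    have "0 = (\<Sum>j<n. fscale (f (unitf j)) (unitf j)) k"
      using 0 by (simp add: sum.reindex[OF inj])
    also have "\<dots> = f x" using k by (simp add: sum_fun_apply unitf_apply if_distrib cong: if_cong)
    finally show "f x = 0" by simp
  qed simp
  then have "fs.dim (FV n :: (nat \<Rightarrow> 'k) set) = card ((unitf :: nat \<Rightarrow> nat \<Rightarrow> 'k) ` {..<n})"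
    by (intro fs.dim_unique[OF _ FV_subset_span _ refl]) (auto simp: FV_def unitf_def)
  then show ?thesis using inj by (simp add: card_image)
qed

section \<open>Matrices as linear maps and their representation in lists of vectors\<close>

definition mapm :: "'k::field mat \<Rightarrow> (nat \<Rightarrow> 'k) \<Rightarrow> nat \<Rightarrow> 'k" where
  "mapm M x = (\<lambda>r. if r < dim_row M then \<Sum>i<dim_col M. M $$ (r, i) * x i else 0)"

lemma linear_mapm: "Vector_Spaces.linear fscale fscale (mapm M)"
  by unfold_locales (auto simp: mapm_def fun_eq_iff algebra_simps sum.distrib sum_distrib_left)

lemma mapm_FV: "M \<in> carrier_mat p q \<Longrightarrow> mapm M x \<in> FV p"
  by (auto simp: mapm_def FV_def)

lemma mapm_one: "x \<in> FV n \<Longrightarrow> mapm (1\<^sub>m n) x = x"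
  by (auto simp: mapm_def FV_def fun_eq_iff if_distrib if_distribR cong: if_cong)

text \<open>Neither list has to be a basis, so that strings can be represented one at a time and the
  representations joined into a block diagonal matrix.\<close>

definition represents :: "'k::field mat \<Rightarrow> (nat \<Rightarrow> 'k) list \<Rightarrow> (nat \<Rightarrow> 'k) list \<Rightarrow> 'k mat \<Rightarrow> bool" where
  "represents M xs ys D \<longleftrightarrow> D \<in> carrier_mat (length ys) (length xs) \<and>
     (\<forall>j<length xs. mapm M (xs ! j) = (\<Sum>i<length ys. fscale (D $$ (i, j)) (ys ! i)))"

definition colmat :: "nat \<Rightarrow> (nat \<Rightarrow> 'k) list \<Rightarrow> 'k mat" where
  "colmat n xs = mat n (length xs) (\<lambda>(i, j). (xs ! j) i)"

lemma colmat_carrier [simp]: "colmat n xs \<in> carrier_mat n (length xs)"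
  by (simp add: colmat_def)

lemma sum_lessThan_add:
  fixes f :: "nat \<Rightarrow> 'b::comm_monoid_add"
  shows "(\<Sum>i<a + b. f i) = (\<Sum>i<a. f i) + (\<Sum>i<b. f (a + i))"
  by (induction b) (auto simp: add.assoc)

lemma represents_append:
  assumes "represents M xs ys D" "represents M xs' ys' D'"
  shows "represents M (xs @ xs') (ys @ ys')
    (four_block_mat D (0\<^sub>m (dim_row D) (dim_col D')) (0\<^sub>m (dim_row D') (dim_col D)) D')"
proof -
  let ?F = "four_block_mat D (0\<^sub>m (dim_row D) (dim_col D')) (0\<^sub>m (dim_row D') (dim_col D)) D'"
  have D: "dim_row D = length ys" "dim_col D = length xs" "dim_row D' = length ys'" "dim_col D' = length xs'"
    using assms by (auto simp: represents_def)
  have "mapm M ((xs @ xs') ! j) = (\<Sum>i<length (ys @ ys'). fscale (?F $$ (i, j)) ((ys @ ys') ! i))"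
    if j: "j < length (xs @ xs')" for j
  proof (cases "j < length xs")
    case True
    have z: "(\<Sum>i<length ys'. fscale (?F $$ (length ys + i, j)) ((ys @ ys') ! (length ys + i))) = 0"
      using D True j by (intro sum.neutral) (auto simp: fscale_def fun_eq_iff)
    have "mapm M ((xs @ xs') ! j) = (\<Sum>i<length ys. fscale (D $$ (i, j)) (ys ! i))"
      using assms True by (simp add: represents_def nth_append)
    also have "\<dots> = (\<Sum>i<length ys. fscale (?F $$ (i, j)) ((ys @ ys') ! i))"
      using D True by (intro sum.cong) (auto simp: nth_append)
    finally show ?thesis using z by (simp add: sum_lessThan_add)
  next
    case False
    have z: "(\<Sum>i<length ys. fscale (?F $$ (i, j)) ((ys @ ys') ! i)) = 0"
      using D False j by (intro sum.neutral) (auto simp: fscale_def fun_eq_iff)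
    have "mapm M ((xs @ xs') ! j) = (\<Sum>i<length ys'. fscale (D' $$ (i, j - length xs)) (ys' ! i))"
      using assms False j by (simp add: represents_def nth_append)
    also have "\<dots> = (\<Sum>i<length ys'. fscale (?F $$ (length ys + i, j)) ((ys @ ys') ! (length ys + i)))"
      using D False j by (intro sum.cong) (auto simp: nth_append)
    finally show ?thesis using z by (simp add: sum_lessThan_add)
  qed
  then show ?thesis using D by (auto simp: represents_def)
qed

lemma represents_Nil: "represents M [] [] (0\<^sub>m 0 0)"
  by (simp add: represents_def)

lemma represents_mult:
  assumes "represents M xs ys D" "M \<in> carrier_mat p q"
  shows "M * colmat q xs = colmat p ys * D"
proof (rule eq_matI)
  have D: "D \<in> carrier_mat (length ys) (length xs)" using assms by (simp add: represents_def)
  fix r j assume "r < dim_row (colmat p ys * D)" "j < dim_col (colmat p ys * D)"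
  then have rj: "r < p" "j < length xs" using D by (auto simp: colmat_def)
  have "(M * colmat q xs) $$ (r, j) = mapm M (xs ! j) r"
    using rj assms(2) by (auto simp: mapm_def colmat_def scalar_prod_def atLeast0LessThan intro!: sum.cong)
  also have "\<dots> = (\<Sum>i<length ys. D $$ (i, j) * (ys ! i) r)"
    using assms(1) rj by (simp add: represents_def sum_fun_apply)
  also have "\<dots> = (colmat p ys * D) $$ (r, j)"
    using rj D by (auto simp: colmat_def scalar_prod_def atLeast0LessThan intro!: sum.cong)
  finally show "(M * colmat q xs) $$ (r, j) = (colmat p ys * D) $$ (r, j)" .
qed (use assms in \<open>auto simp: represents_def colmat_def\<close>)

text \<open>Writing the unit vectors in terms of \<open>xs\<close> gives a right inverse, and the
  matrix is square.\<close>

lemma colmat_invertible: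
  fixes xs :: "(nat \<Rightarrow> 'k::field) list"
  assumes "FV n \<subseteq> fs.span (set xs)" "length xs = n"
  obtains X where "X \<in> carrier_mat n n" "colmat n xs * X = 1\<^sub>m n" "X * colmat n xs = 1\<^sub>m n"
proof -
  have "\<exists>c. unitf j = (\<Sum>i<n. fscale (c i) (xs ! i))" if "j < n" for j
  proof -
    have "unitf j \<in> fs.span (set xs)" using assms that by (auto simp: FV_def unitf_def)
    then show ?thesis using assms(2) by (metis fs.span_list_ext)
  qed
  then obtain c where c: "\<And>j. j < n \<Longrightarrow> unitf j = (\<Sum>i<n. fscale (c j i) (xs ! i))" by metis
  define X where "X = mat n n (\<lambda>(i, j). c j i)"
  have "colmat n xs * X = 1\<^sub>m n"
  proof (rule eq_matI)
    fix r j assume "r < dim_row (1\<^sub>m n)" "j < dim_col (1\<^sub>m n)"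
    then have rj: "r < n" "j < n" by auto
    have "(colmat n xs * X) $$ (r, j) = (\<Sum>i<n. c j i * (xs ! i) r)"
      using rj assms(2)
      by (auto simp: colmat_def X_def scalar_prod_def atLeast0LessThan mult.commute intro!: sum.cong)
    also have "\<dots> = unitf j r" using c[OF rj(2)] by (simp add: sum_fun_apply)
    finally show "(colmat n xs * X) $$ (r, j) = 1\<^sub>m n $$ (r, j)" using rj by (simp add: unitf_def)
  qed (use assms in \<open>auto simp: colmat_def X_def\<close>)
  moreover have "X \<in> carrier_mat n n" by (simp add: X_def)
  moreover have "colmat n xs \<in> carrier_mat n n" using assms(2) by (simp add: colmat_def)
  ultimately show ?thesis using that mat_mult_left_right_inverse by blast
qed

section \<open>Strict equivalence of pencils\<close>

definition kequiv :: "'a::field pencil \<Rightarrow> 'a pencil \<Rightarrow> bool" where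
  "kequiv A B \<longleftrightarrow> (\<exists>p q P P' Q Q'. P \<in> carrier_mat p p \<and> P' \<in> carrier_mat p p \<and>
     Q \<in> carrier_mat q q \<and> Q' \<in> carrier_mat q q \<and> P * P' = 1\<^sub>m p \<and> P' * P = 1\<^sub>m p \<and>
     Q * Q' = 1\<^sub>m q \<and> Q' * Q = 1\<^sub>m q \<and>
     fst A \<in> carrier_mat p q \<and> snd A \<in> carrier_mat p q \<and>
     P * fst A * Q = fst B \<and> P * snd A * Q = snd B)"

text \<open>\<open>A Q = R B\<close> is the form in which a change of bases arises; the left factor
  of the equivalence is then the inverse of \<open>R\<close>. \<open>kequiv\<close> carries inverses
  as witnesses, so that they can be composed and transposed explicitly.\<close>

lemma kequivI:
  assumes "fst A \<in> carrier_mat p q" "snd A \<in> carrier_mat p q"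
    and R: "R \<in> carrier_mat p p" "R' \<in> carrier_mat p p" "R * R' = 1\<^sub>m p" "R' * R = 1\<^sub>m p"
    and Q: "Q \<in> carrier_mat q q" "Q' \<in> carrier_mat q q" "Q * Q' = 1\<^sub>m q" "Q' * Q = 1\<^sub>m q"
    and B: "fst B \<in> carrier_mat p q" "snd B \<in> carrier_mat p q"
    and eq: "fst A * Q = R * fst B" "snd A * Q = R * snd B"
  shows "kequiv A B"
proof -
  have K: "R' * M * Q = N" if "M * Q = R * N" "M \<in> carrier_mat p q" "N \<in> carrier_mat p q" for M N
  proof -
    have "R' * M * Q = R' * (M * Q)" by (rule assoc_mult_mat[OF R(2) that(2) Q(1)])
    also have "\<dots> = (R' * R) * N" unfolding that(1) by (rule assoc_mult_mat[OF R(2,1) that(3), symmetric])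
    finally show ?thesis using R that by simp
  qed
  show ?thesis unfolding kequiv_def
    by (intro exI[of _ p] exI[of _ q] exI[of _ R'] exI[of _ R] exI[of _ Q] exI[of _ Q'] conjI
        R Q assms(1,2) K[OF eq(1) assms(1) B(1)] K[OF eq(2) assms(2) B(2)])
qed

lemma kequiv_trans:
  assumes "kequiv A B" "kequiv B C" shows "kequiv A C"
proof -
  from assms(1) obtain p q P P' Q Q' where 1: "P \<in> carrier_mat p p" "P' \<in> carrier_mat p p"
     "Q \<in> carrier_mat q q" "Q' \<in> carrier_mat q q" "P * P' = 1\<^sub>m p" "P' * P = 1\<^sub>m p"
     "Q * Q' = 1\<^sub>m q" "Q' * Q = 1\<^sub>m q" "fst A \<in> carrier_mat p q" "snd A \<in> carrier_mat p q"
     "P * fst A * Q = fst B" "P * snd A * Q = snd B" unfolding kequiv_def by blast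
  from assms(2) obtain p1 q1 R R' S S' where 2: "R \<in> carrier_mat p1 p1" "R' \<in> carrier_mat p1 p1"
     "S \<in> carrier_mat q1 q1" "S' \<in> carrier_mat q1 q1" "R * R' = 1\<^sub>m p1" "R' * R = 1\<^sub>m p1"
     "S * S' = 1\<^sub>m q1" "S' * S = 1\<^sub>m q1" "fst B \<in> carrier_mat p1 q1" "snd B \<in> carrier_mat p1 q1"
     "R * fst B * S = fst C" "R * snd B * S = snd C" unfolding kequiv_def by blast
  have "fst B \<in> carrier_mat p q" using 1 by (metis mult_carrier_mat)
  then have pq: "p1 = p" "q1 = q" using 2 by auto
  note 2 = 2[unfolded pq]
  have m: "(R * P) * M * (Q * S) = R * (P * M * Q) * S" if M: "M \<in> carrier_mat p q" for M
  proof -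
    have PM: "P * M \<in> carrier_mat p q" and RPM: "R * (P * M) \<in> carrier_mat p q" using 1 2 M by auto
    have "(R * P) * M * (Q * S) = R * (P * M) * (Q * S)"
      by (simp add: assoc_mult_mat[OF 2(1) 1(1) M])
    also have "\<dots> = R * (P * M) * Q * S" by (rule assoc_mult_mat[OF RPM 1(3) 2(3), symmetric])
    also have "\<dots> = R * (P * M * Q) * S" by (simp add: assoc_mult_mat[OF 2(1) PM 1(3)])
    finally show ?thesis .
  qed
  have i: "(X * Y) * (Y' * X') = 1\<^sub>m n" if "X \<in> carrier_mat n n" "Y \<in> carrier_mat n n"
    "X' \<in> carrier_mat n n" "Y' \<in> carrier_mat n n" "Y * Y' = 1\<^sub>m n" "X * X' = 1\<^sub>m n"
    for X Y X' Y' :: "'a mat" and n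
  proof -
    have "(X * Y) * (Y' * X') = X * (Y * (Y' * X'))" using that by (intro assoc_mult_mat) auto
    also have "Y * (Y' * X') = (Y * Y') * X'" using that by (intro assoc_mult_mat[symmetric]) auto
    finally show ?thesis using that by simp
  qed
  have e: "(R * P) * fst A * (Q * S) = fst C" "(R * P) * snd A * (Q * S) = snd C"
    using m[OF 1(9)] m[OF 1(10)] 1(11,12) 2(11,12) by simp_all
  show ?thesis unfolding kequiv_def
    by (rule exI[of _ p], rule exI[of _ q], rule exI[of _ "R * P"], rule exI[of _ "P' * R'"],
        rule exI[of _ "Q * S"], rule exI[of _ "S' * Q'"], intro conjI mult_carrier_mat[of _ p p] mult_carrier_mat[of _ q q]
        i[OF 2(1) 1(1) 2(2) 1(2) 1(5) 2(5)] i[OF 1(2) 2(2) 1(1) 2(1) 2(6) 1(6)]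
        i[OF 1(3) 2(3) 1(4) 2(4) 2(7) 1(7)] i[OF 2(4) 1(4) 2(3) 1(3) 1(8) 2(8)] e 1(1-4,9,10) 2(1-4))
qed

lemma kequiv_transpose:
  assumes "kequiv A B"
  shows "kequiv (transpose_mat (fst A), transpose_mat (snd A)) (transpose_mat (fst B), transpose_mat (snd B))"
proof -
  from assms obtain p q P P' Q Q' where 1: "P \<in> carrier_mat p p" "P' \<in> carrier_mat p p"
     "Q \<in> carrier_mat q q" "Q' \<in> carrier_mat q q" "P * P' = 1\<^sub>m p" "P' * P = 1\<^sub>m p"
     "Q * Q' = 1\<^sub>m q" "Q' * Q = 1\<^sub>m q" "fst A \<in> carrier_mat p q" "snd A \<in> carrier_mat p q"
     "P * fst A * Q = fst B" "P * snd A * Q = snd B" unfolding kequiv_def by blast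
  have t: "transpose_mat Q * transpose_mat M * transpose_mat P = transpose_mat (P * M * Q)"
    if "M \<in> carrier_mat p q" for M
  proof -
    have "transpose_mat (P * M * Q) = transpose_mat Q * (transpose_mat M * transpose_mat P)"
      using 1 that by (simp add: transpose_mult[of _ p q _ q] transpose_mult[of _ p p _ q])
    also have "\<dots> = transpose_mat Q * transpose_mat M * transpose_mat P"
      using 1 that by (intro assoc_mult_mat[symmetric]) auto
    finally show ?thesis by simp
  qed
  have i: "transpose_mat Y * transpose_mat X = 1\<^sub>m n" if "X \<in> carrier_mat n n" "Y \<in> carrier_mat n n" "X * Y = 1\<^sub>m n"
    for X Y :: "'a mat" and n
    using transpose_mult[OF that(1,2)] that(3) by simp
  have e: "transpose_mat Q * transpose_mat (fst A) * transpose_mat P = transpose_mat (fst B)"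
    "transpose_mat Q * transpose_mat (snd A) * transpose_mat P = transpose_mat (snd B)"
    using t[OF 1(9)] t[OF 1(10)] 1(11,12) by simp_all
  show ?thesis unfolding kequiv_def fst_conv snd_conv
    by (rule exI[of _ q], rule exI[of _ p], rule exI[of _ "transpose_mat Q"], rule exI[of _ "transpose_mat Q'"],
        rule exI[of _ "transpose_mat P"], rule exI[of _ "transpose_mat P'"],
        intro conjI e i[OF 1(4,3,8)] i[OF 1(3,4,7)] i[OF 1(2,1,6)] i[OF 1(1,2,5)])
      (use 1(1-4,9,10) in simp_all)
qed

section \<open>Direct sums of pencils\<close>

definition bdiag :: "'a::zero mat \<Rightarrow> 'a mat \<Rightarrow> 'a mat" where
  "bdiag A B = four_block_mat A (0\<^sub>m (dim_row A) (dim_col B)) (0\<^sub>m (dim_row B) (dim_col A)) B"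

lemma diag_block_mat_append': "diag_block_mat (As @ Bs) = bdiag (diag_block_mat As) (diag_block_mat Bs)"
  by (simp add: diag_block_mat_append bdiag_def Let_def)

lemma bdiag_carrier: "A \<in> carrier_mat a b \<Longrightarrow> B \<in> carrier_mat c d \<Longrightarrow> bdiag A B \<in> carrier_mat (a + c) (b + d)"
  by (simp add: bdiag_def)

lemma bdiag_mult:
  assumes "A \<in> carrier_mat a b" "B \<in> carrier_mat c d" "A' \<in> carrier_mat b e" "B' \<in> carrier_mat d f"
  shows "bdiag A B * bdiag A' B' = bdiag (A * A') (B * B' :: 'a::field mat)"
proof -
  have "bdiag A B * bdiag A' B' = four_block_mat (A * A' + 0\<^sub>m a d * 0\<^sub>m d e) (A * 0\<^sub>m b f + 0\<^sub>m a d * B')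
       (0\<^sub>m c b * A' + B * 0\<^sub>m d e) (0\<^sub>m c b * 0\<^sub>m b f + B * B')"
    unfolding bdiag_def using assms by (subst mult_four_block_mat[of _ a b _ d _ c _ _ e _ f]) auto
  also have "\<dots> = bdiag (A * A') (B * B')"
    unfolding bdiag_def using assms by (intro cong_four_block_mat) auto
  finally show ?thesis .
qed

lemma bdiag_one: "bdiag (1\<^sub>m a) (1\<^sub>m b) = 1\<^sub>m (a + b)"
  by (simp add: bdiag_def)

lemma bdiag_transpose: "transpose_mat (bdiag A B) = bdiag (transpose_mat A) (transpose_mat B)"
  unfolding bdiag_def by (subst transpose_four_block_mat[of _ "dim_row A" "dim_col A" _ "dim_col B" _ "dim_row B"]) auto

lemma kequiv_bdiag:
  assumes "kequiv A B" "C0 \<in> carrier_mat c d" "C1 \<in> carrier_mat c d"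
  shows "kequiv (bdiag C0 (fst A), bdiag C1 (snd A)) (bdiag C0 (fst B), bdiag C1 (snd B))"
proof -
  from assms obtain p q P P' Q Q' where 1: "P \<in> carrier_mat p p" "P' \<in> carrier_mat p p"
     "Q \<in> carrier_mat q q" "Q' \<in> carrier_mat q q" "P * P' = 1\<^sub>m p" "P' * P = 1\<^sub>m p"
     "Q * Q' = 1\<^sub>m q" "Q' * Q = 1\<^sub>m q" "fst A \<in> carrier_mat p q" "snd A \<in> carrier_mat p q"
     "P * fst A * Q = fst B" "P * snd A * Q = snd B" unfolding kequiv_def by blast
  have t: "bdiag (1\<^sub>m c) P * bdiag C M * bdiag (1\<^sub>m d) Q = bdiag C (P * M * Q)"
    if "M \<in> carrier_mat p q" "C \<in> carrier_mat c d" for M C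
    using 1 that by (simp add: bdiag_mult[of _ c c _ p p _ d _ q] bdiag_mult[of _ c d _ p q _ d _ q])
  have i: "bdiag (1\<^sub>m k) X * bdiag (1\<^sub>m k) Y = 1\<^sub>m (k + n)"
    if "X \<in> carrier_mat n n" "Y \<in> carrier_mat n n" "X * Y = 1\<^sub>m n" for X Y :: "'a mat" and k n
    using bdiag_mult[OF one_carrier_mat that(1) one_carrier_mat that(2), of k] that(3) by (simp add: bdiag_one)
  show ?thesis unfolding kequiv_def fst_conv snd_conv
    by (rule exI[of _ "c + p"], rule exI[of _ "d + q"], rule exI[of _ "bdiag (1\<^sub>m c) P"], rule exI[of _ "bdiag (1\<^sub>m c) P'"],
        rule exI[of _ "bdiag (1\<^sub>m d) Q"], rule exI[of _ "bdiag (1\<^sub>m d) Q'"],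
        intro conjI bdiag_carrier one_carrier_mat 1(1-4,9,10) assms(2,3)
          i[OF 1(1,2,5)] i[OF 1(2,1,6)] i[OF 1(3,4,7)] i[OF 1(4,3,8)])
      (use t[OF 1(9) assms(2)] t[OF 1(10) assms(3)] 1(11,12) in simp_all)
qed

lemma fscale_if: "fscale (if b then 1 else 0) x = (if b then x else 0)"
  by (auto simp: fscale_def fun_eq_iff)

text \<open>The conditions in \<open>good_string\<close> are the columns of the two coefficients of
  the block, that of s for \<open>E\<close> and the constant one for \<open>A\<close>.\<close>

lemma good_string_represents:
  assumes "good_string (mapm E) (mapm A) (b, vs, ws)"
  shows "represents E vs ws (snd (kblock_pencil b))" "represents A vs ws (fst (kblock_pencil b))"
proof -
  have "represents E vs ws (snd (kblock_pencil b)) \<and> represents A vs ws (fst (kblock_pencil b))"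
  proof (cases b)
    case (NB k)
    have "mapm E (vs ! j) = (\<Sum>i<k. fscale (if j = i + 1 then 1 else 0) (ws ! i))" if "j < k" for j
      using assms NB that by (cases j) (auto simp: good_string_def fscale_if)
    moreover have "mapm A (vs ! j) = (\<Sum>i<k. fscale (if i = j then 1 else 0) (ws ! i))" if "j < k" for j
      using assms NB that by (auto simp: good_string_def fscale_if)
    ultimately show ?thesis
      using assms NB by (auto simp: represents_def shift_mat_def good_string_def intro!: sum.cong)
  next
    case (LTB k)
    have "mapm E (vs ! j) = (\<Sum>i<Suc k. fscale (if i = j then 1 else 0) (ws ! i))" if "j < k" for j
      using assms LTB that by (auto simp: good_string_def fscale_if simp del: sum.lessThan_Suc)
    moreover have "mapm A (vs ! j) = (\<Sum>i<Suc k. fscale (if i = j + 1 then 1 else 0) (ws ! i))" if "j < k" for j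
      using assms LTB that by (auto simp: good_string_def fscale_if simp del: sum.lessThan_Suc)
    ultimately show ?thesis
      using assms LTB
      by (auto simp: represents_def shift_mat_def diag_mat_rc_def good_string_def simp del: sum.lessThan_Suc intro!: sum.cong)
  qed (use assms in \<open>auto simp: good_string_def\<close>)
  then show "represents E vs ws (snd (kblock_pencil b))" "represents A vs ws (fst (kblock_pencil b))" by auto
qed

lemma good_string_represents':
  assumes "good_string (mapm E) (mapm A) t"
  shows "represents E (fst (snd t)) (snd (snd t)) (snd (kblock_pencil (fst t)))"
    "represents A (fst (snd t)) (snd (snd t)) (fst (kblock_pencil (fst t)))"
  using assms good_string_represents[of E A "fst t" "fst (snd t)" "snd (snd t)"] by simp_all

lemma represents_bdiag:
  "represents M xs ys D \<Longrightarrow> represents M xs' ys' D' \<Longrightarrow> represents M (xs @ xs') (ys @ ys') (bdiag D D')"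
  unfolding bdiag_def by (rule represents_append)

lemma diag_block_mat_Cons': "diag_block_mat (A # As) = bdiag A (diag_block_mat As)"
  by (simp add: bdiag_def Let_def)

lemma represents_concat:
  assumes "\<And>t. t \<in> set ts \<Longrightarrow> represents M (fst (snd t)) (snd (snd t)) (g t)"
  shows "represents M (vcat ts) (wcat ts) (diag_block_mat (map g ts))"
  using assms
proof (induction ts)
  case Nil
  then show ?case by (simp add: vcat_def wcat_def represents_Nil)
next
  case (Cons t ts)
  then have "represents M (vcat ts) (wcat ts) (diag_block_mat (map g ts))" by simp
  from represents_bdiag[OF Cons.prems[of t] this] show ?case
    by (simp add: vcat_def wcat_def diag_block_mat_Cons' del: diag_block_mat.simps)
qed

section \<open>Splitting off the infinite Jordan blocks and the blocks of minimal indices\<close>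

lemma (in Vector_Spaces.vector_space) basis_list:
  assumes "subspace V" "fd scale V"
  obtains xs where "set xs \<subseteq> V" "span (set xs) = V" "length xs = dim V"
proof -
  have "fd scale ({} \<union> V)" using assms by simp
  then obtain xs where "set xs \<subseteq> V" "span ({} \<union> set xs) = span ({} \<union> V)"
    "dim ({} \<union> V) = dim {} + length xs" by (rule extend_by_list)
  moreover have "dim {} = 0" using dim_eq_card_independent[OF independent_empty] by simp
  ultimately show ?thesis using that assms(1) by simp
qed

lemma represents_exists:
  assumes "\<And>x. x \<in> set xs \<Longrightarrow> mapm M x \<in> fs.span (set ys)"
  obtains D where "represents M xs ys D"
proof -
  have "\<exists>c. mapm M (xs ! j) = (\<Sum>i<length ys. fscale (c i) (ys ! i))" if "j < length xs" for j
    using assms[of "xs ! j"] that by (metis fs.span_list_ext nth_mem)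
  then obtain c where c: "\<And>j. j < length xs \<Longrightarrow> mapm M (xs ! j) = (\<Sum>i<length ys. fscale (c j i) (ys ! i))"
    by metis
  have "represents M xs ys (mat (length ys) (length xs) (\<lambda>(i, j). c j i))"
    using c by (auto simp: represents_def intro!: sum.cong)
  then show ?thesis by (rule that)
qed

lemma kequiv_if_represents:
  assumes M: "A \<in> carrier_mat p q" "E \<in> carrier_mat p q"
    and "represents A xs ys D" "represents E xs ys F"
    and xs: "FV q \<subseteq> fs.span (set xs)" "length xs = q" and ys: "FV p \<subseteq> fs.span (set ys)" "length ys = p"
  shows "kequiv (A, E) (D, F)"
proof -
  obtain X where X: "X \<in> carrier_mat q q" "colmat q xs * X = 1\<^sub>m q" "X * colmat q xs = 1\<^sub>m q"
    using xs by (rule colmat_invertible)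
  obtain Y where Y: "Y \<in> carrier_mat p p" "colmat p ys * Y = 1\<^sub>m p" "Y * colmat p ys = 1\<^sub>m p"
    using ys by (rule colmat_invertible)
  have DF: "D \<in> carrier_mat p q" "F \<in> carrier_mat p q" using assms by (auto simp: represents_def)
  have c: "colmat q xs \<in> carrier_mat q q" "colmat p ys \<in> carrier_mat p p"
    using colmat_carrier[of q xs] colmat_carrier[of p ys] xs ys by auto
  show ?thesis
    by (rule kequivI[of _ p q "colmat p ys" Y "colmat q xs" X])
      (use M X Y c DF represents_mult[OF assms(3) M(1)] represents_mult[OF assms(4) M(2)] in auto)
qed

text \<open>\<open>N\<close> for infinite and \<open>LT\<close> for transposed L blocks, the only
  kinds a good string can carry.\<close>

definition NLT :: "'a kblock \<Rightarrow> bool" where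
  "NLT b \<longleftrightarrow> valid_kblock b \<and> (case b of NB k \<Rightarrow> True | LTB k \<Rightarrow> True | _ \<Rightarrow> False)"

lemma good_string_NLT: "good_string E A t \<Longrightarrow> NLT (fst t)"
  by (cases t) (auto simp: good_string_def NLT_def valid_kblock_def split: kblock.splits)

lemma kcf_append: "kcf_pencil (bs @ bs') =
    (bdiag (fst (kcf_pencil bs)) (fst (kcf_pencil bs')), bdiag (snd (kcf_pencil bs)) (snd (kcf_pencil bs')))"
  by (simp add: kcf_pencil_def diag_block_mat_append')

text \<open>On the remaining pair, \<open>E\<close> maps \<open>V'\<close> onto \<open>W'\<close>;
  in a basis of \<open>V'\<close> that ends with a basis of the kernel it becomes an identity block
  followed by zero columns, which is \<open>diag_mat_rc\<close>. If \<open>E\<close> is injective on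
  the whole space, the kernel is absent and the remainder is square.\<close>

lemma pencil_split:
  fixes A E :: "'a::field mat"
  assumes M: "A \<in> carrier_mat p q" "E \<in> carrier_mat p q"
  obtains bs m n C where "C \<in> carrier_mat m n" "m \<le> n" "\<forall>b\<in>set bs. NLT b"
    "kequiv (A, E) (bdiag (fst (kcf_pencil bs)) C, bdiag (snd (kcf_pencil bs)) (diag_mat_rc m n))"
    "(\<forall>x\<in>FV q. mapm E x = 0 \<longrightarrow> x = 0) \<Longrightarrow> (\<forall>b\<in>set bs. \<not> is_NB b) \<and> m = n"
proof -
  interpret lp: linear_pencil fscale fscale "mapm E" "mapm A"
    using linear_mapm[of E] linear_mapm[of A] by (simp add: linear_pencil_def)
  have EA: "mapm E ` FV q \<subseteq> FV p" "mapm A ` FV q \<subseteq> FV p" using M mapm_FV by blast+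
  obtain ts :: "('a, nat \<Rightarrow> 'a, nat \<Rightarrow> 'a) kstring list" and V' W' where H:
     "fs.subspace V' \<and> V' \<subseteq> FV q
      \<and> fs.subspace W' \<and> W' \<subseteq> FV p \<and> mapm E ` V' = W' \<and> mapm A ` V' \<subseteq> W'
      \<and> (\<forall>t\<in>set ts. good_string (mapm E) (mapm A) t)
      \<and> fs.span (V' \<union> set (vcat ts)) = FV q \<and> fs.dim (FV q :: (nat \<Rightarrow> 'a) set) = fs.dim V' + length (vcat ts)
      \<and> fs.span (W' \<union> set (wcat ts)) = FV p \<and> fs.dim (FV p :: (nat \<Rightarrow> 'a) set) = fs.dim W' + length (wcat ts)
      \<and> ((\<forall>v\<in>FV q. mapm E v = 0 \<longrightarrow> v = 0) \<longrightarrow> (\<forall>t\<in>set ts. \<not> is_NB (fst t)))"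
    using lp.string_decomposition[OF subspace_FV fd_FV subspace_FV fd_FV EA] by (elim exE) (rule that)
  have sV: "fs.subspace V'" and VF: "V' \<subseteq> FV q" and sW: "fs.subspace W'" and WF: "W' \<subseteq> FV p"
    and EV: "mapm E ` V' = W'" and AV: "mapm A ` V' \<subseteq> W'"
    and good: "\<forall>t\<in>set ts. good_string (mapm E) (mapm A) t"
    and spV: "fs.span (V' \<union> set (vcat ts)) = FV q" and dV: "fs.dim (FV q :: (nat \<Rightarrow> 'a) set) = fs.dim V' + length (vcat ts)"
    and spW: "fs.span (W' \<union> set (wcat ts)) = FV p" and dW: "fs.dim (FV p :: (nat \<Rightarrow> 'a) set) = fs.dim W' + length (wcat ts)"
    and inj: "(\<forall>v\<in>FV q. mapm E v = 0 \<longrightarrow> v = 0) \<longrightarrow> (\<forall>t\<in>set ts. \<not> is_NB (fst t))"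
    using H by - (elim conjE, assumption)+
  have fdV: "fd fscale V'" by (rule fs.fd_mono[OF fd_FV VF])
  have fdW: "fd fscale W'" by (rule fs.fd_mono[OF fd_FV WF])
  obtain ys where ys: "set ys \<subseteq> W'" "fs.span (set ys) = W'" "length ys = fs.dim W'"
    using sW fdW by (rule fs.basis_list)
  define K where "K = {v \<in> V'. mapm E v = 0}"
  have K: "fs.subspace K" "K \<subseteq> V'"
    using sV by (auto simp: K_def fs.subspace_def lp.E.add lp.E.scale lp.E.zero)
  have fdK: "fd fscale K" by (rule fs.fd_mono[OF fdV K(2)])
  obtain ks where ks: "set ks \<subseteq> K" "fs.span (set ks) = K" "length ks = fs.dim K"
    using K(1) fdK by (rule fs.basis_list)
  have "\<exists>x\<in>V'. mapm E x = y" if "y \<in> set ys" for y using ys(1) EV that by blast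
  then obtain g where g: "\<And>y. y \<in> set ys \<Longrightarrow> g y \<in> V' \<and> mapm E (g y) = y" by metis
  define xs where "xs = map g ys @ ks"
  have xsV: "set xs \<subseteq> V'" using g ks K by (auto simp: xs_def)
  have spxs: "V' \<subseteq> fs.span (set xs)"
  proof
    fix v assume v: "v \<in> V'"
    then have "mapm E v \<in> fs.span (set ys)" using EV ys by blast
    moreover have "set ys = mapm E ` set (map g ys)" using g by force
    ultimately have "mapm E v \<in> mapm E ` fs.span (set (map g ys))" using lp.E.span_image by metis
    then obtain x where x: "x \<in> fs.span (set (map g ys))" "mapm E v = mapm E x" by blast
    have "set (map g ys) \<subseteq> V'" using g by auto
    then have "x \<in> V'" using x fs.span_minimal[OF _ sV] by blast
    then have "v - x \<in> K" using v x sV by (simp add: K_def lp.E.diff fs.subspace_diff)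
    then have "v - x \<in> fs.span (set xs)" using ks fs.span_mono[of "set ks" "set xs"] by (auto simp: xs_def)
    moreover have "x \<in> fs.span (set xs)"
      using x fs.span_mono[of "set (map g ys)" "set xs"] by (auto simp: xs_def)
    ultimately have "(v - x) + x \<in> fs.span (set xs)" by (rule fs.span_add)
    then show "v \<in> fs.span (set xs)" by simp
  qed
  define m n where "m = length ys" and "n = length xs"
  have dVn: "fs.dim V' = n"
    using lp.E.rank_nullity[OF sV fdV] EV ys ks by (simp add: n_def xs_def K_def)
  have "mapm E (xs ! j) = (\<Sum>i<m. fscale (diag_mat_rc m n $$ (i, j)) (ys ! i))" if "j < n" for j
  proof (cases "j < m")
    case True
    have "mapm E (xs ! j) = ys ! j" using True g by (simp add: xs_def m_def nth_append)
    also have "\<dots> = (\<Sum>i<m. fscale (if i = j then 1 else 0) (ys ! i))" using True by (simp add: fscale_if)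
    also have "\<dots> = (\<Sum>i<m. fscale (diag_mat_rc m n $$ (i, j)) (ys ! i))"
      using that by (intro sum.cong) (auto simp: diag_mat_rc_def)
    finally show ?thesis .
  next
    case False
    then have "xs ! j \<in> set ks" using that by (simp add: xs_def n_def m_def nth_append)
    then have "mapm E (xs ! j) = 0" using ks by (auto simp: K_def)
    moreover have "(\<Sum>i<m. fscale (diag_mat_rc m n $$ (i, j)) (ys ! i)) = 0"
      using that False by (intro sum.neutral) (auto simp: diag_mat_rc_def)
    ultimately show ?thesis by simp
  qed
  then have rE: "represents E xs ys (diag_mat_rc m n)"
    by (simp add: represents_def m_def n_def diag_mat_rc_def)
  have "mapm A x \<in> fs.span (set ys)" if "x \<in> set xs" for x using AV xsV ys that by blast
  then obtain C where rA: "represents A xs ys C" by (rule represents_exists)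
  define bs where "bs = map fst ts"
  have "represents E (vcat ts) (wcat ts) (diag_block_mat (map (\<lambda>t. snd (kblock_pencil (fst t))) ts))"
    by (rule represents_concat) (use good good_string_represents' in blast)
  then have "represents E (vcat ts) (wcat ts) (snd (kcf_pencil bs))" by (simp add: kcf_pencil_def bs_def o_def)
  then have RE: "represents E (vcat ts @ xs) (wcat ts @ ys) (bdiag (snd (kcf_pencil bs)) (diag_mat_rc m n))"
    using rE by (rule represents_bdiag)
  have "represents A (vcat ts) (wcat ts) (diag_block_mat (map (\<lambda>t. fst (kblock_pencil (fst t))) ts))"
    by (rule represents_concat) (use good good_string_represents' in blast)
  then have "represents A (vcat ts) (wcat ts) (fst (kcf_pencil bs))" by (simp add: kcf_pencil_def bs_def o_def)
  then have RA: "represents A (vcat ts @ xs) (wcat ts @ ys) (bdiag (fst (kcf_pencil bs)) C)"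
    using rA by (rule represents_bdiag)
  have sp: "fs.span (U \<union> set zs) \<subseteq> fs.span (set (zs @ us))" if "U \<subseteq> fs.span (set us)" for U zs and us :: "(nat \<Rightarrow> 'a) list"
    using that fs.span_mono[of "set us" "set (zs @ us)"] fs.span_superset[of "set (zs @ us)"]
    by (intro fs.span_minimal) auto
  have "kequiv (A, E) (bdiag (fst (kcf_pencil bs)) C, bdiag (snd (kcf_pencil bs)) (diag_mat_rc m n))"
  proof (rule kequiv_if_represents[OF M RA RE])
    show "FV q \<subseteq> fs.span (set (vcat ts @ xs))" using sp[OF spxs, of "vcat ts"] spV by simp
    show "FV p \<subseteq> fs.span (set (wcat ts @ ys))" using sp[of W' ys "wcat ts"] ys spW by simp
    show "length (vcat ts @ xs) = q" using dV dVn by (simp add: dim_FV n_def)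
    show "length (wcat ts @ ys) = p" using dW ys by (simp add: dim_FV)
  qed
  moreover have "C \<in> carrier_mat m n" using rA by (simp add: represents_def m_def n_def)
  moreover have "m \<le> n" by (simp add: m_def n_def xs_def)
  moreover have "\<forall>b\<in>set bs. NLT b"
    unfolding bs_def set_map using good good_string_NLT by blast
  moreover have "(\<forall>b\<in>set bs. \<not> is_NB b) \<and> m = n" if "\<forall>x\<in>FV q. mapm E x = 0 \<longrightarrow> x = 0"
  proof -
    have "K = {0}" using that VF K fs.subspace_0 by (auto simp: K_def)
    then have "n = m" using ks(3) fs.dim_zero_singleton by (simp add: n_def m_def xs_def)
    then show ?thesis using inj that by (auto simp: bs_def)
  qed
  ultimately show ?thesis using that by blast
qed

fun kflip :: "'a kblock \<Rightarrow> 'a kblock" where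
  "kflip (LTB k) = LB k" | "kflip b = b"

lemma transpose_LTB_blocks:
  assumes "\<forall>b\<in>set bs. NLT b \<and> \<not> is_NB b"
  shows "transpose_mat (fst (kcf_pencil bs)) = fst (kcf_pencil (map kflip bs))"
    "transpose_mat (snd (kcf_pencil bs)) = snd (kcf_pencil (map kflip bs))"
proof -
  have "transpose_mat (diag_block_mat (map (\<lambda>b. g (kblock_pencil b)) bs))
      = diag_block_mat (map (\<lambda>b. g (kblock_pencil (kflip b))) bs)"
    if g: "g = fst \<or> g = snd" for g :: "'a pencil \<Rightarrow> 'a mat"
    using assms
  proof (induction bs)
    case (Cons b bs)
    then obtain k where "b = LTB k" by (cases b) (auto simp: NLT_def)
    then have "transpose_mat (g (kblock_pencil b)) = g (kblock_pencil (kflip b))" using g by auto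
    then show ?case using Cons by (simp add: diag_block_mat_Cons' bdiag_transpose del: diag_block_mat.simps)
  qed simp
  from this[of fst] this[of snd] show "transpose_mat (fst (kcf_pencil bs)) = fst (kcf_pencil (map kflip bs))"
    "transpose_mat (snd (kcf_pencil bs)) = snd (kcf_pencil (map kflip bs))"
    by (simp_all add: kcf_pencil_def o_def)
qed

text \<open>Transposing an identity block with zero columns gives an injective map, so splitting the
  transpose produces no infinite blocks.\<close>

lemma mapm_diag_transpose_inj:
  assumes "m \<le> n" "x \<in> FV m" "mapm (transpose_mat (diag_mat_rc m n)) x = 0"
  shows "x = (0 :: nat \<Rightarrow> 'a::field)"
proof
  fix i
  show "x i = 0 i"
  proof (cases "i < m")
    case True
    have "(\<Sum>k<m. transpose_mat (diag_mat_rc m n) $$ (i, k) * x k) = (\<Sum>k<m. if k = i then x k else 0)"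
      using True assms(1) by (intro sum.cong) (auto simp: diag_mat_rc_def)
    then have "mapm (transpose_mat (diag_mat_rc m n)) x i = x i"
      using True assms(1) by (simp add: mapm_def diag_mat_rc_def)
    then show ?thesis using assms(3) by simp
  qed (use assms(2) in \<open>auto simp: FV_def\<close>)
qed

lemma diag_mat_rc_one: "diag_mat_rc n n = 1\<^sub>m n"
  by (auto simp: diag_mat_rc_def)

lemma kequiv_carrier:
  assumes "kequiv A B" "fst A \<in> carrier_mat p q"
  shows "fst B \<in> carrier_mat p q \<and> snd B \<in> carrier_mat p q"
proof -
  from assms(1) obtain p1 q1 P P' Q Q' where 1: "P \<in> carrier_mat p1 p1" "P' \<in> carrier_mat p1 p1"
     "Q \<in> carrier_mat q1 q1" "Q' \<in> carrier_mat q1 q1" "P * P' = 1\<^sub>m p1" "P' * P = 1\<^sub>m p1"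
     "Q * Q' = 1\<^sub>m q1" "Q' * Q = 1\<^sub>m q1" "fst A \<in> carrier_mat p1 q1" "snd A \<in> carrier_mat p1 q1"
     "P * fst A * Q = fst B" "P * snd A * Q = snd B" unfolding kequiv_def by blast
  have "p1 = p" "q1 = q" using 1(9) assms(2) by auto
  moreover have "P * fst A * Q \<in> carrier_mat p1 q1" "P * snd A * Q \<in> carrier_mat p1 q1"
    by (intro mult_carrier_mat[of _ p1 p1] mult_carrier_mat[of _ p1 q1] 1)+
  ultimately show ?thesis using 1(11,12) by simp
qed

text \<open>The \<open>LB\<close> blocks split off as the \<open>LTB\<close> blocks of the transpose.\<close>
lemma surjective_pencil_split:
  fixes C :: "'a::field mat"
  assumes C: "C \<in> carrier_mat m n" "m \<le> n"
  obtains bs l D where "D \<in> carrier_mat l l" "\<forall>b\<in>set bs. valid_kblock b"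
    "kequiv (C, diag_mat_rc m n) (bdiag (fst (kcf_pencil bs)) D, bdiag (snd (kcf_pencil bs)) (1\<^sub>m l))"
proof -
  have c: "transpose_mat C \<in> carrier_mat n m" "transpose_mat (diag_mat_rc m n :: 'a mat) \<in> carrier_mat n m"
    using C by (auto simp: diag_mat_rc_def)
  obtain bs k l D where D: "D \<in> carrier_mat k l" "k \<le> l" and N: "\<forall>b\<in>set bs. NLT b"
    and e: "kequiv (transpose_mat C, transpose_mat (diag_mat_rc m n))
        (bdiag (fst (kcf_pencil bs)) D, bdiag (snd (kcf_pencil bs)) (diag_mat_rc k l))"
    and i: "(\<forall>x\<in>FV m. mapm (transpose_mat (diag_mat_rc m n)) x = (0 :: nat \<Rightarrow> 'a) \<longrightarrow> x = 0)
        \<Longrightarrow> (\<forall>b\<in>set bs. \<not> is_NB b) \<and> k = l"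
    using pencil_split[OF c] by metis
  have nb: "\<forall>b\<in>set bs. \<not> is_NB b" and kl: "k = l"
    using i mapm_diag_transpose_inj[OF C(2)] by blast+
  have "kequiv (C, diag_mat_rc m n)
     (bdiag (fst (kcf_pencil (map kflip bs))) (transpose_mat D), bdiag (snd (kcf_pencil (map kflip bs))) (1\<^sub>m l))"
    using kequiv_transpose[OF e] transpose_LTB_blocks[of bs] N nb kl
    by (simp add: bdiag_transpose diag_mat_rc_one)
  moreover have "valid_kblock (kflip b)" if "NLT b" "\<not> is_NB b" for b :: "'a kblock"
    using that by (cases b) (auto simp: NLT_def valid_kblock_def)
  then have "\<forall>b\<in>set (map kflip bs). valid_kblock b" using N nb by auto
  moreover have "transpose_mat D \<in> carrier_mat l l" using D kl by simp
  ultimately show ?thesis using that by blast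
qed

section \<open>Jordan form over an algebraically closed field\<close>

lemma eigenvalue_exists:
  fixes D :: "'a::alg_closed_field mat"
  assumes D: "D \<in> carrier_mat n n" "n > 0"
  obtains mu x where "x \<in> FV n" "x \<noteq> 0" "mapm D x = fscale mu x"
proof -
  have "degree (char_poly D) > 0" using degree_monic_char_poly[OF D(1)] D(2) by simp
  then obtain mu where "poly (char_poly D) mu = 0" using alg_closed_imp_poly_has_root by blast
  then have "eigenvalue D mu" using eigenvalue_root_char_poly[OF D(1)] by simp
  then obtain v where v: "v \<in> carrier_vec n" "v \<noteq> 0\<^sub>v n" "D *\<^sub>v v = mu \<cdot>\<^sub>v v"
    using D by (auto simp: eigenvalue_def eigenvector_def)
  define x where "x = (\<lambda>i. if i < n then v $ i else 0)"
  have "x \<in> FV n" by (simp add: x_def FV_def)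
  moreover have "x \<noteq> 0"
  proof
    assume "x = 0"
    then have "v $ i = 0" if "i < n" for i using that by (metis x_def zero_fun_apply)
    then have "v = 0\<^sub>v n" using v(1) by (intro eq_vecI) auto
    then show False using v(2) by simp
  qed
  moreover have "mapm D x = fscale mu x"
  proof
    fix r show "mapm D x r = fscale mu x r"
    proof (cases "r < n")
      case True
      have "(D *\<^sub>v v) $ r = (\<Sum>i<n. D $$ (r, i) * v $ i)"
        using D v(1) True by (auto simp: scalar_prod_def atLeast0LessThan intro!: sum.cong)
      also have "\<dots> = mapm D x r" using D True by (auto simp: mapm_def x_def intro!: sum.cong)
      finally show ?thesis using v True by (simp add: x_def)
    qed (use D in \<open>auto simp: mapm_def x_def\<close>)
  qed
  ultimately show ?thesis using that by blast
qed

text \<open>An infinite block contributes as many vectors to the domain as to the codomain and a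
  transposed L block one fewer, so equal totals leave only infinite blocks.\<close>

lemma vcat_le_wcat:
  assumes "\<forall>t\<in>set ts. good_string E A t"
  shows "length (vcat ts) \<le> length (wcat ts)"
    and "length (vcat ts) = length (wcat ts) \<Longrightarrow> t \<in> set ts \<Longrightarrow> is_NB (fst t)"
proof -
  have "length (vcat ts) \<le> length (wcat ts) \<and>
     (length (vcat ts) = length (wcat ts) \<longrightarrow> (\<forall>t\<in>set ts. is_NB (fst t)))"
    using assms
  proof (induction ts)
    case Nil
    then show ?case by (simp add: vcat_def)
  next
    case (Cons t ts)
    have "length (fst (snd t)) \<le> length (snd (snd t)) \<and>
       (length (fst (snd t)) = length (snd (snd t)) \<longrightarrow> is_NB (fst t))"
      using Cons.prems by (cases t) (auto simp: good_string_def split: kblock.splits)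
    moreover have "vcat (t # ts) = fst (snd t) @ vcat ts" "wcat (t # ts) = snd (snd t) @ wcat ts"
      by (simp_all add: vcat_def wcat_def)
    ultimately show ?case using Cons.IH Cons.prems by auto
  qed
  then show "length (vcat ts) \<le> length (wcat ts)"
    and "length (vcat ts) = length (wcat ts) \<Longrightarrow> t \<in> set ts \<Longrightarrow> is_NB (fst t)" by auto
qed

text \<open>An infinite block of the pencil formed from D - mu and the identity is a Jordan block of
  D for mu. In the pencil D + s it becomes singular at s = - mu, which is the parameter of
  \<open>JB\<close>.\<close>

fun knj :: "'a::field \<Rightarrow> 'a kblock \<Rightarrow> 'a kblock" where
  "knj mu (NB k) = JB k (- mu)" | "knj mu b = b"

lemma kcf_Nil: "kcf_pencil [] = (0\<^sub>m 0 0, 0\<^sub>m 0 0)"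
  by (simp add: kcf_pencil_def)

text \<open>After subtracting an eigenvalue the splitting strips off at least one nilpotent block.\<close>
lemma jordan_form:
  fixes D :: "'a::alg_closed_field mat"
  assumes "D \<in> carrier_mat n n"
  shows "\<exists>bs. (\<forall>b\<in>set bs. valid_kblock b) \<and> kequiv (D, 1\<^sub>m n) (kcf_pencil bs)"
  using assms
proof (induction n arbitrary: D rule: less_induct)
  case (less n)
  note D = less.prems
  show ?case
  proof (cases "n = 0")
    case True
    have "D = 0\<^sub>m 0 0" using D True by auto
    then have "kequiv (D, 1\<^sub>m n) (kcf_pencil [])" using True
      by (intro kequivI[of _ 0 0 "1\<^sub>m 0" "1\<^sub>m 0" "1\<^sub>m 0" "1\<^sub>m 0"]) (auto simp: kcf_Nil)
    then show ?thesis by (intro exI[of _ "[]"]) simp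
  next
    case False
    then obtain mu e where e: "e \<in> FV n" "e \<noteq> 0" "mapm D e = fscale mu e"
      using eigenvalue_exists[OF D] by blast
    define E where "E = D - mu \<cdot>\<^sub>m 1\<^sub>m n"
    have E: "E \<in> carrier_mat n n" unfolding E_def by (rule minus_carrier_mat) simp
    have mE: "mapm E x = mapm D x - fscale mu x" if "x \<in> FV n" for x
    proof
      fix r show "mapm E x r = (mapm D x - fscale mu x) r"
      proof (cases "r < n")
        case True
        have "mapm E x r = (\<Sum>i<n. D $$ (r, i) * x i - (if i = r then mu * x i else 0))"
          using D True by (auto simp: mapm_def E_def algebra_simps intro!: sum.cong)
        also have "\<dots> = mapm D x r - mu * x r" using D True by (simp add: sum_subtractf mapm_def)
        finally show ?thesis by simp
      qed (use D that in \<open>auto simp: mapm_def E_def FV_def\<close>)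
    qed
    \<comment> \<open>The decomposition is applied to the pencil with D - mu as coefficient of s and
      the identity as constant coefficient, so that its infinite blocks are nilpotent blocks of D -
      mu.\<close>
    interpret lp: linear_pencil fscale fscale "mapm E" "mapm (1\<^sub>m n)"
      using linear_mapm[of E] linear_mapm[of "1\<^sub>m n"] by (simp add: linear_pencil_def)
    have EA: "mapm E ` FV n \<subseteq> FV n" "mapm (1\<^sub>m n) ` FV n \<subseteq> FV n"
      using mapm_FV[OF E] mapm_FV[OF one_carrier_mat] by blast+
    obtain ts :: "('a, nat \<Rightarrow> 'a, nat \<Rightarrow> 'a) kstring list" and V' W' where H:
       "fs.subspace V' \<and> V' \<subseteq> FV n
        \<and> fs.subspace W' \<and> W' \<subseteq> FV n \<and> mapm E ` V' = W' \<and> mapm (1\<^sub>m n) ` V' \<subseteq> W'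
        \<and> (\<forall>t\<in>set ts. good_string (mapm E) (mapm (1\<^sub>m n)) t)
        \<and> fs.span (V' \<union> set (vcat ts)) = FV n \<and> fs.dim (FV n :: (nat \<Rightarrow> 'a) set) = fs.dim V' + length (vcat ts)
        \<and> fs.span (W' \<union> set (wcat ts)) = FV n \<and> fs.dim (FV n :: (nat \<Rightarrow> 'a) set) = fs.dim W' + length (wcat ts)
        \<and> ((\<forall>v\<in>FV n. mapm E v = 0 \<longrightarrow> v = 0) \<longrightarrow> (\<forall>t\<in>set ts. \<not> is_NB (fst t)))"
      using lp.string_decomposition[OF subspace_FV fd_FV subspace_FV fd_FV EA] by (elim exE) (rule that)
    have sV: "fs.subspace V'" and VF: "V' \<subseteq> FV n" and sW: "fs.subspace W'" and WF: "W' \<subseteq> FV n"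
      and EV: "mapm E ` V' = W'" and AV: "mapm (1\<^sub>m n) ` V' \<subseteq> W'"
      and good: "\<forall>t\<in>set ts. good_string (mapm E) (mapm (1\<^sub>m n)) t"
      and spV: "fs.span (V' \<union> set (vcat ts)) = FV n" and dV: "fs.dim (FV n :: (nat \<Rightarrow> 'a) set) = fs.dim V' + length (vcat ts)"
      and spW: "fs.span (W' \<union> set (wcat ts)) = FV n" and dW: "fs.dim (FV n :: (nat \<Rightarrow> 'a) set) = fs.dim W' + length (wcat ts)"
      using H by - (elim conjE, assumption)+
    have fdV: "fd fscale V'" by (rule fs.fd_mono[OF fd_FV VF])
    have fdW: "fd fscale W'" by (rule fs.fd_mono[OF fd_FV WF])
    have VW: "V' \<subseteq> W'"
    proof
      fix v assume "v \<in> V'"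
      then show "v \<in> W'" using AV mapm_one[of v n] VF by (metis image_subset_iff subsetD)
    qed
    \<comment> \<open>\<open>W'\<close> is an image of \<open>V'\<close> and, the constant
      coefficient being the identity, contains it; equality follows, and with it the absence of
      transposed L blocks.\<close>
    have "fs.dim W' \<le> fs.dim V'" using lp.E.rank_nullity[OF sV fdV] EV by simp
    then have eq: "V' = W'" by (rule fs.subspace_eq_if_dim_le[OF sV sW VW fdW])
    then have "length (vcat ts) = length (wcat ts)" using dV dW by simp
    then have NBs: "is_NB (fst t)" if "t \<in> set ts" for t using vcat_le_wcat(2)[OF good] that by blast
    have vcF: "set (vcat ts) \<subseteq> FV n" using spV fs.span_superset by blast
    define bs where "bs = map (\<lambda>t. knj mu (fst t)) ts"
    have str: "snd (snd t) = fst (snd t) \<and> represents D (fst (snd t)) (snd (snd t)) (fst (kblock_pencil (knj mu (fst t))))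
       \<and> snd (kblock_pencil (knj mu (fst t))) = 1\<^sub>m (length (fst (snd t))) \<and> valid_kblock (knj mu (fst t))
       \<and> fst (snd t) \<noteq> []"
      if t: "t \<in> set ts" for t
    proof -
      obtain b vs ws where bvw: "t = (b, vs, ws)" by (cases t)
      obtain k where b: "b = NB k" using NBs[OF t] bvw by (cases b) auto
      have g: "k \<ge> 1" "length vs = k" "length ws = k" "\<And>j. j < k \<Longrightarrow> mapm (1\<^sub>m n) (vs ! j) = ws ! j"
        "mapm E (vs ! 0) = 0" "\<And>j. Suc j < k \<Longrightarrow> mapm E (vs ! Suc j) = ws ! j"
        using good t bvw b by (auto simp: good_string_def)
      have vsF: "vs ! j \<in> FV n" if "j < k" for j
        using vcF t bvw g(2) that by (force simp: vcat_def)
      have wv: "ws = vs" using g(2,3,4) mapm_one[OF vsF] by (intro nth_equalityI) auto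
      have Dv: "mapm D (vs ! j) = mapm E (vs ! j) + fscale mu (vs ! j)" if "j < k" for j
        using mE[OF vsF[OF that]] by simp
      have "mapm D (vs ! j) = (\<Sum>i<k. fscale (fst (kblock_pencil (JB k (- mu))) $$ (i, j)) (vs ! i))" if j: "j < k" for j
      proof -
        have "mapm E (vs ! j) = (\<Sum>i<k. fscale (if j = i + 1 then 1 else 0) (vs ! i))"
          using g wv j by (cases j) (auto simp: fscale_if)
        moreover have "fscale mu (vs ! j) = (\<Sum>i<k. fscale mu (fscale (if i = j then 1 else 0) (vs ! i)))"
          using j by (simp add: fscale_if fs.scale_sum_right[symmetric])
        ultimately have "mapm D (vs ! j) = (\<Sum>i<k. fscale (if j = i + 1 then 1 else 0) (vs ! i)
            + fscale mu (fscale (if i = j then 1 else 0) (vs ! i)))"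
          using Dv[OF j] by (simp add: sum.distrib)
        also have "\<dots> = (\<Sum>i<k. fscale (fst (kblock_pencil (JB k (- mu))) $$ (i, j)) (vs ! i))"
          using j by (intro sum.cong) (auto simp: shift_mat_def fscale_def fun_eq_iff)
        finally show ?thesis .
      qed
      moreover have "fst (kblock_pencil (JB k (- mu))) \<in> carrier_mat k k"
        by (simp add: shift_mat_def minus_carrier_mat del: minus_mat_def)
      ultimately have "represents D vs vs (fst (kblock_pencil (JB k (- mu))))"
        using g(2) unfolding represents_def by blast
      then show ?thesis using bvw b wv g by (auto simp: valid_kblock_def)
    qed
    have bsv: "\<forall>b\<in>set bs. valid_kblock b"
      unfolding bs_def set_map using str by blast
    have wv: "wcat ts = vcat ts"
      unfolding vcat_def wcat_def using str by (intro arg_cong[where f = concat] map_cong) auto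
    obtain ys where ys: "set ys \<subseteq> V'" "fs.span (set ys) = V'" "length ys = fs.dim V'"
      using sV fdV by (rule fs.basis_list)
    define m where "m = length ys"
    have "mapm D y \<in> fs.span (set ys)" if "y \<in> set ys" for y
    proof -
      have "mapm D y = mapm E y + fscale mu y" using mE[of y] ys VF that by auto
      moreover have "mapm E y \<in> V'" "y \<in> V'" using EV eq ys that by auto
      ultimately show ?thesis using ys sV by (simp add: fs.subspace_add fs.subspace_scale)
    qed
    then obtain C where rC: "represents D ys ys C" by (rule represents_exists)
    have "represents D (vcat ts) (wcat ts) (diag_block_mat (map (\<lambda>t. fst (kblock_pencil (knj mu (fst t)))) ts))"
      by (rule represents_concat) (use str in blast)
    then have rD: "represents D (vcat ts) (vcat ts) (fst (kcf_pencil bs))"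
      by (simp add: wv kcf_pencil_def bs_def o_def)
    note RD = represents_bdiag[OF rD rC]
    have one: "represents (1\<^sub>m n) zs zs (1\<^sub>m (length zs))" if "set zs \<subseteq> FV n" for zs :: "(nat \<Rightarrow> 'a) list"
    proof -
      have "mapm (1\<^sub>m n) (zs ! j) = (\<Sum>i<length zs. fscale (1\<^sub>m (length zs) $$ (i, j)) (zs ! i))" if "j < length zs" for j
      proof -
        have "(\<Sum>i<length zs. fscale (1\<^sub>m (length zs) $$ (i, j)) (zs ! i))
            = (\<Sum>i<length zs. fscale (if i = j then 1 else 0) (zs ! i))" using that by (intro sum.cong) auto
        also have "\<dots> = zs ! j" using that by (simp add: fscale_if)
        moreover have "zs ! j \<in> FV n" using \<open>set zs \<subseteq> FV n\<close> that by (meson nth_mem subsetD)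
        ultimately show ?thesis using mapm_one by simp
      qed
      then show ?thesis by (simp add: represents_def)
    qed
    have "represents (1\<^sub>m n) (vcat ts) (wcat ts) (diag_block_mat (map (\<lambda>t. snd (kblock_pencil (knj mu (fst t)))) ts))"
    proof (rule represents_concat)
      fix t assume t: "t \<in> set ts"
      have "set (fst (snd t)) \<subseteq> FV n" using vcF t by (force simp: vcat_def)
      then show "represents (1\<^sub>m n) (fst (snd t)) (snd (snd t)) (snd (kblock_pencil (knj mu (fst t))))"
        using one[of "fst (snd t)"] str[OF t] by simp
    qed
    then have r1: "represents (1\<^sub>m n) (vcat ts) (vcat ts) (snd (kcf_pencil bs))"
      by (simp add: wv kcf_pencil_def bs_def o_def)
    have "represents (1\<^sub>m n) ys ys (1\<^sub>m m)" using one[of ys] ys VF by (simp add: m_def)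
    note R1 = represents_bdiag[OF r1 this]
    have sp: "FV n \<subseteq> fs.span (set (vcat ts @ ys))"
      unfolding spV[symmetric] using fs.span_mono[of "set ys" "set (vcat ts @ ys)"] fs.span_superset[of "set (vcat ts @ ys)"] ys(2)
      by (intro fs.span_minimal) auto
    have len: "length (vcat ts @ ys) = n" using dV ys by (simp add: dim_FV)
    have k1: "kequiv (D, 1\<^sub>m n) (bdiag (fst (kcf_pencil bs)) C, bdiag (snd (kcf_pencil bs)) (1\<^sub>m m))"
      by (rule kequiv_if_represents[OF D _ RD R1 sp len sp len]) simp
    \<comment> \<open>Without strings \<open>E\<close> would map the whole space onto itself and be
      injective, against the eigenvector \<open>e\<close>.\<close>
    have "ts \<noteq> []"
    proof
      assume "ts = []"
      then have "fs.span V' = FV n" using spV by (simp add: vcat_def)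
      moreover have "fs.span V' = V'" using sV fs.span_eq_iff by blast
      ultimately have "V' = FV n" by simp
      then have "fs.dim {x \<in> FV n. mapm E x = 0} = 0"
        using lp.E.rank_nullity[OF subspace_FV fd_FV, of n] EV eq by simp
      moreover have "fs.subspace {x \<in> FV n. mapm E x = 0}"
        using subspace_FV[of n] by (auto simp: fs.subspace_def lp.E.add lp.E.scale lp.E.zero)
      moreover have "fd fscale {x \<in> FV n. mapm E x = (0 :: nat \<Rightarrow> 'a)}" by (rule fs.fd_mono[OF fd_FV[of n]]) auto
      ultimately have "{x \<in> FV n. mapm E x = 0} = {0}" using fs.dim_eq_0_fd by blast
      moreover have "mapm E e = 0" using mE e by simp
      ultimately show False using e by blast
    qed
    then obtain t ts' where "ts = t # ts'" by (cases ts) auto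
    then have "vcat ts \<noteq> []" using str[of t] by (simp add: vcat_def)
    then have mn: "m < n" using len by (cases "vcat ts") (auto simp: m_def)
    have C: "C \<in> carrier_mat m m" using rC by (simp add: represents_def m_def)
    from less.IH[OF mn C] obtain bs' where bs': "\<forall>b\<in>set bs'. valid_kblock b" "kequiv (C, 1\<^sub>m m) (kcf_pencil bs')"
      by blast
    have "fst (kcf_pencil bs) \<in> carrier_mat (length (vcat ts)) (length (vcat ts))"
      "snd (kcf_pencil bs) \<in> carrier_mat (length (vcat ts)) (length (vcat ts))"
      using rD r1 unfolding represents_def by blast+
    from kequiv_bdiag[OF bs'(2) this]
    have "kequiv (bdiag (fst (kcf_pencil bs)) C, bdiag (snd (kcf_pencil bs)) (1\<^sub>m m)) (kcf_pencil (bs @ bs'))"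
      by (simp add: kcf_append)
    from kequiv_trans[OF k1 this] show ?thesis
      using bs'(1) bsv by (intro exI[of _ "bs @ bs'"]) auto
  qed
qed

text \<open>The splitting takes out the infinite and the transposed L blocks, the splitting of the
  transposed remainder takes out the L blocks, and what is left has the identity as coefficient of s
  and falls under the Jordan form.\<close>

theorem kcf_exists:
  fixes A :: "'a::alg_closed_field pencil"
  assumes A: "fst A \<in> carrier_mat p q" "snd A \<in> carrier_mat p q"
  obtains bs where "is_kcf A bs"
proof -
  obtain bs1 m n C where C: "C \<in> carrier_mat m n" "m \<le> n" and N: "\<forall>b\<in>set bs1. NLT b"
    and e1: "kequiv (fst A, snd A) (bdiag (fst (kcf_pencil bs1)) C, bdiag (snd (kcf_pencil bs1)) (diag_mat_rc m n))"
    using pencil_split[OF A] by metis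
  obtain bs2 l D where D: "D \<in> carrier_mat l l" and v2: "\<forall>b\<in>set bs2. valid_kblock b"
    and e2: "kequiv (C, diag_mat_rc m n) (bdiag (fst (kcf_pencil bs2)) D, bdiag (snd (kcf_pencil bs2)) (1\<^sub>m l))"
    using surjective_pencil_split[OF C] by metis
  obtain bs3 where v3: "\<forall>b\<in>set bs3. valid_kblock b" and e3: "kequiv (D, 1\<^sub>m l) (kcf_pencil bs3)"
    using jordan_form[OF D] by blast
  have dims: "dim_row (snd (kcf_pencil bs)) = dim_row (fst (kcf_pencil bs))"
    "dim_col (snd (kcf_pencil bs)) = dim_col (fst (kcf_pencil bs))" for bs :: "'a kblock list"
  proof -
    have "dim_row (snd (kblock_pencil b)) = dim_row (fst (kblock_pencil b)) \<and>
      dim_col (snd (kblock_pencil b)) = dim_col (fst (kblock_pencil b))" for b :: "'a kblock"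
      by (cases b) (auto simp: shift_mat_def diag_mat_rc_def)
    then show "dim_row (snd (kcf_pencil bs)) = dim_row (fst (kcf_pencil bs))"
      "dim_col (snd (kcf_pencil bs)) = dim_col (fst (kcf_pencil bs))"
      by (simp_all add: kcf_pencil_def dim_diag_block_mat o_def)
  qed
  have c: "fst (kcf_pencil bs) \<in> carrier_mat (dim_row (fst (kcf_pencil bs))) (dim_col (fst (kcf_pencil bs)))"
     "snd (kcf_pencil bs) \<in> carrier_mat (dim_row (fst (kcf_pencil bs))) (dim_col (fst (kcf_pencil bs)))" for bs :: "'a kblock list"
    by (auto simp: dims)
  from kequiv_bdiag[OF e3 c(1,2)[of bs2]]
  have "kequiv (bdiag (fst (kcf_pencil bs2)) D, bdiag (snd (kcf_pencil bs2)) (1\<^sub>m l)) (kcf_pencil (bs2 @ bs3))"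
    by (simp add: kcf_append)
  from kequiv_bdiag[OF kequiv_trans[OF e2 this] c(1,2)[of bs1]]
  have "kequiv (bdiag (fst (kcf_pencil bs1)) C, bdiag (snd (kcf_pencil bs1)) (diag_mat_rc m n))
     (kcf_pencil (bs1 @ bs2 @ bs3))"
    by (simp add: kcf_append[of bs1])
  from kequiv_trans[OF e1 this] have e: "kequiv A (kcf_pencil (bs1 @ bs2 @ bs3))" by simp
  obtain p' q' P P' Q Q' where 1: "P \<in> carrier_mat p' p'" "P' \<in> carrier_mat p' p'"
     "Q \<in> carrier_mat q' q'" "Q' \<in> carrier_mat q' q'" "P * P' = 1\<^sub>m p'" "P' * P = 1\<^sub>m p'"
     "Q * Q' = 1\<^sub>m q'" "Q' * Q = 1\<^sub>m q'" "fst A \<in> carrier_mat p' q'" "snd A \<in> carrier_mat p' q'"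
     "P * fst A * Q = fst (kcf_pencil (bs1 @ bs2 @ bs3))" "P * snd A * Q = snd (kcf_pencil (bs1 @ bs2 @ bs3))"
    using e unfolding kequiv_def by blast
  have inv: "invertible_mat X" if "X \<in> carrier_mat r r" "Y \<in> carrier_mat r r" "X * Y = 1\<^sub>m r" "Y * X = 1\<^sub>m r"
    for X Y :: "'a mat" and r
    using that by (auto simp: invertible_mat_def inverts_mat_def intro!: exI[of _ Y])
  have "is_kcf A (bs1 @ bs2 @ bs3)"
    unfolding is_kcf_def using N v2 v3 1 inv[of P p' P'] inv[of Q q' Q']
    by (intro conjI exI[of _ P] exI[of _ Q]) (auto simp: NLT_def)
  then show ?thesis by (rule that)
qed

subsection \<open>Null vectors and the column minimal indices\<close>

definition prow :: "'a::field pencil \<Rightarrow> nat \<Rightarrow> nat \<Rightarrow> 'a poly" where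
  "prow A r = (\<lambda>i. if i < dim_col (fst A) then [:fst A $$ (r, i), snd A $$ (r, i):] else 0)"

definition prows :: "'a::field pencil \<Rightarrow> (nat \<Rightarrow> 'a poly) set" where
  "prows A = prow A ` {..<dim_row (fst A)}"

lemma MS_prows:
  assumes "fst A \<in> carrier_mat p q"
  shows "x \<in> MS q (prows A) n \<longleftrightarrow> x \<in> PV q n \<and> (\<forall>r<p. dotp q (prow A r) x = 0)"
  using assms by (auto simp: MS_def prows_def)

section \<open>Invariance of the null-vector dimensions under strict equivalence\<close>

lemma pCons_sum:
  fixes c :: "'i \<Rightarrow> 'a::field"
  shows "(\<Sum>i\<in>S. Polynomial.smult (c i) [:a i, b i:]) = [:\<Sum>i\<in>S. c i * a i, \<Sum>i\<in>S. c i * b i:]"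
  by (induction S rule: infinite_finite_induct) auto

definition mapp :: "'a::field mat \<Rightarrow> (nat \<Rightarrow> 'a poly) \<Rightarrow> nat \<Rightarrow> 'a poly" where
  "mapp Q x = (\<lambda>i. if i < dim_row Q then \<Sum>j<dim_col Q. Polynomial.smult (Q $$ (i, j)) (x j) else 0)"

lemma linear_mapp: "Vector_Spaces.linear pscale pscale (mapp Q)"
  by unfold_locales
    (auto simp: mapp_def fun_eq_iff smult_add_right sum.distrib pl.scale_sum_right mult.commute)

lemma mapp_PV: "Q \<in> carrier_mat q q' \<Longrightarrow> x \<in> PV q' n \<Longrightarrow> mapp Q x \<in> PV q n"
  by (auto simp: mapp_def PV_def PP_def coeff_sum)

lemma mapp_mult:
  assumes "Q \<in> carrier_mat q q1" "S \<in> carrier_mat q1 q2"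
  shows "mapp Q (mapp S x) = mapp (Q * S) x"
proof
  fix i
  show "mapp Q (mapp S x) i = mapp (Q * S) x i"
  proof (cases "i < q")
    case True
    have "mapp Q (mapp S x) i = (\<Sum>j<q1. \<Sum>k<q2. Polynomial.smult (Q $$ (i, j) * S $$ (j, k)) (x k))"
      using True assms by (auto simp: mapp_def pl.scale_sum_right intro!: sum.cong)
    also have "\<dots> = (\<Sum>k<q2. \<Sum>j<q1. Polynomial.smult (Q $$ (i, j) * S $$ (j, k)) (x k))"
      by (rule sum.swap)
    also have "\<dots> = mapp (Q * S) x i"
      using True assms
      by (auto simp: mapp_def scalar_prod_def atLeast0LessThan pl.scale_sum_left intro!: sum.cong)
    finally show ?thesis .
  qed (use assms in \<open>auto simp: mapp_def\<close>)
qed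

lemma mapp_one: "x \<in> PV q n \<Longrightarrow> mapp (1\<^sub>m q) x = x"
  by (auto simp: mapp_def PV_def fun_eq_iff if_distrib if_distribR cong: if_cong)

text \<open>Comparing the coefficients in \<open>A Q = R B\<close>, a row of \<open>A\<close>
  applied to \<open>Q x\<close> is a constant combination of the rows of \<open>B\<close> applied to
  \<open>x\<close>.\<close>

lemma dotp_prow_mapp:
  assumes A: "fst A \<in> carrier_mat p q" "snd A \<in> carrier_mat p q" and Q: "Q \<in> carrier_mat q q"
    and B: "fst B \<in> carrier_mat p q" "snd B \<in> carrier_mat p q" and R: "R \<in> carrier_mat p p"
    and eq: "fst A * Q = R * fst B" "snd A * Q = R * snd B" and r: "r < p"
  shows "dotp q (prow A r) (mapp Q x) = (\<Sum>k<p. Polynomial.smult (R $$ (r, k)) (dotp q (prow B k) x))"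
proof -
  have "dotp q (prow A r) (mapp Q x)
      = (\<Sum>i<q. \<Sum>j<q. Polynomial.smult (Q $$ (i, j)) [:fst A $$ (r, i), snd A $$ (r, i):] * x j)"
    using A Q by (auto simp: dotp_def prow_def mapp_def sum_distrib_left simp del: mult_pCons_left smult_pCons intro!: sum.cong)
  also have "\<dots> = (\<Sum>j<q. (\<Sum>i<q. Polynomial.smult (Q $$ (i, j)) [:fst A $$ (r, i), snd A $$ (r, i):]) * x j)"
    unfolding sum_distrib_right by (rule sum.swap)
  also have "\<dots> = (\<Sum>j<q. [:(fst A * Q) $$ (r, j), (snd A * Q) $$ (r, j):] * x j)"
    using A Q r by (intro sum.cong refl)
      (simp add: pCons_sum scalar_prod_def atLeast0LessThan mult.commute del: mult_pCons_left smult_pCons)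
  also have "\<dots> = (\<Sum>j<q. (\<Sum>k<p. Polynomial.smult (R $$ (r, k)) [:fst B $$ (k, j), snd B $$ (k, j):]) * x j)"
    using B R r unfolding eq by (intro sum.cong refl)
      (simp add: pCons_sum scalar_prod_def atLeast0LessThan del: mult_pCons_left smult_pCons)
  also have "\<dots> = (\<Sum>k<p. \<Sum>j<q. Polynomial.smult (R $$ (r, k)) [:fst B $$ (k, j), snd B $$ (k, j):] * x j)"
    unfolding sum_distrib_right by (rule sum.swap)
  also have "\<dots> = (\<Sum>k<p. Polynomial.smult (R $$ (r, k)) (dotp q (prow B k) x))"
    using B by (auto simp: dotp_def prow_def pl.scale_sum_right simp del: mult_pCons_left smult_pCons intro!: sum.cong)
  finally show ?thesis .
qed

text \<open>A constant \<open>Q\<close> with a left inverse embeds the null vectors of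
  \<open>B\<close> into those of \<open>A\<close> without raising degrees.\<close>

lemma dimM_le_of_mult:
  assumes A: "fst A \<in> carrier_mat p q" "snd A \<in> carrier_mat p q"
    and Q: "Q \<in> carrier_mat q q" "Q' \<in> carrier_mat q q" "Q' * Q = 1\<^sub>m q"
    and B: "fst B \<in> carrier_mat p q" "snd B \<in> carrier_mat p q" and R: "R \<in> carrier_mat p p"
    and eq: "fst A * Q = R * fst B" "snd A * Q = R * snd B"
  shows "dimM q (prows B) n \<le> dimM q (prows A) n"
proof -
  interpret l: Vector_Spaces.linear pscale pscale "mapp Q" by (rule linear_mapp)
  have im: "mapp Q ` MS q (prows B) n \<subseteq> MS q (prows A) n"
  proof clarify
    fix x assume "x \<in> MS q (prows B) n"
    then have x: "x \<in> PV q n" "\<And>r. r < p \<Longrightarrow> dotp q (prow B r) x = 0" using MS_prows[OF B(1)] by auto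
    have "dotp q (prow A r) (mapp Q x) = 0" if "r < p" for r
      using dotp_prow_mapp[OF A Q(1) B R eq that] x(2) by simp
    then show "mapp Q x \<in> MS q (prows A) n" using MS_prows[OF A(1)] mapp_PV[OF Q(1) x(1)] by auto
  qed
  have "{x \<in> MS q (prows B) n. mapp Q x = 0} = {0}"
  proof -
    have "x = 0" if "x \<in> MS q (prows B) n" "mapp Q x = 0" for x
    proof -
      have "x \<in> PV q n" using that by (simp add: MS_def)
      then have "x = mapp (Q' * Q) x" using Q(3) by (simp add: mapp_one)
      also have "\<dots> = mapp Q' 0" using mapp_mult[OF Q(2,1), of x] that(2) by simp
      also have "\<dots> = 0" by (auto simp: mapp_def fun_eq_iff)
      finally show ?thesis .
    qed
    then show ?thesis using ps.subspace_0[OF subspace_MS, of q "prows B" n] l.zero by auto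
  qed
  then have "ps.dim (MS q (prows B) n) = ps.dim (mapp Q ` MS q (prows B) n)"
    using l.rank_nullity[OF subspace_MS fd_MS, of q "prows B" n] by (simp add: ps.dim_zero_singleton)
  also have "\<dots> \<le> ps.dim (MS q (prows A) n)" by (rule ps.dim_subset_fd[OF fd_MS im])
  finally show ?thesis by (simp add: dimM_def)
qed

lemma dimM_kequiv:
  assumes "kequiv A B" "fst A \<in> carrier_mat p q"
  shows "dimM q (prows A) n = dimM q (prows B) n"
proof -
  from assms(1) obtain p1 q1 P P' Q Q' where 1: "P \<in> carrier_mat p1 p1" "P' \<in> carrier_mat p1 p1"
     "Q \<in> carrier_mat q1 q1" "Q' \<in> carrier_mat q1 q1" "P * P' = 1\<^sub>m p1" "P' * P = 1\<^sub>m p1"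
     "Q * Q' = 1\<^sub>m q1" "Q' * Q = 1\<^sub>m q1" "fst A \<in> carrier_mat p1 q1" "snd A \<in> carrier_mat p1 q1"
     "P * fst A * Q = fst B" "P * snd A * Q = snd B" unfolding kequiv_def by blast
  have pq: "p1 = p" "q1 = q" using 1(9) assms(2) by auto
  note 1 = 1[unfolded pq]
  note B = kequiv_carrier[OF assms, THEN conjunct1] kequiv_carrier[OF assms, THEN conjunct2]
  have a: "M * Q = P' * (P * M * Q)" if M: "M \<in> carrier_mat p q" for M
  proof -
    have "P' * (P * M * Q) = P' * (P * (M * Q))" using 1 M by (simp add: assoc_mult_mat[of P p p M q Q q])
    also have "\<dots> = (P' * P) * (M * Q)" using 1 M by (intro assoc_mult_mat[symmetric, of _ p p _ p _ q]) auto
    finally show ?thesis using 1 M by simp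
  qed
  have b: "(P * M * Q) * Q' = P * M" if M: "M \<in> carrier_mat p q" for M
  proof -
    have "(P * M * Q) * Q' = (P * M) * (Q * Q')" using 1 M by (intro assoc_mult_mat[of _ p q _ q _ q]) auto
    then show ?thesis using 1 M by simp
  qed
  have "dimM q (prows B) n \<le> dimM q (prows A) n"
    by (rule dimM_le_of_mult[OF 1(9,10) 1(3,4,8) B 1(2)]) (use a[OF 1(9)] a[OF 1(10)] 1(11,12) in simp_all)
  moreover have "dimM q (prows A) n \<le> dimM q (prows B) n"
    by (rule dimM_le_of_mult[OF B 1(4,3,7) 1(9,10) 1(1)])
      (use b[OF 1(9)] b[OF 1(10)] 1(11,12) in simp_all)
  ultimately show ?thesis by simp
qed

text \<open>Projection onto the last \<open>q2\<close> coordinates maps the null vectors of the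
  direct sum onto those of \<open>C\<close>, with those of \<open>B\<close> as kernel.\<close>

lemma dimM_bdiag:
  assumes B: "fst B \<in> carrier_mat p1 q1" "snd B \<in> carrier_mat p1 q1"
    and C: "fst C \<in> carrier_mat p2 q2" "snd C \<in> carrier_mat p2 q2"
  shows "dimM (q1 + q2) (prows (bdiag (fst B) (fst C), bdiag (snd B) (snd C))) n
     = dimM q1 (prows B) n + dimM q2 (prows C) n"
proof -
  let ?D = "(bdiag (fst B) (fst C), bdiag (snd B) (snd C))"
  let ?f = "\<lambda>x :: nat \<Rightarrow> 'a poly. \<lambda>i. x (q1 + i)"
  have D: "fst ?D \<in> carrier_mat (p1 + p2) (q1 + q2)" using bdiag_carrier[OF B(1) C(1)] by simp
  have row1: "dotp (q1 + q2) (prow ?D r) x = dotp q1 (prow B r) x" if "r < p1" for r x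
  proof -
    have "(\<Sum>i<q1. prow ?D r i * x i) = (\<Sum>i<q1. prow B r i * x i)"
      using B C that by (intro sum.cong) (auto simp: prow_def bdiag_def)
    moreover have "(\<Sum>i<q2. prow ?D r (q1 + i) * x (q1 + i)) = 0"
      using B C that by (intro sum.neutral) (auto simp: prow_def bdiag_def)
    ultimately show ?thesis by (simp add: dotp_def sum_lessThan_add)
  qed
  have row2: "dotp (q1 + q2) (prow ?D (p1 + r)) x = dotp q2 (prow C r) (?f x)" if "r < p2" for r x
  proof -
    have "(\<Sum>i<q1. prow ?D (p1 + r) i * x i) = 0"
      using B C that by (intro sum.neutral) (auto simp: prow_def bdiag_def)
    moreover have "(\<Sum>i<q2. prow ?D (p1 + r) (q1 + i) * x (q1 + i)) = (\<Sum>i<q2. prow C r i * x (q1 + i))"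
      using B C that by (intro sum.cong) (auto simp: prow_def bdiag_def)
    ultimately show ?thesis by (simp add: dotp_def sum_lessThan_add)
  qed
  have mem: "x \<in> MS (q1 + q2) (prows ?D) n \<longleftrightarrow> x \<in> PV (q1 + q2) n \<and> (\<forall>r<p1. dotp q1 (prow B r) x = 0)
      \<and> (\<forall>r<p2. dotp q2 (prow C r) (?f x) = 0)" for x
  proof -
    have "(\<forall>r<p1 + p2. dotp (q1 + q2) (prow ?D r) x = 0) \<longleftrightarrow>
       (\<forall>r<p1. dotp (q1 + q2) (prow ?D r) x = 0) \<and> (\<forall>r<p2. dotp (q1 + q2) (prow ?D (p1 + r)) x = 0)"
      by (auto, metis add_diff_inverse_nat nat_add_left_cancel_less)
    then show ?thesis unfolding MS_prows[OF D] using row1 row2 by auto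
  qed
  interpret l: Vector_Spaces.linear pscale pscale ?f
    by unfold_locales (auto simp: fun_eq_iff)
  have "?f ` MS (q1 + q2) (prows ?D) n = MS q2 (prows C) n"
  proof (rule subset_antisym)
    show "?f ` MS (q1 + q2) (prows ?D) n \<subseteq> MS q2 (prows C) n"
    proof clarify
      fix x assume "x \<in> MS (q1 + q2) (prows ?D) n"
      then show "?f x \<in> MS q2 (prows C) n" unfolding mem MS_prows[OF C(1)] by (simp add: PV_def)
    qed
    show "MS q2 (prows C) n \<subseteq> ?f ` MS (q1 + q2) (prows ?D) n"
    proof
      fix y assume y: "y \<in> MS q2 (prows C) n"
      define x where "x = (\<lambda>i. if i < q1 then 0 else y (i - q1))"
      have fx: "?f x = y" by (auto simp: x_def)
      have "dotp q1 (prow B r) x = 0" for r by (simp add: dotp_def x_def)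
      moreover have "x \<in> PV (q1 + q2) n" using y by (auto simp: MS_def PV_def PP_def x_def)
      ultimately have "x \<in> MS (q1 + q2) (prows ?D) n" using y fx unfolding mem MS_prows[OF C(1)] by simp
      then show "y \<in> ?f ` MS (q1 + q2) (prows ?D) n" using fx by blast
    qed
  qed
  moreover have "{x \<in> MS (q1 + q2) (prows ?D) n. ?f x = 0} = MS q1 (prows B) n"
  proof -
    have "x \<in> PV q1 n" if "x \<in> PV (q1 + q2) n" "?f x = 0" for x
    proof -
      have "x i = 0" if "q1 \<le> i" for i using fun_cong[OF \<open>?f x = 0\<close>, of "i - q1"] that by simp
      then show ?thesis using that by (simp add: PV_def)
    qed
    moreover have "x \<in> PV (q1 + q2) n \<and> ?f x = 0" if "x \<in> PV q1 n" for x
      using that by (auto simp: PV_def fun_eq_iff)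
    moreover have "dotp q2 r (\<lambda>a. 0) = 0" for r :: "nat \<Rightarrow> 'a poly" by (simp add: dotp_def)
    ultimately show ?thesis unfolding set_eq_iff mem_Collect_eq mem MS_prows[OF B(1)] by auto
  qed
  ultimately show ?thesis
    using l.rank_nullity[OF subspace_MS fd_MS, of "q1 + q2" "prows ?D" n] by (simp add: dimM_def)
qed

section \<open>Null vectors of the Kronecker blocks\<close>

lemma sum_mult_if:
  fixes x :: "nat \<Rightarrow> 'b::comm_ring_1"
  shows "(\<Sum>i<n. (if i = r then c else 0) * x i) = (if r < n then c * x r else 0)"
proof -
  have "(\<Sum>i<n. (if i = r then c else 0) * x i) = (\<Sum>i<n. if i = r then c * x i else 0)"
    by (intro sum.cong) auto
  then show ?thesis by simp
qed

definition xvar :: "'a::field poly" where "xvar = [:0, 1:]"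

text \<open>Every row of a Kronecker block has at most two nonzero entries. An index outside the
  range stands for a missing entry.\<close>

lemma dotp_if2:
  fixes x :: "nat \<Rightarrow> 'a::field poly"
  assumes "\<And>i. i < n \<Longrightarrow> f i = (if i = r then c else 0) + (if i = r' then d else 0)"
  shows "dotp n f x = (if r < n then c * x r else 0) + (if r' < n then d * x r' else 0)"
proof -
  have "dotp n f x = (\<Sum>i<n. (if i = r then c else 0) * x i + (if i = r' then d else 0) * x i)"
    unfolding dotp_def using assms by (intro sum.cong) (auto simp: distrib_right)
  then show ?thesis by (simp add: sum.distrib sum_mult_if)
qed

lemma dimM_eq_0: "(\<And>x. x \<in> MS q R n \<Longrightarrow> x = 0) \<Longrightarrow> dimM q R n = 0"
proof -
  assume 0: "\<And>x. x \<in> MS q R n \<Longrightarrow> x = 0"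
  have "MS q R n \<subseteq> {0}" by (rule subsetI) (simp add: 0)
  then have "MS q R n = {0}" using ps.subspace_0[OF subspace_MS, of q R n] by auto
  then show ?thesis by (simp add: dimM_def ps.dim_zero_singleton)
qed

lemma back_substitution:
  fixes x :: "nat \<Rightarrow> 'a::field poly"
  assumes "\<And>r. r < k \<Longrightarrow> c * x r + (if Suc r < k then d * x (Suc r) else 0) = 0" "c \<noteq> 0" "r < k"
  shows "x r = 0"
  using assms(3)
proof (induction "k - r" arbitrary: r rule: less_induct)
  case less
  show ?case
  proof (cases "Suc r < k")
    case True
    then have "x (Suc r) = 0" using less by simp
    then show ?thesis using assms(1)[OF less.prems] assms(2) True by simp
  qed (use assms(1)[OF less.prems] assms(2) in simp)
qed

fun lb_dim :: "nat \<Rightarrow> 'a kblock \<Rightarrow> nat" where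
  "lb_dim n (LB k) = n - k" | "lb_dim n _ = 0"

text \<open>A null vector is determined by its first entry, the later ones being that entry times
  powers of -s. The last of the k + 1 entries has the largest degree and leaves degree below n - k
  for the first.\<close>

lemma dimM_LB: "dimM (k + 1) (prows (kblock_pencil (LB k) :: 'a::field pencil)) n = n - k"
proof -
  let ?B = "kblock_pencil (LB k) :: 'a pencil"
  have B: "fst ?B \<in> carrier_mat k (k + 1)" by (simp add: shift_mat_def)
  have row: "dotp (k + 1) (prow ?B r) x = x (Suc r) + xvar * x r" if "r < k" for r x
    using that by (subst dotp_if2[of _ _ "Suc r" 1 r xvar])
      (auto simp: prow_def shift_mat_def diag_mat_rc_def xvar_def)
  have mem: "x \<in> MS (k + 1) (prows ?B) n \<longleftrightarrow> x \<in> PV (k + 1) n \<and> (\<forall>r<k. x (Suc r) = - xvar * x r)" for x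
    unfolding MS_prows[OF B] using row by (auto simp: add_eq_0_iff2)
  have pw: "x r = (- xvar) ^ r * x 0" if "x \<in> MS (k + 1) (prows ?B) n" "r \<le> k" for x r
    using that(2)
  proof (induction r)
    case (Suc r)
    then show ?case using that(1) unfolding mem by (simp add: algebra_simps)
  qed simp
  have co: "coeff ((- xvar) ^ r * p) j = (if j < r then 0 else (- 1) ^ r * coeff p (j - r))" for r j and p :: "'a poly"
  proof -
    have "(- xvar) ^ r = monom ((- 1) ^ r :: 'a) r"
      by (induction r) (auto simp: xvar_def monom_Suc algebra_simps minus_monom)
    then show ?thesis by (simp add: coeff_monom_mult)
  qed
  let ?f = "\<lambda>x :: nat \<Rightarrow> 'a poly. x 0"
  interpret l: Vector_Spaces.linear pscale Polynomial.smult ?f by unfold_locales auto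
  have "?f ` MS (k + 1) (prows ?B) n = PP (n - k)"
  proof (rule subset_antisym)
    show "?f ` MS (k + 1) (prows ?B) n \<subseteq> PP (n - k)"
    proof clarify
      fix x assume x: "x \<in> MS (k + 1) (prows ?B) n"
      have "coeff (x 0) j = 0" if "n - k \<le> j" for j
      proof -
        have "coeff (x k) (j + k) = 0" using x that unfolding mem by (simp add: PV_def PP_def)
        then show ?thesis using pw[OF x, of k] co[of k "x 0" "j + k"] by simp
      qed
      then show "x 0 \<in> PP (n - k)" by (simp add: PP_def)
    qed
    show "PP (n - k) \<subseteq> ?f ` MS (k + 1) (prows ?B) n"
    proof
      fix p :: "'a poly" assume p: "p \<in> PP (n - k)"
      define x where "x = (\<lambda>i. if i \<le> k then (- xvar) ^ i * p else 0)"
      have "coeff ((- xvar) ^ i * p) j = 0" if "i \<le> k" "n \<le> j" for i j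
        using p that by (auto simp: co PP_def)
      then have "x \<in> PV (k + 1) n" by (auto simp: x_def PV_def PP_def)
      moreover have "x (Suc r) = - xvar * x r" if "r < k" for r using that by (simp add: x_def algebra_simps)
      ultimately have "x \<in> MS (k + 1) (prows ?B) n" unfolding mem by blast
      moreover have "x 0 = p" by (simp add: x_def)
      ultimately show "p \<in> ?f ` MS (k + 1) (prows ?B) n" by blast
    qed
  qed
  moreover have "{x \<in> MS (k + 1) (prows ?B) n. ?f x = 0} = {0}"
  proof -
    have "x = 0" if x: "x \<in> MS (k + 1) (prows ?B) n" "x 0 = 0" for x
    proof
      fix i show "x i = 0 i"
      proof (cases "i \<le> k")
        case True then show ?thesis using pw[OF x(1) True] x(2) by simp
      next
        case False then show ?thesis using x(1) unfolding mem by (simp add: PV_def)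
      qed
    qed
    then show ?thesis using ps.subspace_0[OF subspace_MS, of "k + 1" "prows ?B" n] by auto
  qed
  ultimately show ?thesis
    using l.rank_nullity[OF subspace_MS fd_MS, of "k + 1" "prows ?B" n]
    by (simp add: dimM_def dim_PP ps.dim_zero_singleton)
qed

text \<open>All blocks other than L blocks have only the zero null vector: substitution runs forward
  through a transposed L block and backward through a Jordan block.\<close>

lemma dimM_kblock:
  fixes b :: "'a::field kblock"
  shows "dimM (dim_col (fst (kblock_pencil b))) (prows (kblock_pencil b)) n = lb_dim n b"
proof (cases b)
  case (LB k)
  then show ?thesis using dimM_LB[of k n] by (simp add: shift_mat_def)
next
  case (LTB k)
  let ?B = "kblock_pencil (LTB k) :: 'a pencil"
  have B: "fst ?B \<in> carrier_mat (k + 1) k" by (simp add: shift_mat_def)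
  have row: "dotp k (prow ?B r) x = (if r < k then xvar * x r else 0) + (if r \<noteq> 0 then x (r - 1) else 0)"
    if "r < k + 1" for r x
  proof (cases r)
    case 0
    then show ?thesis using that by (subst dotp_if2[of _ _ r xvar k 1])
      (auto simp: prow_def shift_mat_def diag_mat_rc_def xvar_def)
  next
    case (Suc r')
    then show ?thesis using that by (subst dotp_if2[of _ _ r xvar r' 1])
      (auto simp: prow_def shift_mat_def diag_mat_rc_def xvar_def)
  qed
  have "x = 0" if x: "x \<in> MS k (prows ?B) n" for x
  proof
    have eq: "(if r < k then xvar * x r else 0) + (if r \<noteq> 0 then x (r - 1) else 0) = 0" if "r < k + 1" for r
      using x that unfolding MS_prows[OF B] using row[OF that, of x] by auto
    fix i show "x i = 0 i"
    proof (cases "i < k")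
      case True then show ?thesis
      proof (induction i)
        case 0 then show ?case using eq[of 0] by (simp add: xvar_def)
      next
        case (Suc i) then show ?case using eq[of "Suc i"] by (simp add: xvar_def)
      qed
    qed (use x in \<open>simp add: MS_def PV_def\<close>)
  qed
  then show ?thesis using LTB by (simp add: shift_mat_def dimM_eq_0)
next
  case (JB k mu)
  let ?B = "kblock_pencil (JB k mu) :: 'a pencil"
  have B: "fst ?B \<in> carrier_mat k k" by (simp add: shift_mat_def minus_carrier_mat del: minus_mat_def)
  have row: "dotp k (prow ?B r) x = [:- mu, 1:] * x r + (if Suc r < k then 1 * x (Suc r) else 0)" if "r < k" for r x
    using that by (subst dotp_if2[of _ _ r "[:- mu, 1:]" "Suc r" 1])
      (auto simp: prow_def shift_mat_def)
  have "x = 0" if x: "x \<in> MS k (prows ?B) n" for x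
  proof
    have eq: "[:- mu, 1:] * x r + (if Suc r < k then 1 * x (Suc r) else 0) = 0" if "r < k" for r
      using x that row[OF that, of x] unfolding MS_prows[OF B] by metis
    fix i show "x i = 0 i"
      by (cases "i < k") (use back_substitution[OF eq, of i] x in \<open>auto simp: MS_def PV_def\<close>)
  qed
  then show ?thesis using JB B by (simp add: dimM_eq_0)
next
  case (NB k)
  let ?B = "kblock_pencil (NB k) :: 'a pencil"
  have B: "fst ?B \<in> carrier_mat k k" by simp
  have row: "dotp k (prow ?B r) x = 1 * x r + (if Suc r < k then xvar * x (Suc r) else 0)" if "r < k" for r x
    using that by (subst dotp_if2[of _ _ r 1 "Suc r" xvar])
      (auto simp: prow_def shift_mat_def xvar_def)
  have "x = 0" if x: "x \<in> MS k (prows ?B) n" for x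
  proof
    have eq: "1 * x r + (if Suc r < k then xvar * x (Suc r) else 0) = 0" if "r < k" for r
      using x that row[OF that, of x] unfolding MS_prows[OF B] by metis
    fix i show "x i = 0 i"
      by (cases "i < k") (use back_substitution[OF eq, of i] x in \<open>auto simp: MS_def PV_def\<close>)
  qed
  then show ?thesis using NB B by (simp add: dimM_eq_0)
qed

lemma kblock_carrier:
  "fst (kblock_pencil b) \<in> carrier_mat (dim_row (fst (kblock_pencil b))) (dim_col (fst (kblock_pencil b)))"
  "snd (kblock_pencil b) \<in> carrier_mat (dim_row (fst (kblock_pencil b))) (dim_col (fst (kblock_pencil b)))"
  by (cases b; auto simp: shift_mat_def diag_mat_rc_def)+

lemma bdiag_dim: "dim_row (bdiag A B) = dim_row A + dim_row B" "dim_col (bdiag A B) = dim_col A + dim_col B"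
  by (simp_all add: bdiag_def)

lemma kcf_Cons: "kcf_pencil (b # bs) = (bdiag (fst (kblock_pencil b)) (fst (kcf_pencil bs)),
    bdiag (snd (kblock_pencil b)) (snd (kcf_pencil bs)))"
  by (simp add: kcf_pencil_def diag_block_mat_Cons' del: diag_block_mat.simps)

lemma kcf_carrier:
  "fst (kcf_pencil bs) \<in> carrier_mat (dim_row (fst (kcf_pencil bs))) (dim_col (fst (kcf_pencil bs)))
   \<and> snd (kcf_pencil bs) \<in> carrier_mat (dim_row (fst (kcf_pencil bs))) (dim_col (fst (kcf_pencil bs)))"
proof (induction bs)
  case Nil
  then show ?case by (simp add: kcf_Nil)
next
  case (Cons b bs)
  show ?case
    unfolding kcf_Cons fst_conv snd_conv bdiag_dim
    by (intro conjI bdiag_carrier kblock_carrier Cons[THEN conjunct1] Cons[THEN conjunct2])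
qed

lemma dimM_kcf: "dimM (dim_col (fst (kcf_pencil bs))) (prows (kcf_pencil bs)) n = (\<Sum>b\<leftarrow>bs. lb_dim n b)"
proof (induction bs)
  case Nil
  have "x = 0" if "x \<in> MS 0 (prows (kcf_pencil [] :: 'a pencil)) n" for x
    using that by (auto simp: MS_def PV_def fun_eq_iff)
  then show ?case by (simp add: kcf_Nil dimM_eq_0)
next
  case (Cons b bs)
  have "dim_col (fst (kcf_pencil (b # bs))) = dim_col (fst (kblock_pencil b)) + dim_col (fst (kcf_pencil bs))"
    unfolding kcf_Cons by (simp add: bdiag_dim)
  moreover have "dimM (dim_col (fst (kblock_pencil b)) + dim_col (fst (kcf_pencil bs))) (prows (kcf_pencil (b # bs))) n
      = lb_dim n b + (\<Sum>b\<leftarrow>bs. lb_dim n b)"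
    unfolding kcf_Cons
    using dimM_bdiag[OF kblock_carrier kcf_carrier[THEN conjunct1] kcf_carrier[THEN conjunct2], of b bs n]
      dimM_kblock[of b n] Cons by metis
  ultimately show ?case by simp
qed

section \<open>Recovering the column minimal indices from dimensions\<close>

lemma is_kcf_kequiv:
  assumes "is_kcf A bs" "fst A \<in> carrier_mat p q" "snd A \<in> carrier_mat p q"
  shows "kequiv A (kcf_pencil bs)"
proof -
  obtain P Q where PQ: "P \<in> carrier_mat p p" "Q \<in> carrier_mat q q" "invertible_mat P" "invertible_mat Q"
    "P * fst A * Q = fst (kcf_pencil bs)" "P * snd A * Q = snd (kcf_pencil bs)"
    using assms unfolding is_kcf_def by auto
  have inv: "\<exists>Y. Y \<in> carrier_mat r r \<and> X * Y = 1\<^sub>m r \<and> Y * X = 1\<^sub>m r"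
    if X: "X \<in> carrier_mat r r" "invertible_mat X" for X :: "'a mat" and r
  proof -
    obtain Y where Y: "X * Y = 1\<^sub>m (dim_row X)" "Y * X = 1\<^sub>m (dim_row Y)"
      using X(2) by (auto simp: invertible_mat_def inverts_mat_def)
    have "dim_col (X * Y) = r" "dim_col (Y * X) = dim_row Y" unfolding Y using X(1) by auto
    then have "Y \<in> carrier_mat r r" using X(1) by auto
    then show ?thesis using X(1) Y by auto
  qed
  obtain P' where P': "P' \<in> carrier_mat p p" "P * P' = 1\<^sub>m p" "P' * P = 1\<^sub>m p" using inv PQ(1,3) by blast
  obtain Q' where Q': "Q' \<in> carrier_mat q q" "Q * Q' = 1\<^sub>m q" "Q' * Q = 1\<^sub>m q" using inv PQ(2,4) by blast
  show ?thesis unfolding kequiv_def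
    by (intro exI[of _ p] exI[of _ q] exI[of _ P] exI[of _ P'] exI[of _ Q] exI[of _ Q'] conjI PQ P' Q' assms(2,3))
qed

text \<open>The first difference counts the indices at most n; the difference of these counts is a
  multiplicity, which gives \<open>mset_eq_of_sums\<close>.\<close>

lemma sum_mset_diff_Suc:
  fixes M :: "nat multiset"
  shows "(\<Sum>k\<in>#M. Suc n - k) = (\<Sum>k\<in>#M. n - k) + size (filter_mset (\<lambda>k. k \<le> n) M)"
  by (induction M) auto

lemma size_filter_le_Suc:
  fixes M :: "nat multiset"
  shows "size (filter_mset (\<lambda>k. k \<le> Suc n) M) = size (filter_mset (\<lambda>k. k \<le> n) M) + count M (Suc n)"
  by (induction M) auto

lemma mset_eq_of_sums:
  fixes M N :: "nat multiset"
  assumes "\<And>n. (\<Sum>k\<in>#M. n - k) = (\<Sum>k\<in>#N. n - k)"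
  shows "M = N"
proof (rule multiset_eqI)
  have f: "size (filter_mset (\<lambda>k. k \<le> n) M) = size (filter_mset (\<lambda>k. k \<le> n) N)" for n
    using sum_mset_diff_Suc[of n M] sum_mset_diff_Suc[of n N] assms by simp
  have z: "size (filter_mset (\<lambda>k. k \<le> 0) X) = count X 0" for X :: "nat multiset"
    by (induction X) auto
  fix k show "count M k = count N k"
  proof (cases k)
    case 0 then show ?thesis using f[of 0] z by simp
  next
    case (Suc n)
    then show ?thesis using f[of n] f[of k] size_filter_le_Suc[of n M] size_filter_le_Suc[of n N] by simp
  qed
qed

lemma lb_dim_sum: "(\<Sum>k\<in>#mset [k. LB k \<leftarrow> bs]. n - k) = (\<Sum>b\<leftarrow>bs. lb_dim n b)"
proof (induction bs)
  case (Cons b bs)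
  then show ?case by (cases b) auto
qed simp

text \<open>By invariance every Kronecker form of \<open>A\<close> yields the same sums, hence the
  same multiset of L block sizes. With the existence of a form, the definite description in
  \<open>col_min_indices\<close> is therefore determined.\<close>

theorem dimM_col_min_indices:
  fixes A :: "'a::alg_closed_field pencil"
  assumes A: "fst A \<in> carrier_mat p q" "snd A \<in> carrier_mat p q"
  shows "dimM q (prows A) n = (\<Sum>k\<in>#col_min_indices A. n - k)"
proof -
  have d: "dimM q (prows A) n = (\<Sum>k\<in>#mset [k. LB k \<leftarrow> bs]. n - k)" if "is_kcf A bs" for bs n
  proof -
    have e: "kequiv A (kcf_pencil bs)" by (rule is_kcf_kequiv[OF that A])
    then have "dim_col (fst (kcf_pencil bs)) = q" using kequiv_carrier[OF e A(1)] by auto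
    then show ?thesis using dimM_kequiv[OF e A(1)] dimM_kcf[of bs n] lb_dim_sum[of n bs] by simp
  qed
  obtain bs where bs: "is_kcf A bs" using kcf_exists[OF A] by blast
  have "col_min_indices A = mset [k. LB k \<leftarrow> bs]"
    unfolding col_min_indices_def
  proof (rule the_equality)
    fix M assume "\<exists>bs. is_kcf A bs \<and> M = mset [k. LB k \<leftarrow> bs]"
    then obtain bs' where bs': "is_kcf A bs'" "M = mset [k. LB k \<leftarrow> bs']" by blast
    show "M = mset [k. LB k \<leftarrow> bs]"
      unfolding bs'(2) by (rule mset_eq_of_sums) (use d[OF bs] d[OF bs'(1)] in metis)
  qed (use bs in blast)
  then show ?thesis using d[OF bs] by simp
qed

subsection \<open>Dimension of a span of vectors\<close>

text \<open>Extension by zero carries vectors of a fixed length into \<open>FV\<close>, where the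
  dimension counts above apply.\<close>

definition vfun :: "'k::field vec \<Rightarrow> nat \<Rightarrow> 'k" where
  "vfun v = (\<lambda>i. if i < dim_vec v then v $ i else 0)"

lemma vfun_FV: "v \<in> carrier_vec n \<Longrightarrow> vfun v \<in> FV n"
  by (auto simp: vfun_def FV_def)

lemma vfun_vec: "f \<in> FV n \<Longrightarrow> vfun (vec n f) = f"
  by (auto simp: vfun_def FV_def fun_eq_iff)

lemma vec_vfun: "v \<in> carrier_vec n \<Longrightarrow> vec n (vfun v) = v"
  by (auto simp: vfun_def)

lemma image_vec_vfun:
  assumes "S \<subseteq> carrier_vec n" shows "vec n ` vfun ` S = S"
proof (rule subset_antisym)
  show "vec n ` vfun ` S \<subseteq> S"
  proof clarify
    fix v assume v: "v \<in> S"
    then have "vec n (vfun v) = v" using assms by (intro vec_vfun) blast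
    then show "vec n (vfun v) \<in> S" using v by simp
  qed
  show "S \<subseteq> vec n ` vfun ` S"
  proof
    fix v assume v: "v \<in> S"
    then have e: "vec n (vfun v) = v" using assms by (intro vec_vfun) blast
    have "vec n (vfun v) \<in> vec n ` vfun ` S" using v by (intro imageI)
    then show "v \<in> vec n ` vfun ` S" unfolding e .
  qed
qed

lemma vfun_add: "v \<in> carrier_vec n \<Longrightarrow> w \<in> carrier_vec n \<Longrightarrow> vfun (v + w) = vfun v + vfun w"
  by (auto simp: vfun_def fun_eq_iff)

lemma vfun_smult: "vfun (c \<cdot>\<^sub>v v) = fscale c (vfun v)"
  by (auto simp: vfun_def fun_eq_iff)

lemma vfun_zero: "vfun (0\<^sub>v n) = 0"
  by (auto simp: vfun_def fun_eq_iff)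

lemma vfun_span:
  fixes U :: "'k::field vec set"
  assumes U: "U \<subseteq> carrier_vec n"
  shows "vfun ` LinearCombinations.module.span class_ring (module_vec TYPE('k) n) U = fs.span (vfun ` U)"
proof -
  interpret vec_space "TYPE('k)" n .
  have UC: "U \<subseteq> carrier V" using U by simp
  have sub: "span U \<subseteq> carrier_vec n" using span_is_subset2[OF U] by simp
  show ?thesis
  proof (rule subset_antisym)
    show "vfun ` span U \<subseteq> fs.span (vfun ` U)"
    proof clarify
      fix v assume "v \<in> span U"
      then obtain a A where A: "v = lincomb a A" "finite A" "A \<subseteq> U" using in_spanE by blast
      have AC: "A \<subseteq> carrier_vec n" using A U by blast
      have v: "v \<in> carrier_vec n" using A AC by simp
      have "vfun v = (\<Sum>u\<in>A. fscale (a u) (vfun u))"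
      proof
        fix i show "vfun v i = (\<Sum>u\<in>A. fscale (a u) (vfun u)) i"
        proof (cases "i < n")
          case True
          then have "vfun v i = (\<Sum>u\<in>A. a u * u $ i)"
            using v A(1) lincomb_index[OF True AC, of a] by (simp add: vfun_def)
          also have "\<dots> = (\<Sum>u\<in>A. fscale (a u) (vfun u) i)"
            using AC True by (intro sum.cong) (auto simp: vfun_def)
          finally show ?thesis by (simp add: sum_fun_apply)
        next
          case False
          then have "fscale (a u) (vfun u) i = 0" if "u \<in> A" for u using AC that by (auto simp: vfun_def)
          then show ?thesis using False v by (simp add: sum_fun_apply vfun_def)
        qed
      qed
      also have "\<dots> \<in> fs.span (vfun ` U)"
        using A(3) by (intro fs.span_sum fs.span_scale fs.span_base) auto
      finally show "vfun v \<in> fs.span (vfun ` U)" .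
    qed
    show "fs.span (vfun ` U) \<subseteq> vfun ` span U"
    proof (rule fs.span_minimal)
      show "vfun ` U \<subseteq> vfun ` span U" using in_own_span[OF U] by blast
      show "fs.subspace (vfun ` span U)"
      proof (rule fs.subspaceI)
        have "0\<^sub>v n \<in> span U" by (rule in_spanI[of _ "\<lambda>_. 0" "{}"]) (auto simp: lincomb_def)
        then show "0 \<in> vfun ` span U" using vfun_zero by (metis imageI)
        fix x y assume "x \<in> vfun ` span U" "y \<in> vfun ` span U"
        then obtain v w where vw: "v \<in> span U" "w \<in> span U" "x = vfun v" "y = vfun w" by blast
        have "v + w \<in> span U" using span_add1[OF U vw(1,2)] by simp
        moreover have "x + y = vfun (v + w)"
          unfolding vw(3,4) by (rule vfun_add[symmetric]) (use vw(1,2) sub in blast)+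
        ultimately show "x + y \<in> vfun ` span U" by (metis imageI)
      next
        fix c x assume "x \<in> vfun ` span U"
        then obtain v where v: "v \<in> span U" "x = vfun v" by blast
        have "c \<cdot>\<^sub>v v \<in> span U" by (rule smult_in_span[OF U v(1)])
        then show "fscale c x \<in> vfun ` span U" using v vfun_smult by (metis imageI)
      qed
    qed
  qed
qed

text \<open>\<open>vectorspace.dim\<close> is the least size of a finite generating set. A basis on
  the function side is carried back to give one such set, and any generating set is carried forward
  to give the lower bound.\<close>

lemma dim_span_vec:
  fixes U :: "'k::field vec set"
  assumes U: "U \<subseteq> carrier_vec n"
  shows "vectorspace.dim class_ring ((module_vec TYPE('k) n)\<lparr>carrier :=
      LinearCombinations.module.span class_ring (module_vec TYPE('k) n) U\<rparr>) = fs.dim (vfun ` U)"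
proof -
  interpret vec_space "TYPE('k)" n .
  have UC: "U \<subseteq> carrier V" using U by simp
  let ?W = "span U"
  have sub: "?W \<subseteq> carrier_vec n" using span_is_subset2[OF U] by simp
  have sm: "submodule class_ring ?W V" by (rule span_is_submodule[OF U])
  have vsW: "vectorspace class_ring (vs ?W)"
    using span_is_subspace[of U] UC U subspace_is_vs by simp
  have gen: "LinearCombinations.module.span class_ring (vs ?W) A = span A" if "A \<subseteq> ?W" for A
    by (rule span_li_not_depend(1)[OF that sm])
  have S: "vfun ` ?W = fs.span (vfun ` U)" by (rule vfun_span[OF U])
  have "vfun ` ?W \<subseteq> FV n" using sub vfun_FV by blast
  then have fdS: "fd fscale (vfun ` ?W)" by (rule fs.fd_mono[OF fd_FV])
  obtain B where B: "finite B" "B \<subseteq> vfun ` ?W" "fs.independent B" "vfun ` ?W \<subseteq> fs.span B" "card B = fs.dim (vfun ` ?W)"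
    using fdS by (rule fs.fd_basis)
  have BF: "f \<in> FV n" if "f \<in> B" for f using B(2) sub vfun_FV that by blast
  define A where "A = vec n ` B"
  have AW: "A \<subseteq> ?W"
  proof
    fix v assume "v \<in> A"
    then obtain f where f: "f \<in> B" "v = vec n f" by (auto simp: A_def)
    then obtain w where w: "w \<in> ?W" "f = vfun w" using B(2) by blast
    then have "vec n (vfun w) = w" using sub by (intro vec_vfun) blast
    then show "v \<in> ?W" using f w by simp
  qed
  have AC: "A \<subseteq> carrier_vec n" using AW sub by blast
  have vA: "vfun ` A = B" using vfun_vec BF by (force simp: A_def)
  have cA: "card A = fs.dim (vfun ` ?W)" "finite A"
  proof -
    show "finite A" using B by (simp add: A_def)
    then have "card (vfun ` A) \<le> card A" by (rule card_image_le)
    moreover have "card A \<le> card B" unfolding A_def by (rule card_image_le[OF B(1)])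
    ultimately show "card A = fs.dim (vfun ` ?W)" using vA B(5) by simp
  qed
  have spA: "span A = ?W"
  proof -
    have "vfun ` span A = fs.span B" using vfun_span[OF AC] vA by simp
    also have "\<dots> = vfun ` ?W"
      using B(2,4) S fs.span_minimal[OF B(2)] by (metis fs.subspace_span subset_antisym)
    finally have eq: "vfun ` span A = vfun ` ?W" .
    have "span A \<subseteq> carrier_vec n" by (rule span_is_subset2[OF AC])
    then have "span A = vec n ` vfun ` span A" by (rule image_vec_vfun[symmetric])
    also have "\<dots> = vec n ` vfun ` ?W" unfolding eq ..
    also have "\<dots> = ?W" by (rule image_vec_vfun[OF sub])
    finally show ?thesis .
  qed
  have "vectorspace.dim class_ring (vs ?W) = fs.dim (vfun ` ?W)"
    unfolding vectorspace.dim_def[OF vsW]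
  proof (rule Least_equality)
    show "\<exists>A. finite A \<and> card A = fs.dim (vfun ` ?W) \<and> A \<subseteq> carrier (vs ?W)
        \<and> LinearCombinations.module.span class_ring (vs ?W) A = carrier (vs ?W)"
      using cA AW spA gen[OF AW] by (intro exI[of _ A]) simp
  next
    fix k assume "\<exists>A. finite A \<and> card A = k \<and> A \<subseteq> carrier (vs ?W)
        \<and> LinearCombinations.module.span class_ring (vs ?W) A = carrier (vs ?W)"
    then obtain A' where A': "finite A'" "card A' = k" "A' \<subseteq> carrier (vs ?W)"
      "LinearCombinations.module.span class_ring (vs ?W) A' = carrier (vs ?W)" by blast
    have A'W: "A' \<subseteq> ?W" using A'(3) by simp
    have spA': "span A' = ?W" using A'(4) gen[OF A'W] by simp
    have "vfun ` ?W = fs.span (vfun ` A')"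
      using vfun_span[OF order_trans[OF A'W sub]] unfolding spA' .
    then have "fs.dim (vfun ` ?W) \<le> card (vfun ` A')" using A'(1) by (intro fs.dim_le_card) auto
    also have "\<dots> \<le> k" using card_image_le[OF A'(1)] A'(2) by simp
    finally show "fs.dim (vfun ` ?W) \<le> k" .
  qed
  then show ?thesis using S by simp
qed

subsection \<open>Jordan chains\<close>

text \<open>Substituting s + l for s, or exchanging the coefficients for the point at infinity,
  moves the eigenvalue to 0, and the two recursions for chains become the same one.\<close>

definition at_pt :: "'a::field xpt \<Rightarrow> 'a pencil \<Rightarrow> 'a pencil" where
  "at_pt lam A = (case lam of Fin l \<Rightarrow> (fst A + l \<cdot>\<^sub>m snd A, snd A) | Infty \<Rightarrow> (snd A, fst A))"

lemma at_pt_carrier: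
  assumes "fst A \<in> carrier_mat p q" "snd A \<in> carrier_mat p q"
  shows "fst (at_pt lam A) \<in> carrier_mat p q" "snd (at_pt lam A) \<in> carrier_mat p q"
  using assms by (auto simp: at_pt_def split: xpt.splits)

lemma jordan_chain_at_pt:
  assumes "fst A \<in> carrier_mat p q" "snd A \<in> carrier_mat p q"
  shows "jordan_chain A lam xs \<longleftrightarrow> xs \<noteq> [] \<and> (\<forall>x\<in>set xs. x \<in> carrier_vec q) \<and> xs ! 0 \<noteq> 0\<^sub>v q \<and>
     fst (at_pt lam A) *\<^sub>v (xs ! 0) = 0\<^sub>v p \<and>
     (\<forall>i. Suc i < length xs \<longrightarrow> fst (at_pt lam A) *\<^sub>v (xs ! Suc i) = - (snd (at_pt lam A) *\<^sub>v (xs ! i)))"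
proof -
  have e: "(\<forall>i. 1 \<le> i \<and> i < length xs \<longrightarrow> P i (i - 1)) \<longleftrightarrow> (\<forall>i. Suc i < length xs \<longrightarrow> P (Suc i) i)"
    (is "?l \<longleftrightarrow> ?r") for P
  proof
    assume ?l
    then show ?r by (metis diff_Suc_1 le_add1 plus_1_eq_Suc)
  next
    assume r: ?r
    show ?l
    proof (intro allI impI)
      fix i assume "1 \<le> i \<and> i < length xs"
      then show "P i (i - 1)" using r[rule_format, of "i - 1"] by simp
    qed
  qed
  show ?thesis
  proof (cases lam)
    case (Fin l)
    then show ?thesis
      using assms e[of "\<lambda>i j. (fst A + l \<cdot>\<^sub>m snd A) *\<^sub>v (xs ! i) = - (snd A *\<^sub>v (xs ! j))"]
      by (simp add: jordan_chain_def at_pt_def)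
  next
    case Infty
    then show ?thesis
      using assms e[of "\<lambda>i j. snd A *\<^sub>v (xs ! i) = - (fst A *\<^sub>v (xs ! j))"]
      by (simp add: jordan_chain_def at_pt_def)
  qed
qed

section \<open>Coefficient vectors of polynomial vectors as Jordan chains\<close>

definition cvec :: "nat \<Rightarrow> (nat \<Rightarrow> 'a::field poly) \<Rightarrow> nat \<Rightarrow> 'a vec" where
  "cvec q x j = vec q (\<lambda>i. coeff (x i) j)"

lemma cvec_carrier [simp]: "cvec q x j \<in> carrier_vec q"
  by (simp add: cvec_def)

lemma mult_cvec_index:
  assumes "M \<in> carrier_mat p q" "r < p"
  shows "(M *\<^sub>v cvec q x j) $ r = (\<Sum>i<q. M $$ (r, i) * coeff (x i) j)"
proof -
  have "(M *\<^sub>v cvec q x j) $ r = (\<Sum>i\<in>{0..<q}. row M r $ i * cvec q x j $ i)"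
    using assms by (simp add: scalar_prod_def cvec_def)
  also have "\<dots> = (\<Sum>i<q. M $$ (r, i) * coeff (x i) j)"
    using assms by (intro sum.cong) (auto simp: cvec_def)
  finally show ?thesis .
qed

lemma coeff_linear_mult:
  "coeff ([:a, b:] * p) 0 = a * coeff p 0"
  "coeff ([:a, b:] * p) (Suc j) = a * coeff p (Suc j) + b * coeff p j"
  by simp_all

lemma coeff_dotp_prow:
  assumes B: "fst B \<in> carrier_mat p q" "snd B \<in> carrier_mat p q" and r: "r < p"
  shows "coeff (dotp q (prow B r) x) 0 = (fst B *\<^sub>v cvec q x 0) $ r"
    "coeff (dotp q (prow B r) x) (Suc j) = (fst B *\<^sub>v cvec q x (Suc j)) $ r + (snd B *\<^sub>v cvec q x j) $ r"
proof -
  have e: "prow B r i = [:fst B $$ (r, i), snd B $$ (r, i):]" if "i < q" for i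
    using B that by (simp add: prow_def)
  have "coeff (dotp q (prow B r) x) 0 = (\<Sum>i<q. fst B $$ (r, i) * coeff (x i) 0)"
    unfolding dotp_def coeff_sum by (intro sum.cong refl) (simp only: e lessThan_iff coeff_linear_mult)
  then show "coeff (dotp q (prow B r) x) 0 = (fst B *\<^sub>v cvec q x 0) $ r"
    unfolding mult_cvec_index[OF B(1) r] .
  have "coeff (dotp q (prow B r) x) (Suc j)
      = (\<Sum>i<q. fst B $$ (r, i) * coeff (x i) (Suc j) + snd B $$ (r, i) * coeff (x i) j)"
    unfolding dotp_def coeff_sum by (intro sum.cong refl) (simp only: e lessThan_iff coeff_linear_mult)
  then show "coeff (dotp q (prow B r) x) (Suc j) = (fst B *\<^sub>v cvec q x (Suc j)) $ r + (snd B *\<^sub>v cvec q x j) $ r"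
    unfolding mult_cvec_index[OF B(1) r] mult_cvec_index[OF B(2) r] sum.distrib .
qed

lemma vec_eq_zero_iff: "v \<in> carrier_vec p \<Longrightarrow> v = 0\<^sub>v p \<longleftrightarrow> (\<forall>r<p. v $ r = 0)"
  by (metis carrier_vecD eq_vecI index_zero_vec(1,2))

lemma vec_eq_uminus_iff:
  fixes v w :: "'a::field vec"
  assumes "v \<in> carrier_vec p" "w \<in> carrier_vec p"
  shows "v = - w \<longleftrightarrow> (\<forall>r<p. v $ r + w $ r = 0)"
proof
  assume "v = - w"
  then show "\<forall>r<p. v $ r + w $ r = 0" using assms by simp
next
  assume h: "\<forall>r<p. v $ r + w $ r = 0"
  show "v = - w"
  proof (rule eq_vecI)
    fix r assume "r < dim_vec (- w)"
    then have r: "r < p" using assms by simp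
    then show "v $ r = (- w) $ r" using assms h by (simp add: eq_neg_iff_add_eq_0)
  qed (use assms in simp)
qed

text \<open>Coefficient j of the product is \<open>B0 x_j + B1 x_(j-1)\<close>, so the coefficients
  of a truncated solution satisfy the recursion of a Jordan chain, except that the first ones may be
  zero.\<close>

lemma XS_prows:
  assumes B: "fst B \<in> carrier_mat p q" "snd B \<in> carrier_mat p q" and l: "l \<ge> 1"
  shows "x \<in> XS q (prows B) l \<longleftrightarrow> x \<in> PV q l \<and> fst B *\<^sub>v cvec q x 0 = 0\<^sub>v p \<and>
     (\<forall>j. Suc j < l \<longrightarrow> fst B *\<^sub>v cvec q x (Suc j) = - (snd B *\<^sub>v cvec q x j))"
proof -
  have c: "fst B *\<^sub>v cvec q x j \<in> carrier_vec p" "snd B *\<^sub>v cvec q x j \<in> carrier_vec p" for j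
    by (rule mult_mat_vec_carrier[OF B(1) cvec_carrier], rule mult_mat_vec_carrier[OF B(2) cvec_carrier])
  have pr: "dim_row (fst B) = p" using B by simp
  have "x \<in> XS q (prows B) l \<longleftrightarrow> x \<in> PV q l \<and> (\<forall>j<l. \<forall>r<p. coeff (dotp q (prow B r) x) j = 0)"
    unfolding XS_def prows_def pr by blast
  also have "(\<forall>j<l. \<forall>r<p. coeff (dotp q (prow B r) x) j = 0) \<longleftrightarrow>
     (\<forall>r<p. coeff (dotp q (prow B r) x) 0 = 0) \<and> (\<forall>j. Suc j < l \<longrightarrow> (\<forall>r<p. coeff (dotp q (prow B r) x) (Suc j) = 0))"
    (is "(\<forall>j<l. ?P j) \<longleftrightarrow> _")
  proof -
    have "?P j" if "?P 0" "\<forall>j. Suc j < l \<longrightarrow> ?P (Suc j)" "j < l" for j using that by (cases j) auto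
    then show ?thesis using l by fastforce
  qed
  also have "(\<forall>r<p. coeff (dotp q (prow B r) x) 0 = 0) \<longleftrightarrow> fst B *\<^sub>v cvec q x 0 = 0\<^sub>v p"
    unfolding vec_eq_zero_iff[OF c(1)] by (auto simp only: coeff_dotp_prow[OF B])
  also have "(\<forall>j. Suc j < l \<longrightarrow> (\<forall>r<p. coeff (dotp q (prow B r) x) (Suc j) = 0)) \<longleftrightarrow>
      (\<forall>j. Suc j < l \<longrightarrow> fst B *\<^sub>v cvec q x (Suc j) = - (snd B *\<^sub>v cvec q x j))"
    unfolding vec_eq_uminus_iff[OF c(1) c(2)] by (simp only: coeff_dotp_prow[OF B] cong: imp_cong all_cong)
  finally show ?thesis .
qed

lemma coeff_sum_monom_shift:
  "coeff (\<Sum>m\<le>j. monom (c m) (m + d)) t = (if d \<le> t \<and> t - d \<le> j then c (t - d) else (0::'a::field))"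
proof -
  have "coeff (\<Sum>m\<le>j. monom (c m) (m + d)) t = (\<Sum>m\<le>j. if m + d = t then c m else 0)"
    by (simp add: coeff_sum)
  also have "\<dots> = (\<Sum>m\<le>j. if d \<le> t \<and> m = t - d then c m else 0)"
    by (intro sum.cong) auto
  also have "\<dots> = (if d \<le> t \<and> t - d \<le> j then c (t - d) else 0)"
    by (cases "d \<le> t") auto
  finally show ?thesis .
qed

text \<open>A chain vector is moved to the top coefficient by multiplying the chain, cut off after
  that vector, by a power of the variable. Conversely, the coefficients of a truncated solution from
  the first nonzero one on form a chain that ends in the top coefficient.\<close>

lemma chain_vectors:
  assumes A: "fst A \<in> carrier_mat p q" "snd A \<in> carrier_mat p q" and l: "l \<ge> 1"
  shows "fs.span (vfun ` (\<Union>{set xs | xs. jordan_chain A lam xs \<and> length xs \<le> l}))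
     = (\<lambda>x i. coeff (x i) (l - 1)) ` XS q (prows (at_pt lam A)) l" (is "fs.span (vfun ` ?U) = ?g ` ?X")
proof -
  let ?B = "at_pt lam A"
  note B = at_pt_carrier[OF A, of lam]
  note mem = XS_prows[OF B l]
  interpret g: Vector_Spaces.linear pscale fscale ?g
    by unfold_locales (auto simp: fun_eq_iff)
  have gv: "?g x = vfun (cvec q x (l - 1))" if "x \<in> ?X" for x
    using that by (auto simp: XS_def PV_def cvec_def vfun_def fun_eq_iff)
  show ?thesis
  proof (rule subset_antisym)
    show "fs.span (vfun ` ?U) \<subseteq> ?g ` ?X"
    proof (rule fs.span_minimal)
      show "fs.subspace (?g ` ?X)" by (rule g.subspace_image[OF subspace_XS])
      show "vfun ` ?U \<subseteq> ?g ` ?X"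
      proof clarify
        fix v xs assume v: "v \<in> set xs" and ch: "jordan_chain A lam xs" and len: "length xs \<le> l"
        obtain j where j: "j < length xs" "v = xs ! j" using v by (auto simp: in_set_conv_nth)
        note c = ch[unfolded jordan_chain_at_pt[OF A]]
        \<comment> \<open>The shift that brings the chosen vector, number \<open>j\<close> of the
          chain, to coefficient \<open>l - 1\<close>.\<close>
        define d where "d = l - 1 - j"
        define x where "x = (\<lambda>i. if i < q then \<Sum>m\<le>j. monom (xs ! m $ i) (m + d) else 0)"
        have dj: "d + j = l - 1" using j len by (simp add: d_def)
        have co: "coeff (x i) t = (if i < q \<and> d \<le> t \<and> t - d \<le> j then xs ! (t - d) $ i else 0)" for i t
          by (simp add: x_def coeff_sum_monom_shift)
        have xc: "xs ! k \<in> carrier_vec q" if "k < length xs" for k using c that by simp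
        have cv: "cvec q x t = (if d \<le> t \<and> t - d \<le> j then xs ! (t - d) else 0\<^sub>v q)" for t
          using xc[of "t - d"] j by (auto simp: cvec_def co)
        have z: "M *\<^sub>v 0\<^sub>v q = 0\<^sub>v p" if "M \<in> carrier_mat p q" for M :: "'a mat" using that by auto
        have z': "- (0\<^sub>v p) = (0\<^sub>v p :: 'a vec)" by auto
        have "x i = 0" if "q \<le> i" for i using that by (simp add: x_def)
        then have "x \<in> PV q l" using dj l by (auto simp: PV_def PP_def co)
        moreover have "fst ?B *\<^sub>v cvec q x 0 = 0\<^sub>v p" using c z[OF B(1)] by (auto simp: cv)
        moreover have "fst ?B *\<^sub>v cvec q x (Suc t) = - (snd ?B *\<^sub>v cvec q x t)" if t: "Suc t < l" for t
        proof -
          have tj: "Suc t - d \<le> j" using dj t by simp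
          consider "Suc t < d" | "Suc t = d" | "d \<le> t" by linarith
          then show ?thesis
          proof cases
            case 1 then show ?thesis using z[OF B(1)] z[OF B(2)] z' by (simp add: cv)
          next
            case 2 then show ?thesis using c z[OF B(2)] z' by (simp add: cv)
          next
            case 3
            then have "Suc t - d = Suc (t - d)" "Suc (t - d) < length xs" using tj j by auto
            then show ?thesis using c 3 tj by (simp add: cv)
          qed
        qed
        ultimately have xX: "x \<in> ?X" unfolding mem by blast
        have "cvec q x (d + j) = v" using j by (simp add: cv)
        then have "cvec q x (l - 1) = v" unfolding dj .
        then show "vfun v \<in> ?g ` ?X" using gv[OF xX] xX by (metis image_eqI)
      qed
    qed
    show "?g ` ?X \<subseteq> fs.span (vfun ` ?U)"
    proof clarify
      fix x assume xX: "x \<in> ?X"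
      note x = xX[unfolded mem]
      show "?g x \<in> fs.span (vfun ` ?U)"
      proof (cases "cvec q x (l - 1) = 0\<^sub>v q")
        case True
        then have g0: "?g x = 0" unfolding gv[OF xX] by (simp add: vfun_zero)
        show ?thesis unfolding g0 by (rule fs.span_zero)
      next
        case False
        \<comment> \<open>A chain must start with a nonzero vector, so the zero coefficients in
          front are dropped; the new first vector lies in the kernel because the coefficient before
          it is zero.\<close>
        define d where "d = (LEAST t. cvec q x t \<noteq> 0\<^sub>v q)"
        have d: "cvec q x d \<noteq> 0\<^sub>v q" "d \<le> l - 1"
          using LeastI[of "\<lambda>t. cvec q x t \<noteq> 0\<^sub>v q", OF False] Least_le[of "\<lambda>t. cvec q x t \<noteq> 0\<^sub>v q", OF False]
          by (simp_all add: d_def)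
        have below: "cvec q x t = 0\<^sub>v q" if "t < d" for t using not_less_Least that unfolding d_def by blast
        define xs where "xs = map (\<lambda>t. cvec q x (t + d)) [0..<l - d]"
        have "fst ?B *\<^sub>v cvec q x d = 0\<^sub>v p"
        proof (cases d)
          case 0 then show ?thesis using x by simp
        next
          case (Suc t)
          then have "fst ?B *\<^sub>v cvec q x d = - (snd ?B *\<^sub>v cvec q x t)" using x d l by simp
          also have "\<dots> = 0\<^sub>v p" using below[of t] Suc B by auto
          finally show ?thesis .
        qed
        then have "jordan_chain A lam xs"
          unfolding jordan_chain_at_pt[OF A] using d l x by (auto simp: xs_def)
        moreover have "length xs \<le> l" by (simp add: xs_def)
        moreover have "cvec q x (l - 1) \<in> set xs"
          using d l by (auto simp: xs_def intro!: image_eqI[of _ _ "l - 1 - d"])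
        ultimately have "cvec q x (l - 1) \<in> ?U" by blast
        then show ?thesis unfolding gv[OF xX] by (intro fs.span_base imageI)
      qed
    qed
  qed
qed

lemma deg1_prow: "deg1 (prow A r)"
  by (auto simp: deg1_def prow_def)

text \<open>Rank and nullity for the top coefficient: \<open>chain_vectors\<close> describes its
  image, and for degree reasons its kernel consists of exact null vectors.\<close>

lemma dim_chain_space:
  fixes A :: "'a::field pencil"
  assumes A: "fst A \<in> carrier_mat p q" "snd A \<in> carrier_mat p q"
  shows "dimX q (prows (at_pt lam A)) l
     = subspace_dim TYPE('a) q (chain_space A lam l) + dimM q (prows (at_pt lam A)) (l - 1)"
proof (cases "l \<ge> 1")
  \<comment> \<open>For \<open>l = 0\<close> the zero space is the span of the empty set, which
    \<open>dim_span_vec\<close> covers.\<close>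
  case False
  interpret vec_space "TYPE('a)" q .
  have "span {} = {0\<^sub>v q}"
    unfolding span_def lincomb_def by auto
  then have "subspace_dim TYPE('a) q (chain_space A lam 0) = fs.dim (vfun ` ({} :: 'a vec set))"
    using dim_span_vec[of "{} :: 'a vec set" q] A by (simp add: subspace_dim_def chain_space_def)
  also have "\<dots> = 0" using fs.dim_eq_card_independent[OF fs.independent_empty] by simp
  finally have "subspace_dim TYPE('a) q (chain_space A lam 0) = 0" .
  moreover have "l = 0" using False by simp
  ultimately show ?thesis by simp
next
  case True
  let ?R = "prows (at_pt lam A)"
  let ?U = "\<Union>{set xs | xs. jordan_chain A lam xs \<and> length xs \<le> l}"
  let ?g = "\<lambda>(x :: nat \<Rightarrow> 'a poly) i. coeff (x i) (l - 1)"
  interpret g: Vector_Spaces.linear pscale fscale ?g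
    by unfold_locales (auto simp: fun_eq_iff)
  have "?U \<subseteq> carrier_vec q" using jordan_chain_at_pt[OF A] by auto
  then have "subspace_dim TYPE('a) q (chain_space A lam l) = fs.dim (vfun ` ?U)"
    using dim_span_vec[of ?U q] A True by (simp add: subspace_dim_def chain_space_def)
  also have "\<dots> = fs.dim (fs.span (vfun ` ?U))" by simp
  also have "\<dots> = fs.dim (?g ` XS q ?R l)" unfolding chain_vectors[OF A True] ..
  finally have 1: "subspace_dim TYPE('a) q (chain_space A lam l) = fs.dim (?g ` XS q ?R l)" .
  have "{x \<in> XS q ?R l. ?g x = 0} = MS q ?R (l - 1)"
  proof (intro Set.equalityI subsetI)
    fix x assume x: "x \<in> {x \<in> XS q ?R l. ?g x = 0}"
    have "coeff (x i) j = 0" if "l - 1 \<le> j" for i j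
    proof (cases "j = l - 1")
      case True then show ?thesis using x by (simp add: fun_eq_iff)
    next
      case False then show ?thesis using x that \<open>l \<ge> 1\<close> by (auto simp: XS_def PV_def PP_def)
    qed
    then have pv: "x \<in> PV q (l - 1)" using x by (auto simp: XS_def PV_def PP_def)
    have "dotp q r x = 0" if rR: "r \<in> ?R" for r
    proof (rule poly_eqI)
      fix j
      obtain k where "r = prow (at_pt lam A) k" using rR unfolding prows_def by (rule imageE)
      then have "deg1 r" by (simp only: deg1_prow)
      then have "dotp q r x \<in> PP l" using dotp_PP[OF _ pv] True by simp
      then show "coeff (dotp q r x) j = coeff 0 j"
        using x that by (cases "j < l") (auto simp: XS_def PP_def)
    qed
    then show "x \<in> MS q ?R (l - 1)" using pv by (simp add: MS_def)
  next
    fix x assume "x \<in> MS q ?R (l - 1)"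
    then show "x \<in> {x \<in> XS q ?R l. ?g x = 0}"
      by (auto simp: MS_def XS_def PV_def PP_def fun_eq_iff)
  qed
  then show ?thesis
    using g.rank_nullity[OF subspace_XS fd_XS, of q ?R l] 1 by (simp add: dimX_def dimM_def)
qed

theorem weyr_eq_wd:
  fixes A :: "'a::field pencil"
  assumes A: "fst A \<in> carrier_mat p q" "snd A \<in> carrier_mat p q" and i: "i \<ge> 1"
  shows "weyr A lam i = wd q (prows (at_pt lam A)) i"
proof -
  have "dim_col (fst A) = q" using A by simp
  moreover have "i - 1 - 1 = i - 2" by simp
  ultimately show ?thesis
    using dim_chain_space[OF A, of lam i] dim_chain_space[OF A, of lam "i - 1"]
    by (simp add: weyr_def wd_def)
qed

subsection \<open>Normal rank\<close>

definition nullK :: "nat \<Rightarrow> (nat \<Rightarrow> 'a::field poly) set \<Rightarrow> (nat \<Rightarrow> 'a poly fract) set" where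
  "nullK q R = {y \<in> FV q. \<forall>r\<in>R. dotp q (\<lambda>i. to_fract (r i)) y = 0}"

lemma dotp_fscale: "dotp q r (fscale c y) = c * dotp q r y"
  by (simp add: dotp_def sum_distrib_left algebra_simps)

lemma subspace_nullK: "fs.subspace (nullK q R)"
  using subspace_FV[of q] by (auto simp: fs.subspace_def nullK_def dotp_add_right dotp_fscale)

lemma fd_nullK: "fd fscale (nullK q R)"
  by (rule fs.fd_mono[OF fd_FV[of q]]) (auto simp: nullK_def)

text \<open>Rank and nullity over the rational functions; \<open>vec_space.rank\<close> is the
  dimension of the span of the columns, that is, of the image.\<close>

lemma normal_rank_nullK:
  fixes A :: "'a::field pencil"
  assumes A: "fst A \<in> carrier_mat p q" "snd A \<in> carrier_mat p q"
  shows "q = normal_rank A + fs.dim (nullK q (prows A))"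
proof -
  define M where "M = pencil_ratmat A"
  have M: "M \<in> carrier_mat p q" using A by (simp add: M_def pencil_ratmat_def)
  interpret g: Vector_Spaces.linear fscale fscale "mapm M" by (rule linear_mapm)
  have mr: "mapm M y r = dotp q (\<lambda>i. to_fract (prow A r i)) y" if "r < p" for y r
    using A that by (auto simp: mapm_def M_def pencil_ratmat_def dotp_def prow_def intro!: sum.cong)
  have m0: "mapm M y = 0 \<longleftrightarrow> (\<forall>r<p. mapm M y r = 0)" for y
  proof
    assume h: "\<forall>r<p. mapm M y r = 0"
    show "mapm M y = 0"
    proof
      fix r show "mapm M y r = 0 r" using h M by (cases "r < p") (auto simp: mapm_def)
    qed
  qed simp
  have pr: "dim_row (fst A) = p" using A by simp
  have "{y \<in> FV q. mapm M y = 0} = {y \<in> FV q. \<forall>r<p. dotp q (\<lambda>i. to_fract (prow A r i)) y = 0}"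
    unfolding m0 by (simp only: mr cong: imp_cong all_cong)
  also have "\<dots> = nullK q (prows A)"
    unfolding nullK_def prows_def pr by blast
  finally have "{y \<in> FV q. mapm M y = 0} = nullK q (prows A)" .
  then have q: "q = fs.dim (mapm M ` FV q) + fs.dim (nullK q (prows A))"
    using g.rank_nullity[OF subspace_FV fd_FV, of q] by (simp add: dim_FV)
  have col: "mapm M (unitf i) = vfun (col M i)" if "i < q" for i
    using M that by (auto simp: mapm_def vfun_def unitf_def fun_eq_iff if_distrib cong: if_cong)
  have "FV q = fs.span (unitf ` {..<q} :: (nat \<Rightarrow> 'a poly fract) set)"
  proof (rule subset_antisym[OF FV_subset_span fs.span_minimal[OF _ subspace_FV]])
    show "(unitf ` {..<q} :: (nat \<Rightarrow> 'a poly fract) set) \<subseteq> FV q" by (auto simp: FV_def unitf_def)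
  qed
  then have "mapm M ` FV q = fs.span (mapm M ` unitf ` {..<q})" by (simp add: g.span_image)
  also have "mapm M ` unitf ` {..<q} = vfun ` set (cols M)"
    using M col by (force simp: cols_def)
  finally have "fs.dim (mapm M ` FV q) = fs.dim (vfun ` set (cols M))" by (simp only: fs.dim_span)
  also have "\<dots> = vec_space.rank p M"
    unfolding vec_space.rank_def by (rule dim_span_vec[symmetric]) (use cols_dim[of M] M in simp)
  also have "\<dots> = normal_rank A" using A by (simp add: normal_rank_def M_def)
  finally show ?thesis using q by simp
qed

lemma nullK_insert:
  "fs.dim (nullK q R) = fs.dim (nullK q (insert r R))
     + (if \<exists>y\<in>nullK q R. dotp q (\<lambda>i. to_fract (r i)) y \<noteq> 0 then 1 else 0)"
proof -
  \<comment> \<open>The scalar value is placed in coordinate 0, so that the functional maps into the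
    one-dimensional \<open>FV 1\<close>.\<close>
  let ?g = "\<lambda>y i. if i = (0::nat) then dotp q (\<lambda>i. to_fract (r i)) y else 0"
  interpret g: Vector_Spaces.linear fscale fscale ?g
    by unfold_locales (auto simp: fun_eq_iff dotp_add_right dotp_fscale)
  have g0: "?g y = 0 \<longleftrightarrow> dotp q (\<lambda>i. to_fract (r i)) y = 0" for y
    by (auto simp: fun_eq_iff)
  have "{y \<in> nullK q R. ?g y = 0} = nullK q (insert r R)"
    unfolding g0 by (auto simp: nullK_def)
  then have e: "fs.dim (nullK q R) = fs.dim (?g ` nullK q R) + fs.dim (nullK q (insert r R))"
    using g.rank_nullity[OF subspace_nullK fd_nullK, of q R] by simp
  have sub: "?g ` nullK q R \<subseteq> FV 1" by (auto simp: FV_def)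
  have fdg: "fd fscale (?g ` nullK q R)" by (rule fs.fd_mono[OF fd_FV sub])
  have le: "fs.dim (?g ` nullK q R) \<le> 1"
    using fs.dim_subset_fd[OF fd_FV sub] dim_FV[of 1] by metis
  have "fs.dim (?g ` nullK q R) = 0 \<longleftrightarrow> ?g ` nullK q R = {0}"
    by (rule fs.dim_eq_0_fd[OF g.subspace_image[OF subspace_nullK] fdg])
  also have "\<dots> \<longleftrightarrow> \<not> (\<exists>y\<in>nullK q R. dotp q (\<lambda>i. to_fract (r i)) y \<noteq> 0)"
  proof
    assume h: "?g ` nullK q R = {0}"
    have "?g y = 0" if "y \<in> nullK q R" for y using h that by blast
    then show "\<not> (\<exists>y\<in>nullK q R. dotp q (\<lambda>i. to_fract (r i)) y \<noteq> 0)" unfolding g0 by blast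
  next
    assume "\<not> (\<exists>y\<in>nullK q R. dotp q (\<lambda>i. to_fract (r i)) y \<noteq> 0)"
    then have "?g y = 0" if "y \<in> nullK q R" for y using that unfolding g0 by blast
    then have "?g ` nullK q R \<subseteq> {0}" by (simp only: image_subset_iff singleton_iff) blast
    moreover have "?g ` nullK q R \<noteq> {}" using fs.subspace_0[OF subspace_nullK, of q R] by blast
    ultimately show "?g ` nullK q R = {0}" by (simp only: subset_singleton_iff) blast
  qed
  finally show ?thesis using e le by auto
qed

section \<open>From rational to polynomial null vectors by clearing denominators\<close>

lemma clear_denominators:
  fixes y :: "nat \<Rightarrow> 'a::field poly fract"
  shows "\<exists>d x. d \<noteq> 0 \<and> (\<forall>i<q. to_fract (x i) = to_fract d * y i)"
proof (induction q)
  case 0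
  show ?case by (intro exI[of _ 1]) simp
next
  case (Suc q)
  then obtain d x where d: "d \<noteq> 0" "\<And>i. i < q \<Longrightarrow> to_fract (x i) = to_fract d * y i" by blast
  obtain a b where ab: "y q = Fract a b" "b \<noteq> 0" by (cases "y q")
  have yb: "to_fract b * y q = to_fract a"
    using ab by (simp add: to_fract_def eq_fract)
  show ?case
  proof (intro exI conjI allI impI)
    show "d * b \<noteq> 0" using d ab by simp
    fix i assume "i < Suc q"
    then show "to_fract (if i = q then d * a else b * x i) = to_fract (d * b) * y i"
      using d(2)[of i] yb by (auto simp: less_Suc_eq to_fract_mult algebra_simps)
  qed
qed

lemma dotp_to_fract: "dotp q (\<lambda>i. to_fract (r i)) (\<lambda>i. to_fract (x i)) = to_fract (dotp q r x)"
  by (induction q) (auto simp: dotp_def to_fract_add to_fract_mult)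

lemma nullK_clear:
  fixes R :: "(nat \<Rightarrow> 'a::field poly) set"
  assumes y: "y \<in> nullK q R"
  obtains d x n where "d \<noteq> 0" "x \<in> MS q R n" "(\<lambda>i. to_fract (x i)) = fscale (to_fract d) y"
proof -
  obtain d x0 where d: "d \<noteq> 0" "\<And>i. i < q \<Longrightarrow> to_fract (x0 i) = to_fract d * y i"
    using clear_denominators by blast
  define x where "x = (\<lambda>i. if i < q then x0 i else 0)"
  have xy: "(\<lambda>i. to_fract (x i)) = fscale (to_fract d) y"
    using d y by (auto simp: x_def nullK_def FV_def fun_eq_iff)
  define n where "n = Suc (Max (insert 0 ((\<lambda>i. degree (x i)) ` {..<q})))"
  have "degree (x i) < n" if "i < q" for i
    unfolding n_def using that by (intro le_imp_less_Suc Max_ge) auto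
  then have "x i \<in> PP n" for i
    by (cases "i < q") (auto simp: PP_def x_def intro!: coeff_eq_0 intro: less_le_trans)
  then have "x \<in> PV q n" by (auto simp: PV_def x_def)
  moreover have "dotp q r x = 0" if "r \<in> R" for r
  proof -
    have "to_fract (dotp q r x) = to_fract d * dotp q (\<lambda>i. to_fract (r i)) y"
      unfolding dotp_to_fract[symmetric] xy dotp_fscale ..
    then show ?thesis using y that by (simp add: nullK_def)
  qed
  ultimately have "x \<in> MS q R n" by (simp add: MS_def)
  from that[OF d(1) this xy] show ?thesis .
qed

lemma MS_nullK: "x \<in> MS q R n \<Longrightarrow> (\<lambda>i. to_fract (x i)) \<in> nullK q R"
  by (auto simp: nullK_def MS_def PV_def FV_def dotp_to_fract)

text \<open>Clearing denominators turns a rational null vector on which \<open>r\<close> is nonzero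
  into a polynomial one of some degree. So whether the row raises the normal rank can be read from
  \<open>sigma\<close>.\<close>

lemma dim_nullK_insert:
  "fs.dim (nullK q R) = fs.dim (nullK q (insert r R)) + of_bool (\<exists>n. sigma q R r n > 0)"
proof -
  have "(\<exists>y\<in>nullK q R. dotp q (\<lambda>i. to_fract (r i)) y \<noteq> 0) \<longleftrightarrow> (\<exists>n. sigma q R r n > 0)"
  proof
    assume "\<exists>y\<in>nullK q R. dotp q (\<lambda>i. to_fract (r i)) y \<noteq> 0"
    then obtain y where y: "y \<in> nullK q R" "dotp q (\<lambda>i. to_fract (r i)) y \<noteq> 0" by blast
    obtain d x n where x: "d \<noteq> 0" "x \<in> MS q R n" "(\<lambda>i. to_fract (x i)) = fscale (to_fract d) y"
      using nullK_clear[OF y(1)] by blast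
    have "to_fract (dotp q r x) \<noteq> 0"
      unfolding dotp_to_fract[symmetric] x(3) dotp_fscale using x(1) y(2) by simp
    then have "dotp q r x \<noteq> 0" by auto
    then have "x \<notin> MS q (insert r R) n" by (simp add: MS_def)
    then have "MS q (insert r R) n \<subset> MS q R n" using x(2) by (auto simp: MS_def)
    then have "dimM q (insert r R) n < dimM q R n"
      unfolding dimM_def by (intro ps.dim_psubset_fd subspace_MS fd_MS)
    then show "\<exists>n. sigma q R r n > 0" using dimM_insert[of q R n r] by (intro exI[of _ n]) simp
  next
    assume "\<exists>n. sigma q R r n > 0"
    then obtain n where "dimM q (insert r R) n < dimM q R n" using dimM_insert[of q R _ r] by auto
    then have "MS q (insert r R) n \<noteq> MS q R n" by (auto simp: dimM_def)
    then obtain x where x: "x \<in> MS q R n" "dotp q r x \<noteq> 0" by (auto simp: MS_def)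
    then have "dotp q (\<lambda>i. to_fract (r i)) (\<lambda>i. to_fract (x i)) \<noteq> 0" by (simp add: dotp_to_fract)
    then show "\<exists>y\<in>nullK q R. dotp q (\<lambda>i. to_fract (r i)) y \<noteq> 0" using MS_nullK[OF x(1)] by blast
  qed
  then show ?thesis using nullK_insert[of q R r] by simp
qed

lemma dim_nullK_pos: "fs.dim (nullK q R) > 0 \<longleftrightarrow> (\<exists>n. dimM q R n > 0)"
proof
  assume "fs.dim (nullK q R) > 0"
  then have "nullK q R \<noteq> {0}" using fs.dim_eq_0_fd[OF subspace_nullK fd_nullK, of q R] by simp
  then obtain y where y: "y \<in> nullK q R" "y \<noteq> 0" using fs.subspace_0[OF subspace_nullK, of q R] by blast
  obtain d x n where x: "d \<noteq> 0" "x \<in> MS q R n" "(\<lambda>i. to_fract (x i)) = fscale (to_fract d) y"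
    using nullK_clear[OF y(1)] by blast
  have "fscale (to_fract d) y \<noteq> 0" using x(1) y(2) by simp
  moreover have "(\<lambda>i. to_fract (x i)) = 0" if "x = 0" using that by (simp add: fun_eq_iff)
  ultimately have "x \<noteq> 0" using x(3) by metis
  then have "MS q R n \<noteq> {0}" using x(2) by blast
  then show "\<exists>n. dimM q R n > 0"
    using ps.dim_eq_0_fd[OF subspace_MS fd_MS, of q R n] by (auto simp: dimM_def)
next
  assume "\<exists>n. dimM q R n > 0"
  then obtain n where "dimM q R n > 0" by blast
  then have "MS q R n \<noteq> {0}" using ps.dim_eq_0_fd[OF subspace_MS fd_MS, of q R n] by (simp add: dimM_def)
  then obtain x where x: "x \<in> MS q R n" "x \<noteq> 0" using ps.subspace_0[OF subspace_MS, of q R n] by blast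
  then have "(\<lambda>i. to_fract (x i)) \<noteq> 0" by (auto simp: fun_eq_iff)
  then have "nullK q R \<noteq> {0}" using MS_nullK[OF x(1)] by blast
  then show "fs.dim (nullK q R) > 0" using fs.dim_eq_0_fd[OF subspace_nullK fd_nullK, of q R] by simp
qed

subsection \<open>Moving the eigenvalue to zero\<close>

text \<open>The effect of \<open>at_pt\<close> on a single row, written in coefficients so that it
  is linear and also applies to rows that belong to no pencil.\<close>

definition rowT :: "'a::field xpt \<Rightarrow> (nat \<Rightarrow> 'a poly) \<Rightarrow> nat \<Rightarrow> 'a poly" where
  "rowT lam r = (\<lambda>i. case lam of Fin l \<Rightarrow> [:coeff (r i) 0 + l * coeff (r i) 1, coeff (r i) 1:]
                       | Infty \<Rightarrow> [:coeff (r i) 1, coeff (r i) 0:])"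

fun xinv :: "'a::field xpt \<Rightarrow> 'a xpt" where
  "xinv (Fin l) = Fin (- l)" | "xinv Infty = Infty"

lemma linear_poly_eq: "degree p \<le> 1 \<Longrightarrow> p = [:coeff p 0, coeff p 1:]"
proof (rule poly_eqI)
  fix n assume "degree p \<le> 1"
  then show "coeff p n = coeff [:coeff p 0, coeff p 1:] n"
    by (cases n; cases "n - 1") (auto simp: coeff_eq_0)
qed

lemma deg1_rowT: "deg1 (rowT lam r)"
  by (simp add: deg1_def rowT_def split: xpt.splits)

lemma rowT_xinv: "deg1 r \<Longrightarrow> rowT (xinv lam) (rowT lam r) = r"
proof
  fix i assume "deg1 r"
  then have "r i = [:coeff (r i) 0, coeff (r i) 1:]" by (intro linear_poly_eq) (simp add: deg1_def)
  then show "rowT (xinv lam) (rowT lam r) i = r i"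
    by (cases lam) (simp_all add: rowT_def)
qed

lemma linear_rowT: "Vector_Spaces.linear pscale pscale (rowT lam)"
  by unfold_locales (simp_all add: rowT_def fun_eq_iff algebra_simps split: xpt.splits)

lemma rowT_span_cong:
  assumes "ps.span S = ps.span S'"
  shows "ps.span (rowT lam ` S) = ps.span (rowT lam ` S')"
proof -
  interpret l: Vector_Spaces.linear pscale pscale "rowT lam" by (rule linear_rowT)
  show ?thesis unfolding l.span_image assms ..
qed

lemma prow_at_pt:
  assumes A: "fst A \<in> carrier_mat p q" "snd A \<in> carrier_mat p q" and r: "r < p"
  shows "prow (at_pt lam A) r = rowT lam (prow A r)"
proof
  fix i
  show "prow (at_pt lam A) r i = rowT lam (prow A r) i"
    using A r by (cases lam; cases "i < q") (auto simp: prow_def at_pt_def rowT_def)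
qed

lemma prows_at_pt:
  assumes A: "fst A \<in> carrier_mat p q" "snd A \<in> carrier_mat p q"
  shows "prows (at_pt lam A) = rowT lam ` prows A"
proof -
  have d: "dim_row (fst (at_pt lam A)) = p" "dim_row (fst A) = p" using at_pt_carrier[OF A, of lam] A by auto
  show ?thesis unfolding prows_def d image_image
    by (intro image_cong refl) (simp only: prow_at_pt[OF A] lessThan_iff)
qed

section \<open>Dimensions of null vectors do not depend on the point\<close>

lemma PP_iff: "p \<in> PP n \<longleftrightarrow> p = 0 \<or> degree p < n"
proof
  assume p: "p \<in> PP n"
  show "p = 0 \<or> degree p < n"
  proof (rule ccontr)
    assume h: "\<not> (p = 0 \<or> degree p < n)"
    then have "coeff p (degree p) = 0" using p by (simp add: PP_def)
    then show False using h by simp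
  qed
next
  assume "p = 0 \<or> degree p < n"
  then have "coeff p j = 0" if "n \<le> j" for j using that by (elim disjE) (auto intro: coeff_eq_0)
  then show "p \<in> PP n" by (simp add: PP_def)
qed

lemma dimM_le_inj:
  assumes l: "Vector_Spaces.linear pscale pscale G"
    and im: "\<And>x. x \<in> MS q R n \<Longrightarrow> G x \<in> MS q R' n"
    and inj: "\<And>x. x \<in> MS q R n \<Longrightarrow> G x = 0 \<Longrightarrow> x = 0"
  shows "dimM q R n \<le> dimM q R' n"
proof -
  interpret l: Vector_Spaces.linear pscale pscale G by (rule l)
  have "{x \<in> MS q R n. G x = 0} \<subseteq> {0}" by (rule subsetI) (simp add: inj)
  then have "{x \<in> MS q R n. G x = 0} = {0}" using ps.subspace_0[OF subspace_MS, of q R n] l.zero by auto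
  then have "ps.dim (MS q R n) = ps.dim (G ` MS q R n)"
    using l.rank_nullity[OF subspace_MS fd_MS, of q R n] by (simp add: ps.dim_zero_singleton)
  also have "\<dots> \<le> ps.dim (MS q R' n)" by (rule ps.dim_subset_fd[OF fd_MS]) (use im in blast)
  finally show ?thesis by (simp add: dimM_def)
qed

text \<open>Reversal with respect to the formal degree n - 1, that is, s^(n-1) p(1/s).\<close>

definition revp :: "nat \<Rightarrow> 'a::field poly \<Rightarrow> 'a poly" where
  "revp n p = (\<Sum>j<n. monom (coeff p (n - 1 - j)) j)"

lemma coeff_revp: "coeff (revp n p) j = (if j < n then coeff p (n - 1 - j) else 0)"
proof -
  have "coeff (revp n p) j = (\<Sum>k<n. if k = j then coeff p (n - 1 - k) else 0)"
    unfolding revp_def coeff_sum by (intro sum.cong) auto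
  then show ?thesis by simp
qed

text \<open>Reversal is multiplicative when formal degrees add: 1 for the linear factor, n - 1 for
  \<open>p\<close>, n for the product.\<close>

lemma coeff_linear_revp:
  assumes "p \<in> PP n"
  shows "coeff ([:b, a:] * revp n p) j = (if j \<le> n then coeff ([:a, b:] * p) (n - j) else 0)"
proof (cases j)
  case 0
  show ?thesis
  proof (cases n)
    case 0 then show ?thesis using assms \<open>j = 0\<close> by (simp add: coeff_revp PP_def)
  next
    case (Suc m) then show ?thesis using assms \<open>j = 0\<close> unfolding Suc
      by (simp only: coeff_linear_mult coeff_revp) (simp add: coeff_linear_mult PP_def)
  qed
next
  case (Suc k)
  show ?thesis
  proof (cases "Suc k \<le> n")
    case True
    then obtain m where m: "n = Suc k + m" using le_Suc_ex by blast
    show ?thesis unfolding Suc m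
      by (cases m) (simp_all only: coeff_linear_mult coeff_revp, simp_all)
  qed (simp add: Suc coeff_linear_mult coeff_revp del: mult_pCons_left)
qed

text \<open>Null vectors follow the change of variable injectively: substitution keeps degrees, and
  reversal keeps the bound n.\<close>

lemma dimM_rowT_le:
  assumes R: "\<And>r. r \<in> R \<Longrightarrow> deg1 r"
  shows "dimM q R n \<le> dimM q (rowT lam ` R) n"
proof (cases lam)
  case (Fin l)
  let ?G = "\<lambda>(x :: nat \<Rightarrow> 'a poly) i. pcompose (x i) [:l, 1:]"
  have row: "rowT lam r i = pcompose (r i) [:l, 1:]" if "deg1 r" for r i
  proof -
    have "r i = [:coeff (r i) 0, coeff (r i) 1:]" using that by (intro linear_poly_eq) (simp add: deg1_def)
    then have "pcompose (r i) [:l, 1:] = pcompose [:coeff (r i) 0, coeff (r i) 1:] [:l, 1:]" by metis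
    then show ?thesis by (simp add: rowT_def Fin pcompose_pCons mult.commute)
  qed
  have dt: "dotp q (rowT lam r) (?G x) = pcompose (dotp q r x) [:l, 1:]" if "deg1 r" for r x
    by (simp add: dotp_def row[OF that] pcompose_sum pcompose_mult)
  show ?thesis
  proof (rule dimM_le_inj[of ?G])
    show "Vector_Spaces.linear pscale pscale ?G"
      by unfold_locales (simp_all add: fun_eq_iff pcompose_add pcompose_smult)
    fix x assume x: "x \<in> MS q R n"
    have "pcompose (x i) [:l, 1:] \<in> PP n" for i
    proof -
      have "x i = 0 \<or> degree (x i) < n" using x by (simp add: MS_def PV_def PP_iff)
      then show ?thesis unfolding PP_iff by (elim disjE) (simp_all add: degree_pcompose)
    qed
    then have "?G x \<in> PV q n" using x by (simp add: MS_def PV_def)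
    moreover have "dotp q r' (?G x) = 0" if r': "r' \<in> rowT lam ` R" for r'
    proof -
      from r' obtain r where r: "r \<in> R" "r' = rowT lam r" by blast
      then show ?thesis using dt[OF R[OF r(1)], of x] x by (simp add: MS_def)
    qed
    ultimately show "?G x \<in> MS q (rowT lam ` R) n" by (simp add: MS_def)
    assume 0: "?G x = 0"
    show "x = 0"
    proof
      fix i
      have "pcompose (x i) [:l, 1:] = 0" using fun_cong[OF 0, of i] by simp
      then have "x i = 0" by (rule pcompose_eq_0) simp
      then show "x i = 0 i" by simp
    qed
  qed
next
  case Infty
  let ?G = "\<lambda>(x :: nat \<Rightarrow> 'a poly) i. revp n (x i)"
  have dt: "coeff (dotp q (rowT lam r) (?G x)) j = (if j \<le> n then coeff (dotp q r x) (n - j) else 0)"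
    if "deg1 r" "x \<in> PV q n" for r x j
  proof -
    have "coeff (rowT lam r i * revp n (x i)) j = (if j \<le> n then coeff (r i * x i) (n - j) else 0)" for i
    proof -
      have "r i = [:coeff (r i) 0, coeff (r i) 1:]" using that by (intro linear_poly_eq) (simp add: deg1_def)
      moreover have "x i \<in> PP n" using that by (simp add: PV_def)
      moreover have "rowT lam r i = [:coeff (r i) 1, coeff (r i) 0:]" by (simp add: rowT_def Infty)
      ultimately show ?thesis using coeff_linear_revp by metis
    qed
    then show ?thesis by (simp add: dotp_def coeff_sum)
  qed
  show ?thesis
  proof (rule dimM_le_inj[of ?G])
    show "Vector_Spaces.linear pscale pscale ?G"
      by unfold_locales (auto simp: fun_eq_iff poly_eq_iff coeff_revp)
    fix x assume x: "x \<in> MS q R n"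
    have pv: "x \<in> PV q n" using x by (simp add: MS_def)
    have "revp n (x i) \<in> PP n" for i by (simp add: PP_def coeff_revp)
    moreover have "revp n 0 = (0 :: 'a poly)" by (simp add: poly_eq_iff coeff_revp)
    ultimately have "?G x \<in> PV q n" using pv by (simp add: PV_def)
    moreover have "dotp q r' (?G x) = 0" if r': "r' \<in> rowT lam ` R" for r'
    proof -
      from r' obtain r where r: "r \<in> R" "r' = rowT lam r" by blast
      have "dotp q r x = 0" using x r by (simp add: MS_def)
      then show ?thesis using dt[OF R[OF r(1)] pv] by (intro poly_eqI) (simp add: r(2))
    qed
    ultimately show "?G x \<in> MS q (rowT lam ` R) n" by (simp add: MS_def)
    assume 0: "?G x = 0"
    have "coeff (x i) t = 0" for i t
    proof (cases "t < n")
      case True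
      have "coeff (revp n (x i)) (n - 1 - t) = 0" using fun_cong[OF 0, of i] by simp
      then show ?thesis using True by (simp add: coeff_revp)
    next
      case False then show ?thesis using pv by (simp add: PV_def PP_def)
    qed
    then show "x = 0" by (simp add: fun_eq_iff poly_eq_iff)
  qed
qed

lemma dimM_rowT:
  assumes R: "\<And>r. r \<in> R \<Longrightarrow> deg1 r"
  shows "dimM q (rowT lam ` R) n = dimM q R n"
proof (rule antisym)
  have "rowT (xinv lam) ` rowT lam ` R = R"
    unfolding image_image by (simp add: rowT_xinv R)
  then show "dimM q (rowT lam ` R) n \<le> dimM q R n"
    using dimM_rowT_le[of "rowT lam ` R" q n "xinv lam"] deg1_rowT by auto
qed (rule dimM_rowT_le[OF R])

text \<open>\<open>sigma\<close> is a difference of two values of \<open>dimM\<close>. Hence the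
  degree in which a row starts to act, and whether it raises the rank, are the same at every
  point.\<close>

lemma sigma_rowT:
  assumes "\<And>r. r \<in> R \<Longrightarrow> deg1 r" "deg1 r"
  shows "sigma q (rowT lam ` R) (rowT lam r) n = sigma q R r n"
proof -
  have "dimM q (rowT lam ` insert r R) n = dimM q (insert r R) n" using assms by (intro dimM_rowT) auto
  moreover have "dimM q (rowT lam ` R) n = dimM q R n" using assms by (intro dimM_rowT) auto
  ultimately show ?thesis
    using dimM_insert[of q R n r] dimM_insert[of q "rowT lam ` R" n "rowT lam r"] by simp
qed

subsection \<open>Effect of one row\<close>

text \<open>The flag records whether the additional row raises the normal rank.\<close>
definition gap :: "bool \<Rightarrow> (nat \<Rightarrow> int) \<Rightarrow> bool" where
  "gap s d \<longleftrightarrow> (if s then \<exists>a\<ge>1. (\<forall>i. 1 \<le> i \<and> i \<le> a \<longrightarrow> d i \<in> {-1..0}) \<and> (\<forall>i\<ge>a + 1. d i \<in> {0..int a})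
               else \<forall>i\<ge>1. d i \<in> {-1..0})"

lemma gap_insert:
  assumes r: "deg1 r" "\<And>r'. r' \<in> R \<Longrightarrow> deg1 r'"
  shows "gap (\<exists>n. sigma q R r n > 0) (\<lambda>i. wd q (insert r R) i - wd q R i)"
proof (cases "\<exists>n. sigma q R r n > 0")
  case True
  define a where "a = (LEAST n. sigma q R r n > 0)"
  have a: "sigma q R r a > 0" unfolding a_def using True by (rule LeastI_ex)
  have below: "sigma q R r n = 0" if "n < a" for n
    using not_less_Least[of n "\<lambda>n. sigma q R r n > 0"] that by (simp add: a_def)
  have "a \<ge> 1" using a by (cases a) auto
  moreover have "wd q (insert r R) i - wd q R i \<in> {-1..0}" if "1 \<le> i \<and> i \<le> a" for i
    by (rule wd_insert_le[OF _ _ r(1)]) (use that below in auto)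
  moreover have "wd q (insert r R) i - wd q R i \<in> {0..int a}" if "i \<ge> a + 1" for i
    by (rule wd_insert_gt[OF r a below]) (use that in auto)
  ultimately show ?thesis using True unfolding gap_def by auto
next
  case False
  then have "wd q (insert r R) i - wd q R i \<in> {-1..0}" if "i \<ge> 1" for i
    using that by (intro wd_insert_le[OF _ _ r(1)]) auto
  then show ?thesis using False unfolding gap_def by simp
qed

definition tau :: "nat \<Rightarrow> (nat \<Rightarrow> 'a::field poly) set \<Rightarrow> nat \<Rightarrow> int" where
  "tau q R i = int (dimX q R i) - int (dimX q R (i - 1))"

lemma tau_insert: "i \<ge> 1 \<Longrightarrow> tau q R i - tau q (insert r R) i \<in> {0..1}"
proof -
  assume "i \<ge> 1"
  then obtain j where "i = Suc j" by (cases i) auto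
  then show ?thesis
    using dimX_insert[of q R i r] dimX_insert[of q R j r] rho_mono_Suc[of q R r j] rho_Suc_le[of q R r j]
    by (simp add: tau_def)
qed

lemma wd_tau: "wd q R i = tau q R i - (int (dimM q R (i - 1)) - int (dimM q R (i - 2)))"
  by (simp add: wd_def tau_def)

section \<open>Dependence on the span of the rows only\<close>

lemma wd_cong_span: "ps.span R = ps.span R' \<Longrightarrow> wd q R i = wd q R' i"
  unfolding wd_def by (simp only: dimX_cong_span[of R R'] dimM_cong_span[of R R'])

lemma tau_cong_span: "ps.span R = ps.span R' \<Longrightarrow> tau q R i = tau q R' i"
  unfolding tau_def by (simp only: dimX_cong_span[of R R'])

lemma nullK_span:
  fixes R :: "(nat \<Rightarrow> 'a::field poly) set"
  shows "nullK q (ps.span R) = nullK q R"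
proof -
  have "ps.span R \<subseteq> {r. dotp q (\<lambda>i. to_fract (r i)) y = 0}" if "y \<in> nullK q R" for y
  proof (rule ps.span_minimal)
    show "R \<subseteq> {r. dotp q (\<lambda>i. to_fract (r i)) y = 0}" using that by (auto simp: nullK_def)
    have sc: "to_fract (Polynomial.smult c p) = to_fract [:c:] * to_fract p" for c :: 'a and p
      by (simp flip: to_fract_mult)
    have "dotp q (\<lambda>i. to_fract (pscale c r i)) y = to_fract [:c:] * dotp q (\<lambda>i. to_fract (r i)) y" for c r
      by (simp add: dotp_def sc sum_distrib_left mult.assoc)
    moreover have "dotp q (\<lambda>i. to_fract ((r + r') i)) y
        = dotp q (\<lambda>i. to_fract (r i)) y + dotp q (\<lambda>i. to_fract (r' i)) y" for r r'
      by (simp add: dotp_def to_fract_add distrib_right sum.distrib)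
    moreover have "dotp q (\<lambda>i. to_fract ((0 :: nat \<Rightarrow> 'a poly) i)) y = 0" by (simp add: dotp_def)
    ultimately show "ps.subspace {r. dotp q (\<lambda>i. to_fract (r i)) y = 0}"
      by (intro ps.subspaceI) (simp_all del: pscale_apply plus_fun_apply zero_fun_apply)
  qed
  then show ?thesis using ps.span_superset[of R] by (auto simp: nullK_def)
qed

lemma nullK_cong_span: "ps.span R = ps.span R' \<Longrightarrow> nullK q R = nullK q R'"
  by (metis nullK_span)

lemma MS_cong_span: "ps.span R = ps.span R' \<Longrightarrow> MS q R n = MS q R' n"
  by (metis MS_span)

text \<open>One elimination step with pivot row \<open>k\<close>. Row \<open>k\<close> itself is
  also reduced, which does no harm because the pivot stays in the set.\<close>

lemma span_eliminate:
  fixes f :: "nat \<Rightarrow> nat \<Rightarrow> 'a::field poly"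
  assumes k: "k < p"
  shows "ps.span (f ` {..<p}) = ps.span (insert (f k) ((\<lambda>r. f r - pscale (c r) (f k)) ` {..<p}))"
    (is "ps.span ?S = ps.span ?T")
  unfolding ps.span_eq
proof
  show "?S \<subseteq> ps.span ?T"
  proof clarify
    fix r assume "r < p"
    then have "(f r - pscale (c r) (f k)) + pscale (c r) (f k) \<in> ps.span ?T"
      by (intro ps.span_add ps.span_scale ps.span_base) auto
    then show "f r \<in> ps.span ?T" by simp
  qed
  have "f r - pscale (c r) (f k) \<in> ps.span ?S" if "r < p" for r
    using that k by (intro ps.span_diff ps.span_scale ps.span_base) auto
  moreover have "f k \<in> ps.span ?S" using k by (intro ps.span_base) auto
  ultimately show "?T \<subseteq> ps.span ?S" by blast
qed

subsection \<open>Pencils of normal rank one\<close>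

lemma scalar_multiple_of_root:
  fixes f c :: "'a::field poly"
  assumes "degree f = 1" "degree c \<le> 1" "poly f z = 0" "poly c z = 0"
  shows "\<exists>u. c = Polynomial.smult u f"
proof -
  obtain a b where f: "f = [:a, b:]" using linear_poly_eq[of f] assms(1) by auto
  obtain c0 c1 where c: "c = [:c0, c1:]" using linear_poly_eq[of c] assms(2) by auto
  have b: "b \<noteq> 0" using assms(1) f by auto
  have az: "a = - (z * b)" using assms(3) f by (simp add: eq_neg_iff_add_eq_0)
  have cz: "c0 = - (z * c1)" using assms(4) c by (simp add: eq_neg_iff_add_eq_0)
  have "c = Polynomial.smult (c1 / b) f" using b unfolding f c az cz by simp
  then show ?thesis by blast
qed

text \<open>If \<open>f\<close> is constant, comparing degrees shows that \<open>c\<close> or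
  \<open>w\<close> is constant. If it has degree 1, its root is a root of \<open>c\<close> or of
  \<open>w\<close>, and a polynomial of degree at most 1 sharing this root is a constant multiple of
  \<open>f\<close>.\<close>

lemma linear_factor_cases:
  fixes f c w m :: "'a::field poly"
  assumes f: "f \<noteq> 0" "degree f \<le> 1" and d: "degree c \<le> 1" "degree w \<le> 1" "degree m \<le> 1" and eq: "m * f = c * w"
  shows "(\<exists>u. c = Polynomial.smult u f) \<or> (\<exists>u. w = Polynomial.smult u f)"
proof (cases "c = 0 \<or> w = 0")
  case True
  then show ?thesis by (metis smult_0_left)
next
  case False
  then have "m \<noteq> 0" using eq by auto
  then have dg: "degree m + degree f = degree c + degree w"
    using eq f False by (metis degree_mult_eq)
  show ?thesis
  proof (cases "degree f = 0")
    case True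
    then obtain a where a: "f = [:a:]" by (rule degree_eq_zeroE)
    have const: "\<exists>u. g = Polynomial.smult u f" if dg0: "degree g = 0" for g
    proof -
      obtain b where b: "g = [:b:]" using dg0 by (rule degree_eq_zeroE)
      have "g = Polynomial.smult (b / a) f" using a b f by simp
      then show ?thesis by blast
    qed
    have "degree c = 0 \<or> degree w = 0" using dg True d by linarith
    then show ?thesis using const by blast
  next
    case False
    then have f1: "degree f = 1" using f by simp
    obtain a b where ab: "f = [:a, b:]" using linear_poly_eq[OF f(2)] by blast
    have "b \<noteq> 0" using f1 ab by auto
    then have z: "poly f (- a / b) = 0" using ab by simp
    then have "poly (c * w) (- a / b) = 0" by (simp flip: eq)
    then have "poly c (- a / b) = 0 \<or> poly w (- a / b) = 0" by simp
    then show ?thesis using scalar_multiple_of_root[OF f1 _ z] d by blast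
  qed
qed

lemma dotp_unitf: "i < q \<Longrightarrow> dotp q r (unitf i) = r i"
  by (simp add: dotp_def unitf_def if_distrib cong: if_cong)

text \<open>At a nonzero entry (a, b), row \<open>a\<close> alone already lowers the null space by
  one dimension, so every other row vanishes on the null space of row \<open>a\<close>. Evaluating
  the rows at a vector of that space supported on the coordinates i and b gives the 2 by 2
  minors.\<close>

lemma rank_one_minors:
  fixes P :: "'a::field pencil"
  assumes P: "fst P \<in> carrier_mat p q" "snd P \<in> carrier_mat p q" and rk: "normal_rank P = 1"
  obtains a b where "a < p" "prow P a b \<noteq> 0"
    "\<And>k i. k < p \<Longrightarrow> prow P k i * prow P a b = prow P k b * prow P a i"
proof -
  have pr: "dim_row (fst P) = p" using P by simp
  have n1: "q = 1 + fs.dim (nullK q (prows P))" using normal_rank_nullK[OF P] rk by simp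
  have e: "nullK q {} = FV q" by (simp add: nullK_def)
  have out: "prow P k i = 0" if "\<not> i < q" for k i using that P by (simp add: prow_def)
  have "\<exists>a<p. \<exists>b. prow P a b \<noteq> 0"
  proof (rule ccontr)
    assume "\<not> ?thesis"
    then have z: "prow P k i = 0" if "k < p" for k i using that by blast
    then have "dotp q (\<lambda>i. to_fract (r i)) y = 0" if "r \<in> prows P" for r and y :: "nat \<Rightarrow> 'a poly fract"
      using that by (auto simp: prows_def pr dotp_def)
    then have "nullK q (prows P) = FV q" by (auto simp: nullK_def)
    then show False using n1 by (simp add: dim_FV)
  qed
  then obtain a b where ab: "a < p" "prow P a b \<noteq> 0" by blast
  have bq: "b < q" using ab out by blast
  have "dotp q (\<lambda>i. to_fract (prow P a i)) (unitf b) \<noteq> 0" using ab bq by (simp add: dotp_unitf)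
  moreover have "unitf b \<in> nullK q ({} :: (nat \<Rightarrow> 'a poly) set)" using bq by (auto simp: e FV_def unitf_def)
  ultimately have E: "\<exists>y\<in>nullK q ({} :: (nat \<Rightarrow> 'a poly) set). dotp q (\<lambda>i. to_fract (prow P a i)) y \<noteq> 0"
    by (rule bexI)
  have "q = fs.dim (nullK q {prow P a}) + 1"
    using nullK_insert[of q "{}" "prow P a"] unfolding if_P[OF E] unfolding e dim_FV .
  then have dd: "fs.dim (nullK q {prow P a}) \<le> fs.dim (nullK q (prows P))" using n1 by simp
  have "prow P a \<in> prows P" using ab unfolding prows_def pr by blast
  then have "nullK q (prows P) \<subseteq> nullK q {prow P a}" by (auto simp: nullK_def)
  then have eq: "nullK q (prows P) = nullK q {prow P a}"
    by (rule fs.subspace_eq_if_dim_le[OF subspace_nullK subspace_nullK _ fd_nullK dd])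
  have "prow P k i * prow P a b = prow P k b * prow P a i" if k: "k < p" for k i
  proof (cases "i < q")
    case True
    define y where "y = fscale (to_fract (prow P a b)) (unitf i) + fscale (- to_fract (prow P a i)) (unitf b)"
    have dy: "dotp q r y = to_fract (prow P a b) * r i - to_fract (prow P a i) * r b" for r
      unfolding y_def using True bq by (simp only: dotp_add_right dotp_fscale dotp_unitf) simp
    have "y \<in> FV q" unfolding y_def
      using subspace_FV[of q] True bq by (intro fs.subspace_add fs.subspace_scale) (auto simp: FV_def unitf_def)
    then have "y \<in> nullK q {prow P a}" by (simp add: nullK_def dy mult.commute)
    then have "y \<in> nullK q (prows P)" unfolding eq .
    moreover have "prow P k \<in> prows P" using k unfolding prows_def pr by blast
    ultimately have "dotp q (\<lambda>i. to_fract (prow P k i)) y = 0" by (simp add: nullK_def)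
    then have "to_fract (prow P a b * prow P k i) = to_fract (prow P a i * prow P k b)"
      by (simp add: dy to_fract_mult)
    then have "prow P a b * prow P k i = prow P a i * prow P k b" by (simp only: to_fract_eq_iff)
    then show ?thesis by (simp only: mult.commute)
  qed (simp add: out)
  then show ?thesis using that ab by blast
qed

text \<open>Let f be a nonzero entry in row \<open>a\<close> and column \<open>b\<close>. If every
  entry of column \<open>b\<close> is a constant multiple of f, the minors make every row a constant
  multiple of row \<open>a\<close>. Otherwise the minors through an exceptional row and
  \<open>linear_factor_cases\<close> make each entry of row \<open>a\<close> a constant multiple of
  f.\<close>

lemma rank_one_pencil:
  fixes P :: "'a::field pencil"
  assumes P: "fst P \<in> carrier_mat p q" "snd P \<in> carrier_mat p q" and rk: "normal_rank P = 1"
  shows "(\<exists>u v. deg1 v \<and> (\<forall>k<p. prow P k = pscale (u k) v)) \<or>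
         (\<exists>g v. \<forall>k<p. degree (g k) \<le> 1 \<and> prow P k = (\<lambda>i. Polynomial.smult (v i) (g k)))"
proof -
  obtain a b where ab: "a < p" "prow P a b \<noteq> 0"
    and minor: "\<And>k i. k < p \<Longrightarrow> prow P k i * prow P a b = prow P k b * prow P a i"
    using rank_one_minors[OF P rk] by blast
  have d: "degree (prow P k i) \<le> 1" for k i using deg1_prow[of P k] by (simp add: deg1_def)
  show ?thesis
  proof (cases "\<forall>k<p. \<exists>u. prow P k b = Polynomial.smult u (prow P a b)")
    case True
    then obtain u where u: "\<And>k. k < p \<Longrightarrow> prow P k b = Polynomial.smult (u k) (prow P a b)" by metis
    have "prow P k = pscale (u k) (prow P a)" if k: "k < p" for k
    proof
      fix i
      have "prow P k i * prow P a b = Polynomial.smult (u k) (prow P a i) * prow P a b"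
        using minor[OF k, of i] u[OF k] by (simp add: mult.commute)
      from iffD1[OF mult_right_cancel[OF ab(2)] this]
      show "prow P k i = pscale (u k) (prow P a) i" by simp
    qed
    then show ?thesis using deg1_prow by blast
  next
    case False
    then obtain k0 where k0: "k0 < p" "\<nexists>u. prow P k0 b = Polynomial.smult u (prow P a b)" by blast
    have "\<exists>u. prow P a i = Polynomial.smult u (prow P a b)" for i
      using linear_factor_cases[OF ab(2) d d d d minor[OF k0(1), of i]] k0(2) by blast
    then obtain v where v: "\<And>i. prow P a i = Polynomial.smult (v i) (prow P a b)" by metis
    have col: "prow P k = (\<lambda>i. Polynomial.smult (v i) (prow P k b))" if k: "k < p" for k
    proof
      fix i
      have "prow P k i * prow P a b = Polynomial.smult (v i) (prow P k b) * prow P a b"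
        using minor[OF k, of i] v[of i] by simp
      from iffD1[OF mult_right_cancel[OF ab(2)] this]
      show "prow P k i = Polynomial.smult (v i) (prow P k b)" .
    qed
    show ?thesis
      by (rule disjI2, rule exI[of _ "\<lambda>k. prow P k b"], rule exI[of _ v])
        (intro allI impI conjI d; erule col)
  qed
qed

subsection \<open>Comparison of a pencil with its perturbation\<close>

text \<open>\<open>e\<close> will be the change of normal rank, read from which of the two one-row
  changes raise the rank. The last two clauses say that one more row confines the null vectors of
  one pencil to those of the other; when the other is regular, this supplies the assumption of
  \<open>dimM_Suc_le\<close>.\<close>

definition compared :: "nat \<Rightarrow> (nat \<Rightarrow> 'a::field poly) set \<Rightarrow> (nat \<Rightarrow> 'a poly) set \<Rightarrow> int \<Rightarrow> bool" where
  "compared q RA RB e \<longleftrightarrow> (\<exists>d1 d2 s1 s2. gap s1 d1 \<and> gap s2 d2 \<and> (\<forall>i. wd q RB i - wd q RA i = d1 i - d2 i)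
      \<and> e = of_bool s1 - of_bool s2)
    \<and> (\<forall>i\<ge>1. \<bar>tau q RB i - tau q RA i\<bar> \<le> 1)
    \<and> (\<exists>r. \<forall>n. MS q (insert r RB) n \<subseteq> MS q RA n)
    \<and> (\<exists>r. \<forall>n. MS q (insert r RA) n \<subseteq> MS q RB n)"

text \<open>Both pencils are reached from the common rows \<open>C\<close>: \<open>d1\<close> is the
  change on inserting \<open>b\<close> and \<open>d2\<close> the change on inserting
  \<open>a\<close>.\<close>

lemma compared_row_type:
  assumes C: "\<And>r. r \<in> C \<Longrightarrow> deg1 r" and ab: "deg1 a" "deg1 b"
    and RA: "ps.span RA = ps.span (insert a C)" and RB: "ps.span RB = ps.span (insert b C)"
  shows "compared q (rowT lam ` RA) (rowT lam ` RB)
     (int (fs.dim (nullK q RA)) - int (fs.dim (nullK q RB)))"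
proof -
  let ?C = "rowT lam ` C" and ?a = "rowT lam a" and ?b = "rowT lam b"
  have A: "ps.span (rowT lam ` RA) = ps.span (insert ?a ?C)" using rowT_span_cong[OF RA, of lam] by simp
  have B: "ps.span (rowT lam ` RB) = ps.span (insert ?b ?C)" using rowT_span_cong[OF RB, of lam] by simp
  have dC: "deg1 r" if "r \<in> ?C" for r using that deg1_rowT by blast
  have sg: "(\<exists>n. sigma q ?C (rowT lam r) n > 0) \<longleftrightarrow> (\<exists>n. sigma q C r n > 0)" if "deg1 r" for r
    using sigma_rowT[OF C that, where lam = lam and q = q] by simp
  have ga: "gap (\<exists>n. sigma q C a n > 0) (\<lambda>i. wd q (insert ?a ?C) i - wd q ?C i)"
    using gap_insert[of ?a ?C q, OF deg1_rowT dC] unfolding sg[OF ab(1)] .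
  have gb: "gap (\<exists>n. sigma q C b n > 0) (\<lambda>i. wd q (insert ?b ?C) i - wd q ?C i)"
    using gap_insert[of ?b ?C q, OF deg1_rowT dC] unfolding sg[OF ab(2)] .
  have e: "int (fs.dim (nullK q RA)) - int (fs.dim (nullK q RB))
      = of_bool (\<exists>n. sigma q C b n > 0) - of_bool (\<exists>n. sigma q C a n > 0)"
    using arg_cong[OF dim_nullK_insert[of q C a], of int] arg_cong[OF dim_nullK_insert[of q C b], of int]
    unfolding nullK_cong_span[OF RA] nullK_cong_span[OF RB] of_nat_add of_nat_of_bool by linarith
  have t: "\<bar>tau q (rowT lam ` RB) i - tau q (rowT lam ` RA) i\<bar> \<le> 1" if "i \<ge> 1" for i
    using tau_insert[OF that, of q ?C ?a] tau_insert[OF that, of q ?C ?b]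
    unfolding tau_cong_span[OF A] tau_cong_span[OF B] by auto
  have m: "MS q (insert r S) n \<subseteq> MS q S' n" if "ps.span S = ps.span (insert s ?C)" "ps.span S' = ps.span (insert r ?C)" for r s S S' n
    using MS_cong_span[OF that(1), of q n] MS_cong_span[OF that(2), of q n] by (auto simp: MS_def)
  show ?thesis unfolding compared_def
  proof (intro conjI)
    show "\<exists>d1 d2 s1 s2. gap s1 d1 \<and> gap s2 d2 \<and>
        (\<forall>i. wd q (rowT lam ` RB) i - wd q (rowT lam ` RA) i = d1 i - d2 i) \<and>
        int (fs.dim (nullK q RA)) - int (fs.dim (nullK q RB)) = of_bool s1 - of_bool s2"
      unfolding wd_cong_span[OF A] wd_cong_span[OF B] e
      by (rule exI, rule exI, rule exI, rule exI, rule conjI, rule gb, rule conjI, rule ga) simp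
    show "\<forall>i\<ge>1. \<bar>tau q (rowT lam ` RB) i - tau q (rowT lam ` RA) i\<bar> \<le> 1" using t by blast
    show "\<exists>r. \<forall>n. MS q (insert r (rowT lam ` RB)) n \<subseteq> MS q (rowT lam ` RA) n"
      by (rule exI, rule allI, rule m[OF B A])
    show "\<exists>r. \<forall>n. MS q (insert r (rowT lam ` RA)) n \<subseteq> MS q (rowT lam ` RB) n"
      by (rule exI, rule allI, rule m[OF A B])
  qed
qed

section \<open>Perturbation along a constant row vector\<close>

lemma dotp_multiple_row: "dotp q (\<lambda>i. g * v i) x = g * dotp q v x"
  by (simp add: dotp_def sum_distrib_left algebra_simps)

text \<open>Where the product with \<open>v\<close> vanishes, exactly or modulo a power of the
  variable, the rows of both pencils take the same value in the same sense.\<close>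

lemma insert_col_subset:
  fixes fA fB :: "nat \<Rightarrow> nat \<Rightarrow> 'a::field poly"
  assumes f: "\<And>k. k < p \<Longrightarrow> fB k = fA k + (\<lambda>i. g k * v i)"
  shows "XS q (insert v (fA ` {..<p})) n \<subseteq> XS q (insert v (fB ` {..<p})) n"
    "MS q (insert v (fA ` {..<p})) n \<subseteq> MS q (insert v (fB ` {..<p})) n"
    "nullK q (insert v (fA ` {..<p})) \<subseteq> nullK q (insert v (fB ` {..<p}))"
proof -
  have dt: "dotp q (fB k) x = dotp q (fA k) x + g k * dotp q v x" if "k < p" for k x
    using f[OF that] by (simp add: dotp_add_left dotp_multiple_row)
  have mz: "coeff (g k * z) j = 0" if "\<forall>j<n. coeff z j = 0" "j < n" for k j z
    using that unfolding coeff_mult by (intro sum.neutral) auto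
  show "XS q (insert v (fA ` {..<p})) n \<subseteq> XS q (insert v (fB ` {..<p})) n"
    by (auto simp: XS_def dt mz)
  show "MS q (insert v (fA ` {..<p})) n \<subseteq> MS q (insert v (fB ` {..<p})) n"
    by (auto simp: MS_def dt)
  have dk: "dotp q (\<lambda>i. to_fract (fB k i)) y
      = dotp q (\<lambda>i. to_fract (fA k i)) y + to_fract (g k) * dotp q (\<lambda>i. to_fract (v i)) y" if "k < p" for k y
    using f[OF that] by (simp add: dotp_def to_fract_add to_fract_mult algebra_simps sum.distrib sum_distrib_left)
  show "nullK q (insert v (fA ` {..<p})) \<subseteq> nullK q (insert v (fB ` {..<p}))"
    by (auto simp: nullK_def dk)
qed

lemma insert_col_eq:
  fixes fA fB :: "nat \<Rightarrow> nat \<Rightarrow> 'a::field poly"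
  assumes f: "\<And>k. k < p \<Longrightarrow> fB k = fA k + (\<lambda>i. g k * v i)"
  shows "XS q (insert v (fA ` {..<p})) n = XS q (insert v (fB ` {..<p})) n"
    "MS q (insert v (fA ` {..<p})) n = MS q (insert v (fB ` {..<p})) n"
    "nullK q (insert v (fA ` {..<p})) = nullK q (insert v (fB ` {..<p}))"
proof -
  have "fA k = fB k + (\<lambda>i. - g k * v i)" if "k < p" for k using f[OF that] by (simp add: fun_eq_iff)
  note 1 = insert_col_subset[where fA = fB and fB = fA and g = "\<lambda>k. - g k" and v = v and p = p and q = q, OF this]
  note 2 = insert_col_subset[where fA = fA and fB = fB and g = g and v = v and p = p and q = q, OF f]
  show "XS q (insert v (fA ` {..<p})) n = XS q (insert v (fB ` {..<p})) n"
    "MS q (insert v (fA ` {..<p})) n = MS q (insert v (fB ` {..<p})) n"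
    "nullK q (insert v (fA ` {..<p})) = nullK q (insert v (fB ` {..<p}))"
    using 1 2 by (blast intro: subset_antisym)+
qed

text \<open>At infinity \<open>rowT\<close> sends the constant row to the variable times that row,
  which has the same exact null vectors but imposes less modulo a power. The comparison modulo
  powers needs the constant row itself, so its \<open>sigma\<close> is treated separately.\<close>

lemma sigma_rowT_const:
  assumes R: "\<And>r. r \<in> R \<Longrightarrow> deg1 r"
  shows "sigma q (rowT lam ` R) (\<lambda>i. [:v i:]) n = sigma q R (\<lambda>i. [:v i:]) n"
proof (cases lam)
  case (Fin l)
  have "rowT lam (\<lambda>i. [:v i:]) = (\<lambda>i. [:v i:])" by (simp add: rowT_def Fin)
  then show ?thesis using sigma_rowT[of R "\<lambda>i. [:v i:]" q lam n, OF R] by (simp add: deg1_def)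
next
  case Infty
  have T: "rowT lam (\<lambda>i. [:v i:]) = (\<lambda>i. [:0, 1:] * [:v i:])" by (simp add: rowT_def Infty)
  have "MS q (insert (rowT lam (\<lambda>i. [:v i:])) S) n = MS q (insert (\<lambda>i. [:v i:]) S) n" for S
  proof -
    have "dotp q (rowT lam (\<lambda>i. [:v i:])) x = 0 \<longleftrightarrow> dotp q (\<lambda>i. [:v i:]) x = 0" for x
      unfolding T dotp_multiple_row by simp
    then show ?thesis by (simp add: MS_def)
  qed
  then have "sigma q (rowT lam ` R) (\<lambda>i. [:v i:]) n = sigma q (rowT lam ` R) (rowT lam (\<lambda>i. [:v i:])) n"
    using dimM_insert[of q "rowT lam ` R" n "\<lambda>i. [:v i:]"]
      dimM_insert[of q "rowT lam ` R" n "rowT lam (\<lambda>i. [:v i:])"] by (simp add: dimM_def)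
  then show ?thesis using sigma_rowT[of R "\<lambda>i. [:v i:]" q lam n, OF R] by (simp add: deg1_def)
qed

text \<open>Inserting \<open>v\<close> gives the same spaces for both pencils, so the way from one
  to the other leads up by \<open>v\<close> and down again. Thus \<open>d1\<close> is the change on
  inserting \<open>v\<close> into the first pencil and \<open>d2\<close> that for the second,
  whereas in the row case the common set lies below both.\<close>

lemma compared_col_type:
  fixes fA fB :: "nat \<Rightarrow> nat \<Rightarrow> 'a::field poly"
  assumes d: "\<And>k. deg1 (fA k)" "\<And>k. deg1 (fB k)"
    and f: "\<And>k. k < p \<Longrightarrow> fB k = fA k + (\<lambda>i. Polynomial.smult (v i) (g k))"
  shows "compared q (rowT lam ` fA ` {..<p}) (rowT lam ` fB ` {..<p})
     (int (fs.dim (nullK q (fA ` {..<p}))) - int (fs.dim (nullK q (fB ` {..<p}))))"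
proof -
  let ?v = "\<lambda>i. [:v i:]"
  let ?A = "(\<lambda>k. rowT lam (fA k)) ` {..<p}" and ?B = "(\<lambda>k. rowT lam (fB k)) ` {..<p}"
  have im: "rowT lam ` fA ` {..<p} = ?A" "rowT lam ` fB ` {..<p} = ?B" by (simp_all add: image_image)
  \<comment> \<open>The column factor is moved to 0 like a row entry, while the constants
    \<open>v\<close> are unaffected.\<close>
  define g' where "g' k = (case lam of Fin l \<Rightarrow> [:coeff (g k) 0 + l * coeff (g k) 1, coeff (g k) 1:]
     | Infty \<Rightarrow> [:coeff (g k) 1, coeff (g k) 0:])" for k
  have f0: "fB k = fA k + (\<lambda>i. g k * ?v i)" if "k < p" for k
    using f[OF that] by (simp add: mult.commute)
  have f1: "rowT lam (fB k) = rowT lam (fA k) + (\<lambda>i. g' k * ?v i)" if "k < p" for k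
  proof -
    interpret l: Vector_Spaces.linear pscale pscale "rowT lam" by (rule linear_rowT)
    have "rowT lam (\<lambda>i. Polynomial.smult (v i) (g k)) = (\<lambda>i. g' k * ?v i)"
      by (auto simp: rowT_def g'_def fun_eq_iff algebra_simps split: xpt.splits)
    then show ?thesis unfolding f[OF that] l.add by simp
  qed
  note eq = insert_col_eq[where fA = "\<lambda>k. rowT lam (fA k)" and fB = "\<lambda>k. rowT lam (fB k)" and v = ?v and g = g' and p = p and q = q, OF f1]
  have dv: "deg1 ?v" by (simp add: deg1_def)
  have dA: "deg1 r" if "r \<in> ?A" for r using that deg1_rowT by auto
  have dB: "deg1 r" if "r \<in> ?B" for r using that deg1_rowT by auto
  have dA0: "deg1 r" if "r \<in> fA ` {..<p}" for r using that d by auto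
  have dB0: "deg1 r" if "r \<in> fB ` {..<p}" for r using that d by auto
  have sA: "sigma q ?A ?v n = sigma q (fA ` {..<p}) ?v n" for n
    using sigma_rowT_const[of "fA ` {..<p}" q lam v n, OF dA0] im by simp
  have sB: "sigma q ?B ?v n = sigma q (fB ` {..<p}) ?v n" for n
    using sigma_rowT_const[of "fB ` {..<p}" q lam v n, OF dB0] im by simp
  have ga: "gap (\<exists>n. sigma q (fA ` {..<p}) ?v n > 0) (\<lambda>i. wd q (insert ?v ?A) i - wd q ?A i)"
    using gap_insert[of ?v ?A q, OF dv dA] unfolding sA .
  have gb: "gap (\<exists>n. sigma q (fB ` {..<p}) ?v n > 0) (\<lambda>i. wd q (insert ?v ?B) i - wd q ?B i)"
    using gap_insert[of ?v ?B q, OF dv dB] unfolding sB .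
  have X1: "dimX q (insert ?v ?A) i = dimX q (insert ?v ?B) i" for i
    unfolding dimX_def using eq(1)[of i] by simp
  have X2: "dimM q (insert ?v ?A) i = dimM q (insert ?v ?B) i" for i
    unfolding dimM_def using eq(2)[of i] by simp
  note X = X1 X2
  have W: "wd q (insert ?v ?A) i = wd q (insert ?v ?B) i" for i unfolding wd_def X ..
  have T: "tau q (insert ?v ?A) i = tau q (insert ?v ?B) i" for i unfolding tau_def X ..
  have "nullK q (insert ?v (fA ` {..<p})) = nullK q (insert ?v (fB ` {..<p}))"
    by (rule insert_col_eq(3)[where g = g, OF f0])
  then have e: "int (fs.dim (nullK q (fA ` {..<p}))) - int (fs.dim (nullK q (fB ` {..<p})))
      = of_bool (\<exists>n. sigma q (fA ` {..<p}) ?v n > 0) - of_bool (\<exists>n. sigma q (fB ` {..<p}) ?v n > 0)"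
    using dim_nullK_insert[of q "fA ` {..<p}" ?v] dim_nullK_insert[of q "fB ` {..<p}" ?v] by simp
  have t: "\<bar>tau q ?B i - tau q ?A i\<bar> \<le> 1" if "i \<ge> 1" for i
    using tau_insert[OF that, of q ?A ?v] tau_insert[OF that, of q ?B ?v] T[of i] by auto
  show ?thesis unfolding compared_def im
  proof (intro conjI)
    show "\<exists>d1 d2 s1 s2. gap s1 d1 \<and> gap s2 d2 \<and> (\<forall>i. wd q ?B i - wd q ?A i = d1 i - d2 i) \<and>
        int (fs.dim (nullK q (fA ` {..<p}))) - int (fs.dim (nullK q (fB ` {..<p}))) = of_bool s1 - of_bool s2"
      unfolding e
      by (rule exI, rule exI, rule exI, rule exI, rule conjI, rule ga, rule conjI, rule gb) (simp add: W)
    show "\<forall>i\<ge>1. \<bar>tau q ?B i - tau q ?A i\<bar> \<le> 1" using t by blast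
    show "\<exists>r. \<forall>n. MS q (insert r ?B) n \<subseteq> MS q ?A n"
    proof (intro exI[of _ ?v] allI)
      fix n
      have "MS q (insert ?v ?A) n \<subseteq> MS q ?A n" by (auto simp: MS_def)
      with eq(2)[of n] show "MS q (insert ?v ?B) n \<subseteq> MS q ?A n" by simp
    qed
    show "\<exists>r. \<forall>n. MS q (insert r ?A) n \<subseteq> MS q ?B n"
    proof (intro exI[of _ ?v] allI)
      fix n
      have "MS q (insert ?v ?B) n \<subseteq> MS q ?B n" by (auto simp: MS_def)
      with eq(2)[of n] show "MS q (insert ?v ?A) n \<subseteq> MS q ?B n" by simp
    qed
  qed
qed

section \<open>Application to the perturbed pencil\<close>

lemma pencil_add_carrier:
  assumes "fst A \<in> carrier_mat p q" "snd A \<in> carrier_mat p q" "fst P \<in> carrier_mat p q" "snd P \<in> carrier_mat p q"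
  shows "fst (pencil_add A P) \<in> carrier_mat p q" "snd (pencil_add A P) \<in> carrier_mat p q"
  using assms by (simp_all add: pencil_add_def)

lemma compared_perturbation:
  fixes A P :: "'a::field pencil"
  assumes A: "fst A \<in> carrier_mat p q" "snd A \<in> carrier_mat p q"
    and P: "fst P \<in> carrier_mat p q" "snd P \<in> carrier_mat p q" and rk: "normal_rank P = 1"
  shows "compared q (prows (at_pt lam A)) (prows (at_pt lam (pencil_add A P)))
     (int (normal_rank (pencil_add A P)) - int (normal_rank A))"
proof -
  let ?B = "pencil_add A P"
  note B = pencil_add_carrier[OF A P]
  have pr: "dim_row (fst A) = p" "dim_row (fst ?B) = p" using A B by simp_all
  have pB: "prow ?B k = prow A k + prow P k" if "k < p" for k
    using A P that by (auto simp: prow_def pencil_add_def fun_eq_iff)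
  have rank: "int (normal_rank ?B) - int (normal_rank A)
      = int (fs.dim (nullK q (prows A))) - int (fs.dim (nullK q (prows ?B)))"
    using normal_rank_nullK[OF A] normal_rank_nullK[OF B] by linarith
  consider (row) u v where "deg1 v" "\<And>k. k < p \<Longrightarrow> prow P k = pscale (u k) v"
    | (col) g v where "\<And>k. k < p \<Longrightarrow> prow P k = (\<lambda>i. Polynomial.smult (v i) (g k))"
    using rank_one_pencil[OF P rk] by blast
  then show ?thesis
  proof cases
    case row
    obtain C a b where C: "\<And>r. r \<in> C \<Longrightarrow> deg1 r" "deg1 a" "deg1 b"
      "ps.span (prows A) = ps.span (insert a C)" "ps.span (prows ?B) = ps.span (insert b C)"
    proof (cases "\<exists>k<p. u k \<noteq> 0")
      case True
      then obtain k where k: "k < p" "u k \<noteq> 0" by blast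
      \<comment> \<open>These combinations cancel the contribution of \<open>v\<close>, so they are
        the same for \<open>A\<close> and for the perturbed pencil.\<close>
      define C where "C = (\<lambda>r. prow A r - pscale (u r / u k) (prow A k)) ` {..<p}"
      have "prow ?B r - pscale (u r / u k) (prow ?B k) = prow A r - pscale (u r / u k) (prow A k)" if "r < p" for r
        using pB[OF that] pB[OF k(1)] row(2)[OF that] row(2)[OF k(1)] k(2)
        by (simp add: fun_eq_iff smult_add_right)
      then have CB: "C = (\<lambda>r. prow ?B r - pscale (u r / u k) (prow ?B k)) ` {..<p}"
        unfolding C_def by (intro image_cong) auto
      have "deg1 r" if rC: "r \<in> C" for r
      proof -
        from rC obtain r0 where r0: "r = prow A r0 - pscale (u r0 / u k) (prow A k)" unfolding C_def by blast
        have "degree (prow A j i) \<le> 1" for j i using deg1_prow[of A j] by (simp add: deg1_def)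
        then show ?thesis unfolding r0 deg1_def
          by (auto intro!: degree_diff_le order_trans[OF degree_smult_le])
      qed
      moreover have "ps.span (prows A) = ps.span (insert (prow A k) C)"
        unfolding prows_def pr C_def by (rule span_eliminate[OF k(1)])
      moreover have "ps.span (prows ?B) = ps.span (insert (prow ?B k) C)"
        unfolding prows_def pr CB by (rule span_eliminate[OF k(1)])
      ultimately show ?thesis using that deg1_prow by blast
    next
      \<comment> \<open>Both pencils have the same rows, and the zero row takes the place of the two
        single rows.\<close>
      case False
      have "prow ?B r = prow A r" if "r < p" for r
        using pB[OF that] row(2)[OF that] False that by (simp add: fun_eq_iff)
      then have "prows ?B = prows A" unfolding prows_def pr by (intro image_cong) auto
      moreover have "deg1 r" if "r \<in> prows A" for r using that deg1_prow unfolding prows_def by blast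
      moreover have "deg1 (0 :: nat \<Rightarrow> 'a poly)" by (simp add: deg1_def)
      ultimately show ?thesis using that[of "prows A" 0 0] ps.span_insert_0[of "prows A"] by simp
    qed
    show ?thesis unfolding prows_at_pt[OF A] prows_at_pt[OF B] rank
      by (rule compared_row_type[OF C])
  next
    case col
    have f: "prow ?B k = prow A k + (\<lambda>i. Polynomial.smult (v i) (g k))" if "k < p" for k
      using pB[OF that] col[OF that] by simp
    show ?thesis unfolding prows_at_pt[OF A] prows_at_pt[OF B] rank
      unfolding prows_def pr by (rule compared_col_type[OF deg1_prow deg1_prow f])
  qed
qed

text \<open>\<open>RA\<close> contributes no null vectors. Those of \<open>RB\<close> are pairwise
  proportional over the rational functions, so from the first bound \<open>a\<close> that admits one
  their dimension grows by exactly 1: up to a the difference is that of \<open>tau\<close>,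
  afterwards that of \<open>tau\<close> minus 1.\<close>

lemma regular_against_singular:
  assumes 0: "\<And>n. dimM q RA n = 0" and pos: "\<exists>n. dimM q RB n > 0"
    and t: "\<forall>i\<ge>1. \<bar>tau q RB i - tau q RA i\<bar> \<le> 1"
    and r: "\<exists>r. \<forall>n. MS q (insert r RB) n \<subseteq> MS q RA n"
  shows "\<exists>a\<ge>1. (\<forall>i. 1 \<le> i \<and> i \<le> a \<longrightarrow> wd q RB i - wd q RA i \<in> {-1..1})
    \<and> (\<forall>i\<ge>a + 1. wd q RB i - wd q RA i \<in> {-2..0})"
proof -
  define a where "a = (LEAST n. dimM q RB n > 0)"
  have a: "dimM q RB a > 0" unfolding a_def using pos by (rule LeastI_ex)
  have below: "dimM q RB n = 0" if "n < a" for n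
    using not_less_Least[of n "\<lambda>n. dimM q RB n > 0"] that by (simp add: a_def)
  obtain r where r: "\<And>n. MS q (insert r RB) n \<subseteq> MS q RA n" using r by blast
  have "MS q RA n = {0}" for n
    using 0[of n] ps.dim_eq_0_fd[OF subspace_MS fd_MS, of q RA n] by (simp add: dimM_def)
  then have "MS q (insert r RB) n \<subseteq> {0}" for n using r by blast
  note up = dimM_Suc_le[OF this]
  have w: "wd q RB i - wd q RA i = (tau q RB i - tau q RA i) - (int (dimM q RB (i - 1)) - int (dimM q RB (i - 2)))" for i
    by (simp add: wd_tau 0)
  have a1: "a \<ge> 1" using a by (cases a) auto
  have "wd q RB i - wd q RA i \<in> {-1..1}" if "1 \<le> i \<and> i \<le> a" for i
    using t[rule_format, of i] that below[of "i - 1"] below[of "i - 2"] a1 unfolding w by auto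
  moreover have "wd q RB i - wd q RA i \<in> {-2..0}" if "i \<ge> a + 1" for i
  proof -
    define j where "j = i - 2"
    have j: "i - 1 = Suc j" "i - 2 = j" using that a1 by (auto simp: j_def)
    have "dimM q RB (Suc j) = Suc (dimM q RB j)"
    proof (cases "Suc j = a")
      case True
      then show ?thesis using a below[of j] up[of j] by simp
    next
      case False
      then have "a \<le> j" using that j by linarith
      then have "dimM q RB j > 0" using a dimM_mono[of a j q RB] by simp
      then show ?thesis using dimM_Suc_gt[of q RB j] up[of j] by simp
    qed
    then show ?thesis using t[rule_format, of i] that unfolding w j by auto
  qed
  ultimately show ?thesis using a1 by blast
qed

theorem theorem5p4:
  fixes A P :: "'a::alg_closed_field pencil" and p q :: nat and lam :: "'a xpt"
  assumes "fst A \<in> carrier_mat p q" and "snd A \<in> carrier_mat p q"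
    and "fst P \<in> carrier_mat p q" and "snd P \<in> carrier_mat p q"
    and "normal_rank P = 1"
  defines "D \<equiv> (\<lambda>i. weyr (pencil_add A P) lam i - weyr A lam i)"
  shows
    "(regular_pencil A \<and> regular_pencil (pencil_add A P) \<longrightarrow>
        (\<forall>i\<ge>1. -1 \<le> D i \<and> D i \<le> 1))
   \<and> (regular_pencil A \<and> \<not> regular_pencil (pencil_add A P) \<longrightarrow>
        (\<exists>a::nat. a \<ge> 1 \<and> (\<forall>i. 1 \<le> i \<and> i \<le> a \<longrightarrow> -1 \<le> D i \<and> D i \<le> 1)
                 \<and> (\<forall>i\<ge>a+1. -2 \<le> D i \<and> D i \<le> 0)))
   \<and> (\<not> regular_pencil A \<and> regular_pencil (pencil_add A P) \<longrightarrow>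
        (\<exists>a::nat. a \<ge> 1 \<and> (\<forall>i. 1 \<le> i \<and> i \<le> a \<longrightarrow> -1 \<le> D i \<and> D i \<le> 1)
                 \<and> (\<forall>i\<ge>a+1. 0 \<le> D i \<and> D i \<le> 2)))
   \<and> (\<not> regular_pencil A \<and> \<not> regular_pencil (pencil_add A P) \<longrightarrow>
        (normal_rank A = normal_rank (pencil_add A P) \<and>
           col_min_indices A = col_min_indices (pencil_add A P) \<longrightarrow>
           (\<forall>i\<ge>1. -1 \<le> D i \<and> D i \<le> 1))
      \<and> (normal_rank A = normal_rank (pencil_add A P) \<and>
           col_min_indices A \<noteq> col_min_indices (pencil_add A P) \<longrightarrow>
           (\<exists>a b::nat. 1 \<le> a \<and> a < b
              \<and> (\<forall>i. 1 \<le> i \<and> i \<le> a \<longrightarrow> -1 \<le> D i \<and> D i \<le> 1)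
              \<and> (\<forall>i. a+1 \<le> i \<and> i \<le> b \<longrightarrow> - int (a+1) \<le> D i \<and> D i \<le> int (a+1))
              \<and> (\<forall>i\<ge>b+1. - int b \<le> D i \<and> D i \<le> int b)))
      \<and> (normal_rank A < normal_rank (pencil_add A P) \<longrightarrow>
           (\<exists>a::nat. a \<ge> 1 \<and> (\<forall>i. 1 \<le> i \<and> i \<le> a \<longrightarrow> -1 \<le> D i \<and> D i \<le> 1)
                    \<and> (\<forall>i\<ge>a+1. 0 \<le> D i \<and> D i \<le> int (a+1))))
      \<and> (normal_rank A > normal_rank (pencil_add A P) \<longrightarrow>
           (\<exists>a::nat. a \<ge> 1 \<and> (\<forall>i. 1 \<le> i \<and> i \<le> a \<longrightarrow> -1 \<le> D i \<and> D i \<le> 1)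
                    \<and> (\<forall>i\<ge>a+1. - int (a+1) \<le> D i \<and> D i \<le> 0))))"
proof -
  note A = assms(1,2) and P = assms(3,4)
  let ?B = "pencil_add A P"
  note B = pencil_add_carrier[OF A P]
  define RA RB where "RA = prows (at_pt lam A)" and "RB = prows (at_pt lam ?B)"
  have D: "D i = wd q RB i - wd q RA i" if "i \<ge> 1" for i
    unfolding D_def RA_def RB_def using weyr_eq_wd[OF A that] weyr_eq_wd[OF B that] by simp
  have cmp: "compared q RA RB (int (normal_rank ?B) - int (normal_rank A))"
    unfolding RA_def RB_def by (rule compared_perturbation[OF A P assms(5)])
  have t: "\<forall>i\<ge>1. \<bar>tau q RB i - tau q RA i\<bar> \<le> 1"
    and rB: "\<exists>r. \<forall>n. MS q (insert r RB) n \<subseteq> MS q RA n"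
    and rA: "\<exists>r. \<forall>n. MS q (insert r RA) n \<subseteq> MS q RB n"
    and ex: "\<exists>d1 d2 s1 s2. gap s1 d1 \<and> gap s2 d2 \<and> (\<forall>i. wd q RB i - wd q RA i = d1 i - d2 i)
      \<and> int (normal_rank ?B) - int (normal_rank A) = of_bool s1 - of_bool s2"
    using cmp unfolding compared_def by - (elim conjE, assumption)+
  obtain d1 d2 s1 s2 where g1: "gap s1 d1" and g2: "gap s2 d2" and wd: "\<And>i. wd q RB i - wd q RA i = d1 i - d2 i"
    and rk: "int (normal_rank ?B) - int (normal_rank A) = of_bool s1 - of_bool s2"
    using ex by blast
  have Dd: "D i = d1 i - d2 i" if "i \<ge> 1" for i using D[OF that] wd by simp
  \<comment> \<open>The null-vector dimensions at \<open>lam\<close> are those of the pencil itself,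
    so they can be related to the normal rank and the minimal indices.\<close>
  have dM: "dimM q (prows (at_pt lam X)) n = dimM q (prows X) n"
    if X: "fst X \<in> carrier_mat p q" "snd X \<in> carrier_mat p q" for X :: "'a pencil" and n
    unfolding prows_at_pt[OF X] by (rule dimM_rowT) (auto simp only: prows_def deg1_prow)
  have reg: "p = q \<and> (\<forall>n. dimM q (prows (at_pt lam X)) n = 0)"
    if X: "fst X \<in> carrier_mat p q" "snd X \<in> carrier_mat p q" and "regular_pencil X" for X :: "'a pencil"
  proof -
    have pq: "p = q" "normal_rank X = q" using that by (auto simp: regular_pencil_def)
    then have "fs.dim (nullK q (prows X)) = 0" using normal_rank_nullK[OF X] by simp
    then have "dimM q (prows X) n = 0" for n using dim_nullK_pos[of q "prows X"] by simp
    then show ?thesis using pq dM[OF X] by simp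
  qed
  \<comment> \<open>For a square pencil, singular means normal rank below \<open>q\<close>;
    squareness will come from the regularity of the other pencil.\<close>
  have sing: "\<exists>n. dimM q (prows (at_pt lam X)) n > 0"
    if X: "fst X \<in> carrier_mat p q" "snd X \<in> carrier_mat p q" and "\<not> regular_pencil X" "p = q" for X :: "'a pencil"
  proof -
    have "normal_rank X \<noteq> q" using that by (auto simp: regular_pencil_def)
    then have "fs.dim (nullK q (prows X)) > 0" using normal_rank_nullK[OF X] by simp
    then show ?thesis using dim_nullK_pos[of q "prows X"] dM[OF X] by simp
  qed
  \<comment> \<open>With equal null-vector dimensions only the increments of t remain.\<close>
  have Dtau: "-1 \<le> D i \<and> D i \<le> 1" if "\<And>n. dimM q RA n = dimM q RB n" "i \<ge> 1" for i
    using t[rule_format, OF that(2)] D[OF that(2)] that(1) by (auto simp: wd_tau)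
  have 1: "\<forall>i\<ge>1. -1 \<le> D i \<and> D i \<le> 1" if "regular_pencil A" "regular_pencil ?B"
    using reg[OF A that(1)] reg[OF B that(2)] Dtau by (simp add: RA_def RB_def)
  have 2: "\<exists>a::nat. a \<ge> 1 \<and> (\<forall>i. 1 \<le> i \<and> i \<le> a \<longrightarrow> -1 \<le> D i \<and> D i \<le> 1) \<and> (\<forall>i\<ge>a+1. -2 \<le> D i \<and> D i \<le> 0)"
    if h: "regular_pencil A" "\<not> regular_pencil ?B"
  proof -
    have "dimM q RA n = 0" for n using reg[OF A h(1)] by (simp add: RA_def)
    moreover have "\<exists>n. dimM q RB n > 0" using sing[OF B h(2)] reg[OF A h(1)] by (simp add: RB_def)
    ultimately obtain a where a: "a \<ge> 1" "\<forall>i. 1 \<le> i \<and> i \<le> a \<longrightarrow> wd q RB i - wd q RA i \<in> {-1..1}"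
      "\<forall>i\<ge>a + 1. wd q RB i - wd q RA i \<in> {-2..0}"
      using regular_against_singular[OF _ _ t rB] by blast
    show ?thesis using a D by (intro exI[of _ a]) auto
  qed
  have 3: "\<exists>a::nat. a \<ge> 1 \<and> (\<forall>i. 1 \<le> i \<and> i \<le> a \<longrightarrow> -1 \<le> D i \<and> D i \<le> 1) \<and> (\<forall>i\<ge>a+1. 0 \<le> D i \<and> D i \<le> 2)"
    if h: "\<not> regular_pencil A" "regular_pencil ?B"
  proof -
    have t': "\<forall>i\<ge>1. \<bar>tau q RA i - tau q RB i\<bar> \<le> 1" using t by (simp add: abs_minus_commute)
    have "dimM q RB n = 0" for n using reg[OF B h(2)] by (simp add: RB_def)
    moreover have "\<exists>n. dimM q RA n > 0" using sing[OF A h(1)] reg[OF B h(2)] by (simp add: RA_def)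
    ultimately obtain a where a: "a \<ge> 1" "\<forall>i. 1 \<le> i \<and> i \<le> a \<longrightarrow> wd q RA i - wd q RB i \<in> {-1..1}"
      "\<forall>i\<ge>a + 1. wd q RA i - wd q RB i \<in> {-2..0}"
      using regular_against_singular[OF _ _ t' rA] by blast
    have sw: "D i = - (wd q RA i - wd q RB i)" if "i \<ge> 1" for i using D[OF that] by simp
    have "-1 \<le> D i \<and> D i \<le> 1" if "1 \<le> i \<and> i \<le> a" for i
      using a(2)[rule_format, OF that] sw[of i] that by auto
    moreover have "0 \<le> D i \<and> D i \<le> 2" if "i \<ge> a + 1" for i
      using a(3)[rule_format, OF that] sw[of i] that by auto
    ultimately show ?thesis using a(1) by blast
  qed
  have 4: "\<forall>i\<ge>1. -1 \<le> D i \<and> D i \<le> 1" if "col_min_indices A = col_min_indices ?B"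
  proof -
    have "dimM q RA n = dimM q RB n" for n
      unfolding RA_def RB_def dM[OF A] dM[OF B] dimM_col_min_indices[OF A] dimM_col_min_indices[OF B] that ..
    then show ?thesis using Dtau by blast
  qed
  have 5: "\<exists>a b::nat. 1 \<le> a \<and> a < b
      \<and> (\<forall>i. 1 \<le> i \<and> i \<le> a \<longrightarrow> -1 \<le> D i \<and> D i \<le> 1)
      \<and> (\<forall>i. a+1 \<le> i \<and> i \<le> b \<longrightarrow> - int (a+1) \<le> D i \<and> D i \<le> int (a+1))
      \<and> (\<forall>i\<ge>b+1. - int b \<le> D i \<and> D i \<le> int b)" if eqr: "normal_rank A = normal_rank ?B"
  proof (cases s1)
    case False
    then have "\<not> s2" using rk eqr by (cases s2) auto
    \<comment> \<open>Neither row raises the rank, so both changes lie between -1 and 0 throughout,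
      and any pair of thresholds will do; 1 and 2 are taken.\<close>
    have D1: "-1 \<le> D i \<and> D i \<le> 1" if "i \<ge> 1" for i
      using g1 g2 False \<open>\<not> s2\<close> Dd[OF that] that by (fastforce simp: gap_def)
    have "- int (1 + 1) \<le> D i \<and> D i \<le> int (1 + 1)" if "1 + 1 \<le> i \<and> i \<le> 2" for i
      using D1[of i] that by simp
    moreover have "- int 2 \<le> D i \<and> D i \<le> int 2" if "i \<ge> 2 + 1" for i
      using D1[of i] that by simp
    moreover have "(1::nat) \<le> 1 \<and> (1::nat) < 2" by simp
    ultimately show ?thesis using D1 by blast
  next
    case True
    then have "s2" using rk eqr by (cases s2) auto
    obtain a where a: "a \<ge> 1" "\<And>i. 1 \<le> i \<and> i \<le> a \<Longrightarrow> d1 i \<in> {-1..0}" "\<And>i. i \<ge> a + 1 \<Longrightarrow> d1 i \<in> {0..int a}"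
      using g1 True by (auto simp: gap_def)
    obtain b where b: "b \<ge> 1" "\<And>i. 1 \<le> i \<and> i \<le> b \<Longrightarrow> d2 i \<in> {-1..0}" "\<And>i. i \<ge> b + 1 \<Longrightarrow> d2 i \<in> {0..int b}"
      using g2 \<open>s2\<close> by (auto simp: gap_def)
    \<comment> \<open>\<open>M\<close> has to exceed \<open>m\<close> also when the two thresholds
      coincide.\<close>
    define m M where "m = min a b" and "M = max (max a b) (m + 1)"
    have "-1 \<le> D i \<and> D i \<le> 1" if i: "1 \<le> i \<and> i \<le> m" for i
      using a(2)[of i] b(2)[of i] Dd[of i] i by (auto simp: m_def)
    moreover have "- int (m+1) \<le> D i \<and> D i \<le> int (m+1)" if i: "m+1 \<le> i \<and> i \<le> M" for i
    proof -
      \<comment> \<open>For unequal thresholds only the change with the smaller one has passed it,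
        and lies between 0 and \<open>m\<close>; the other has absolute value at most 1. For equal
        thresholds both changes lie between 0 and \<open>m\<close>.\<close>
      have ab: "(d1 i \<in> {-1..0} \<and> i \<le> a) \<or> (d1 i \<in> {0..int a} \<and> i \<ge> a + 1)"
        "(d2 i \<in> {-1..0} \<and> i \<le> b) \<or> (d2 i \<in> {0..int b} \<and> i \<ge> b + 1)"
        using a(2)[of i] a(3)[of i] b(2)[of i] b(3)[of i] i by linarith+
      show ?thesis using ab Dd[of i] i by (auto simp: m_def M_def min_def max_def split: if_splits)
    qed
    moreover have "- int M \<le> D i \<and> D i \<le> int M" if i: "i \<ge> M + 1" for i
    proof -
      have "a + 1 \<le> i" "b + 1 \<le> i" "int a \<le> int M" "int b \<le> int M" using i by (auto simp: M_def)
      then show ?thesis using a(3)[of i] b(3)[of i] Dd[of i] i by auto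
    qed
    moreover have "1 \<le> m" "m < M" using a(1) b(1) by (auto simp: m_def M_def)
    ultimately show ?thesis by blast
  qed
  have 6: "\<exists>a::nat. a \<ge> 1 \<and> (\<forall>i. 1 \<le> i \<and> i \<le> a \<longrightarrow> -1 \<le> D i \<and> D i \<le> 1)
      \<and> (\<forall>i\<ge>a+1. 0 \<le> D i \<and> D i \<le> int (a+1))" if lt: "normal_rank A < normal_rank ?B"
  proof -
    \<comment> \<open>The rank changes by the difference of the two flags, so a rise fixes both. The
      extra 1 in the bound a + 1 comes from the second change.\<close>
    have s: "s1" "\<not> s2" using rk lt by (cases s1; cases s2; simp)+
    obtain a where a: "a \<ge> 1" "\<And>i. 1 \<le> i \<and> i \<le> a \<Longrightarrow> d1 i \<in> {-1..0}" "\<And>i. i \<ge> a + 1 \<Longrightarrow> d1 i \<in> {0..int a}"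
      using g1 s by (auto simp: gap_def)
    have d2: "d2 i \<in> {-1..0}" if "i \<ge> 1" for i using g2 s that by (simp add: gap_def)
    have "-1 \<le> D i \<and> D i \<le> 1" if i: "1 \<le> i \<and> i \<le> a" for i
      using a(2)[of i] d2[of i] Dd[of i] i by auto
    moreover have "0 \<le> D i \<and> D i \<le> int (a+1)" if i: "i \<ge> a + 1" for i
      using a(3)[of i] d2[of i] Dd[of i] i by auto
    ultimately show ?thesis using a(1) by blast
  qed
  have 7: "\<exists>a::nat. a \<ge> 1 \<and> (\<forall>i. 1 \<le> i \<and> i \<le> a \<longrightarrow> -1 \<le> D i \<and> D i \<le> 1)
      \<and> (\<forall>i\<ge>a+1. - int (a+1) \<le> D i \<and> D i \<le> 0)" if lt: "normal_rank A > normal_rank ?B"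
  proof -
    have s: "\<not> s1" "s2" using rk lt by (cases s1; cases s2; simp)+
    obtain a where a: "a \<ge> 1" "\<And>i. 1 \<le> i \<and> i \<le> a \<Longrightarrow> d2 i \<in> {-1..0}" "\<And>i. i \<ge> a + 1 \<Longrightarrow> d2 i \<in> {0..int a}"
      using g2 s by (auto simp: gap_def)
    have d1: "d1 i \<in> {-1..0}" if "i \<ge> 1" for i using g1 s that by (simp add: gap_def)
    have "-1 \<le> D i \<and> D i \<le> 1" if i: "1 \<le> i \<and> i \<le> a" for i
      using a(2)[of i] d1[of i] Dd[of i] i by auto
    moreover have "- int (a+1) \<le> D i \<and> D i \<le> 0" if i: "i \<ge> a + 1" for i
      using a(3)[of i] d1[of i] Dd[of i] i by auto
    ultimately show ?thesis using a(1) by blast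
  qed
  show ?thesis
    by (intro conjI impI; elim conjE; ((rule 1, assumption+) | (rule 2, assumption+) | (rule 3, assumption+)
        | (rule 4, assumption) | (rule 5, assumption) | (rule 6, assumption) | (rule 7, assumption)))
qed

end
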